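(* Let $H$ be a Hopf algebra over $k$, and let $A\subseteq H_{par}$ be the subalgebra generated by the elements $\varepsilon_h=[h_{(1)}][S(h_{(2)})]$, $h\in H$. There exists a partial action of $H$ on $A$ such that $H_{par}\simeq\underline{A\# H}$ as algebras, where $\underline{A\# H}$ is the partial smash product.
   Context: $k$ is a commutative ring; all algebras are associative unital $k$-algebras. $H$ is a Hopf algebra over $k$ with Sweedler notation $\Delta(h)=h_{(1)}\otimes h_{(2)}$ and antipode $S$. $H_{par}$ is the quotient of the tensor algebra $T(H)$ by the ideal generated by the elements, for all $h,l\in H$: $1_H-1_{T(H)}$; $h\otimes l_{(1)}\otimes S(l_{(2)})-hl_{(1)}\otimes S(l_{(2)})$; $h_{(1)}\otimes S(h_{(2)})\otimes l-h_{(1)}\otimes S(h_{(2)})l$; $h\otimes S(l_{(1)})\otimes l_{(2)}-hS(l_{(1)})\otimes l_{(2)}$; $S(h_{(1)})\otimes h_{(2)}\otimes l-S(h_{(1)})\otimes h_{(2)}l$. The class of $h\in H$ in $H_{par}$ is denoted $[h]$. A (left) partial action of $H$ on a unital algebra $A$ is a linear map $H\otimes A\to A$, $h\otimes a\mapsto h\cdot a$, such that for all $h,l\in H$, $a,b\in A$: $1_H\cdot a=a$; $h\cdot(ab)=(h_{(1)}\cdot a)(h_{(2)}\cdot b)$; $h\cdot(l\cdot a)=(h_{(1)}\cdot 1_A)(h_{(2)}l\cdot a)$. Given a partial action of $H$ on $A$, the product $(a\otimes h)(b\otimes l)=a(h_{(1)}\cdot b)\otimes h_{(2)}l$ on $A\otimes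 H$ is associative, and the partial smash product is the unital algebra $\underline{A\# H}=(A\otimes H)(1_A\otimes 1_H)$; it is spanned by the elements $a\# h=a(h_{(1)}\cdot 1_A)\otimes h_{(2)}$ and has unit $1_A\#1_H$. *)

theory Defs
  imports "HOL-Algebra.Module" "HOL-Algebra.QuotRing" "HOL-Algebra.Subrings"
begin

section \<open>Modules and algebras over a commutative ring\<close>

text \<open>
  Algebras are records of type \<open>module\<close>: multiplication and unit are the ring fields, the
  scalar multiplication is \<open>smult\<close>.  The locale \<open>algebra\<close> of the library is restricted to
  commutative algebras.  For mere modules the fields \<open>mult\<close> and \<open>one\<close> carry no meaning.
\<close>

locale assoc_algebra = module R A + ring A for R and A (structure) +
  assumes smult_mult_left:
      "\<lbrakk>c \<in> carrier R; x \<in> carrier A; y \<in> carrier A\<rbrakk>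
        \<Longrightarrow> (c \<odot>\<^bsub>A\<^esub> x) \<otimes>\<^bsub>A\<^esub> y = c \<odot>\<^bsub>A\<^esub> (x \<otimes>\<^bsub>A\<^esub> y)"
    and smult_mult_right:
      "\<lbrakk>c \<in> carrier R; x \<in> carrier A; y \<in> carrier A\<rbrakk>
        \<Longrightarrow> x \<otimes>\<^bsub>A\<^esub> (c \<odot>\<^bsub>A\<^esub> y) = c \<odot>\<^bsub>A\<^esub> (x \<otimes>\<^bsub>A\<^esub> y)"

definition mod_hom :: "'k ring \<Rightarrow> ('k, 'a, 'u) module_scheme \<Rightarrow> ('k, 'b, 'v) module_scheme
    \<Rightarrow> ('a \<Rightarrow> 'b) set" where
  "mod_hom R M N = {f \<in> carrier M \<rightarrow> carrier N.
     (\<forall>x\<in>carrier M. \<forall>y\<in>carrier M. f (x \<oplus>\<^bsub>M\<^esub> y) = f x \<oplus>\<^bsub>N\<^esub> f y) \<and>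
     (\<forall>c\<in>carrier R. \<forall>x\<in>carrier M. f (c \<odot>\<^bsub>M\<^esub> x) = c \<odot>\<^bsub>N\<^esub> f x)}"

definition alg_hom :: "'k ring \<Rightarrow> ('k, 'a, 'u) module_scheme \<Rightarrow> ('k, 'b, 'v) module_scheme
    \<Rightarrow> ('a \<Rightarrow> 'b) set" where
  "alg_hom R A B = ring_hom A B \<inter> mod_hom R A B"

definition alg_iso :: "'k ring \<Rightarrow> ('k, 'a, 'u) module_scheme \<Rightarrow> ('k, 'b, 'v) module_scheme
    \<Rightarrow> ('a \<Rightarrow> 'b) set" where
  "alg_iso R A B = {f \<in> alg_hom R A B. bij_betw f (carrier A) (carrier B)}"

definition subalg :: "'k ring \<Rightarrow> ('k, 'a, 'u) module_scheme \<Rightarrow> 'a set \<Rightarrow> bool" where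
  "subalg R A B \<longleftrightarrow> subring B A \<and> submodule B R A"

definition gen_subalg :: "'k ring \<Rightarrow> ('k, 'a, 'u) module_scheme \<Rightarrow> 'a set \<Rightarrow> 'a set" where
  "gen_subalg R A E = \<Inter>{B. subalg R A B \<and> E \<subseteq> B}"

definition gen_submodule :: "'k ring \<Rightarrow> ('k, 'a, 'u) module_scheme \<Rightarrow> 'a set \<Rightarrow> 'a set" where
  "gen_submodule R M E = \<Inter>{N. submodule N R M \<and> E \<subseteq> N}"

definition scalar_alg :: "'k ring \<Rightarrow> ('k, 'k) module" where
  "scalar_alg R = ring.extend R (module.fields (\<lambda>c x. c \<otimes>\<^bsub>R\<^esub> x))"

text \<open>
  The quotient of a module by a submodule, and likewise of an algebra by a two-sided ideal:
  \<open>FactRing\<close> together with the induced scalar multiplication.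
\<close>

definition quot :: "('k, 'a) module \<Rightarrow> 'a set \<Rightarrow> ('k, 'a set) module" where
  "quot M N = ring.extend (M Quot N)
     (module.fields (\<lambda>c E. \<Union>x\<in>E. N +>\<^bsub>M\<^esub> (c \<odot>\<^bsub>M\<^esub> x)))"

section \<open>Free modules, tensor products and tensor algebras\<close>

definition free_mod :: "'k ring \<Rightarrow> 'x set \<Rightarrow> ('k, 'x \<Rightarrow> 'k) module" where
  "free_mod R E =
    \<lparr>carrier = {p. (\<forall>x. p x \<in> carrier R) \<and> {x. p x \<noteq> \<zero>\<^bsub>R\<^esub>} \<subseteq> E \<and> finite {x. p x \<noteq> \<zero>\<^bsub>R\<^esub>}},
     mult = undefined, one = undefined,
     zero = (\<lambda>x. \<zero>\<^bsub>R\<^esub>), add = (\<lambda>p q x. p x \<oplus>\<^bsub>R\<^esub> q x),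
     smult = (\<lambda>c p x. c \<otimes>\<^bsub>R\<^esub> p x)\<rparr>"

definition single :: "'k ring \<Rightarrow> 'x \<Rightarrow> 'x \<Rightarrow> 'k" where
  "single R x = (\<lambda>y. if y = x then \<one>\<^bsub>R\<^esub> else \<zero>\<^bsub>R\<^esub>)"

definition tensor_rels :: "'k ring \<Rightarrow> ('k, 'a, 'u) module_scheme \<Rightarrow> ('k, 'b, 'v) module_scheme
    \<Rightarrow> ('a \<times> 'b \<Rightarrow> 'k) set" where
  "tensor_rels R M N = (let F = free_mod R (carrier M \<times> carrier N); e = single R in
     gen_submodule R F (
       {e (x \<oplus>\<^bsub>M\<^esub> x', y) \<ominus>\<^bsub>F\<^esub> (e (x, y) \<oplus>\<^bsub>F\<^esub> e (x', y)) | x x' y.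
          x \<in> carrier M \<and> x' \<in> carrier M \<and> y \<in> carrier N} \<union>
       {e (x, y \<oplus>\<^bsub>N\<^esub> y') \<ominus>\<^bsub>F\<^esub> (e (x, y) \<oplus>\<^bsub>F\<^esub> e (x, y')) | x y y'.
          x \<in> carrier M \<and> y \<in> carrier N \<and> y' \<in> carrier N} \<union>
       {e (c \<odot>\<^bsub>M\<^esub> x, y) \<ominus>\<^bsub>F\<^esub> (c \<odot>\<^bsub>F\<^esub> e (x, y)) | c x y.
          c \<in> carrier R \<and> x \<in> carrier M \<and> y \<in> carrier N} \<union>
       {e (x, c \<odot>\<^bsub>N\<^esub> y) \<ominus>\<^bsub>F\<^esub> (c \<odot>\<^bsub>F\<^esub> e (x, y)) | c x y.
          c \<in> carrier R \<and> x \<in> carrier M \<and> y \<in> carrier N}))"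

definition tensor :: "'k ring \<Rightarrow> ('k, 'a, 'u) module_scheme \<Rightarrow> ('k, 'b, 'v) module_scheme
    \<Rightarrow> ('k, ('a \<times> 'b \<Rightarrow> 'k) set) module" where
  "tensor R M N = quot (free_mod R (carrier M \<times> carrier N)) (tensor_rels R M N)"

definition tens :: "'k ring \<Rightarrow> ('k, 'a, 'u) module_scheme \<Rightarrow> ('k, 'b, 'v) module_scheme
    \<Rightarrow> 'a \<Rightarrow> 'b \<Rightarrow> ('a \<times> 'b \<Rightarrow> 'k) set" where
  "tens R M N x y = tensor_rels R M N +>\<^bsub>free_mod R (carrier M \<times> carrier N)\<^esub> single R (x, y)"

text \<open>
  The value at \<open>t\<close> of the linear map with values in \<open>P\<close> induced on a tensor product by a map
  \<open>f\<close> of two variables, computed on a representative of the coset \<open>t\<close>.  This is independent of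
  the representative whenever \<open>f\<close> is bilinear, and it is only used in that case.
\<close>

definition tensor_lift :: "('k, 'p, 'w) module_scheme \<Rightarrow> 'k ring \<Rightarrow> ('a \<Rightarrow> 'b \<Rightarrow> 'p)
    \<Rightarrow> ('a \<times> 'b \<Rightarrow> 'k) set \<Rightarrow> 'p" where
  "tensor_lift P R f t = (let p = (SOME p. p \<in> t) in
     \<Oplus>\<^bsub>P\<^esub>z\<in>{z. p z \<noteq> \<zero>\<^bsub>R\<^esub>}. p z \<odot>\<^bsub>P\<^esub> f (fst z) (snd z))"

definition tensor_alg :: "'k ring \<Rightarrow> ('k, 'a, 'u) module_scheme \<Rightarrow> ('k, 'b, 'v) module_scheme
    \<Rightarrow> ('k, ('a \<times> 'b \<Rightarrow> 'k) set) module" where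
  "tensor_alg R A B = (tensor R A B)
    \<lparr>mult := (\<lambda>t u. tensor_lift (tensor R A B) R (\<lambda>a b. tensor_lift (tensor R A B) R
         (\<lambda>a' b'. tens R A B (a \<otimes>\<^bsub>A\<^esub> a') (b \<otimes>\<^bsub>B\<^esub> b')) u) t),
     one := tens R A B \<one>\<^bsub>A\<^esub> \<one>\<^bsub>B\<^esub>\<rparr>"

text \<open>
  The free associative algebra on a set: finitely supported functions on words, with the
  multiplication extending concatenation.
\<close>

definition free_alg :: "'k ring \<Rightarrow> 'x set \<Rightarrow> ('k, 'x list \<Rightarrow> 'k) module" where
  "free_alg R E = (free_mod R (lists E))
    \<lparr>mult := (\<lambda>p q w. \<Oplus>\<^bsub>R\<^esub>i\<in>{..length w}. p (take i w) \<otimes>\<^bsub>R\<^esub> q (drop i w)),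
     one := single R []\<rparr>"

text \<open>
  The free module on words of length \<open>n\<close> modulo the multilinearity relations is the \<open>n\<close>-th
  tensor power, and the multilinearity relations of all degrees together span the ideal
  generated by the linearity relations between words of length one.  So the following is the
  direct sum of all tensor powers of \<open>M\<close>, with concatenation as multiplication.
\<close>

definition tensor_algebra_rels :: "'k ring \<Rightarrow> ('k, 'a, 'u) module_scheme
    \<Rightarrow> ('a list \<Rightarrow> 'k) set" where
  "tensor_algebra_rels R M = (let F = free_alg R (carrier M); e = (\<lambda>x. single R [x]) in
     Idl\<^bsub>F\<^esub> (
       {e (x \<oplus>\<^bsub>M\<^esub> y) \<ominus>\<^bsub>F\<^esub> (e x \<oplus>\<^bsub>F\<^esub> e y) | x y. x \<in> carrier M \<and> y \<in> carrier M} \<union>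
       {e (c \<odot>\<^bsub>M\<^esub> x) \<ominus>\<^bsub>F\<^esub> (c \<odot>\<^bsub>F\<^esub> e x) | c x. c \<in> carrier R \<and> x \<in> carrier M}))"

definition tensor_algebra :: "'k ring \<Rightarrow> ('k, 'a, 'u) module_scheme
    \<Rightarrow> ('k, ('a list \<Rightarrow> 'k) set) module" where
  "tensor_algebra R M = quot (free_alg R (carrier M)) (tensor_algebra_rels R M)"

definition tensor_algebra_in :: "'k ring \<Rightarrow> ('k, 'a, 'u) module_scheme \<Rightarrow> 'a
    \<Rightarrow> ('a list \<Rightarrow> 'k) set" where
  "tensor_algebra_in R M x = tensor_algebra_rels R M +>\<^bsub>free_alg R (carrier M)\<^esub> single R [x]"

section \<open>Hopf algebras\<close>

record ('k, 'h) hopf = "('k, 'h) module" +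
  comult :: "'h \<Rightarrow> ('h \<times> 'h \<Rightarrow> 'k) set"
  counit :: "'h \<Rightarrow> 'k"
  antipode :: "'h \<Rightarrow> 'h"

text \<open>
  \<open>sweedler P R H f h\<close> is the Sweedler sum of \<open>f h\<^sub>1 h\<^sub>2\<close> in \<open>P\<close>, for a bilinear map \<open>f\<close>.
\<close>

definition sweedler :: "('k, 'p, 'w) module_scheme \<Rightarrow> 'k ring \<Rightarrow> ('k, 'h, 'z) hopf_scheme
    \<Rightarrow> ('h \<Rightarrow> 'h \<Rightarrow> 'p) \<Rightarrow> 'h \<Rightarrow> 'p" where
  "sweedler P R H f h = tensor_lift P R f (comult H h)"

text \<open>
  In \<open>coassoc\<close>, both sides are elements of \<open>H \<otimes> (H \<otimes> H)\<close>:
  \<open>(h\<^sub>1)\<^sub>1 \<otimes> ((h\<^sub>1)\<^sub>2 \<otimes> h\<^sub>2) = h\<^sub>1 \<otimes> \<Delta>(h\<^sub>2)\<close>.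
\<close>

locale hopf_algebra = assoc_algebra R H
  for R :: "'k ring" and H :: "('k, 'h) hopf" (structure) +
  assumes comult_hom: "comult H \<in> alg_hom R H (tensor_alg R H H)"
    and counit_hom: "counit H \<in> alg_hom R H (scalar_alg R)"
    and coassoc: "h \<in> carrier H \<Longrightarrow>
      sweedler (tensor R H (tensor R H H)) R H
        (\<lambda>x z. sweedler (tensor R H (tensor R H H)) R H
          (\<lambda>x1 x2. tens R H (tensor R H H) x1 (tens R H H x2 z)) x) h
      = sweedler (tensor R H (tensor R H H)) R H
        (\<lambda>x z. tens R H (tensor R H H) x (comult H z)) h"
    and counit_left: "h \<in> carrier H \<Longrightarrow> sweedler H R H (\<lambda>x y. counit H x \<odot>\<^bsub>H\<^esub> y) h = h"
    and counit_right: "h \<in> carrier H \<Longrightarrow> sweedler H R H (\<lambda>x y. counit H y \<odot>\<^bsub>H\<^esub> x) h = h"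
    and antipode_hom: "antipode H \<in> mod_hom R H H"
    and antipode_left: "h \<in> carrier H \<Longrightarrow>
      sweedler H R H (\<lambda>x y. antipode H x \<otimes>\<^bsub>H\<^esub> y) h = counit H h \<odot>\<^bsub>H\<^esub> \<one>\<^bsub>H\<^esub>"
    and antipode_right: "h \<in> carrier H \<Longrightarrow>
      sweedler H R H (\<lambda>x y. x \<otimes>\<^bsub>H\<^esub> antipode H y) h = counit H h \<odot>\<^bsub>H\<^esub> \<one>\<^bsub>H\<^esub>"

section \<open>The algebra \<open>H\<^sub>p\<^sub>a\<^sub>r\<close>\<close>

definition par_rels :: "'k ring \<Rightarrow> ('k, 'h) hopf \<Rightarrow> ('h list \<Rightarrow> 'k) set set" where
  "par_rels R H =
    (let T = tensor_algebra R H; i = tensor_algebra_in R H; S = antipode H in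
     Idl\<^bsub>T\<^esub> (
       {i \<one>\<^bsub>H\<^esub> \<ominus>\<^bsub>T\<^esub> \<one>\<^bsub>T\<^esub>} \<union>
       {sweedler T R H (\<lambda>x y. i h \<otimes>\<^bsub>T\<^esub> i x \<otimes>\<^bsub>T\<^esub> i (S y)) l
          \<ominus>\<^bsub>T\<^esub> sweedler T R H (\<lambda>x y. i (h \<otimes>\<^bsub>H\<^esub> x) \<otimes>\<^bsub>T\<^esub> i (S y)) l
         | h l. h \<in> carrier H \<and> l \<in> carrier H} \<union>
       {sweedler T R H (\<lambda>x y. i x \<otimes>\<^bsub>T\<^esub> i (S y) \<otimes>\<^bsub>T\<^esub> i l) h
          \<ominus>\<^bsub>T\<^esub> sweedler T R H (\<lambda>x y. i x \<otimes>\<^bsub>T\<^esub> i (S y \<otimes>\<^bsub>H\<^esub> l)) h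
         | h l. h \<in> carrier H \<and> l \<in> carrier H} \<union>
       {sweedler T R H (\<lambda>x y. i h \<otimes>\<^bsub>T\<^esub> i (S x) \<otimes>\<^bsub>T\<^esub> i y) l
          \<ominus>\<^bsub>T\<^esub> sweedler T R H (\<lambda>x y. i (h \<otimes>\<^bsub>H\<^esub> S x) \<otimes>\<^bsub>T\<^esub> i y) l
         | h l. h \<in> carrier H \<and> l \<in> carrier H} \<union>
       {sweedler T R H (\<lambda>x y. i (S x) \<otimes>\<^bsub>T\<^esub> i y \<otimes>\<^bsub>T\<^esub> i l) h
          \<ominus>\<^bsub>T\<^esub> sweedler T R H (\<lambda>x y. i (S x) \<otimes>\<^bsub>T\<^esub> i (y \<otimes>\<^bsub>H\<^esub> l)) h
         | h l. h \<in> carrier H \<and> l \<in> carrier H}))"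

definition H_par :: "'k ring \<Rightarrow> ('k, 'h) hopf \<Rightarrow> ('k, ('h list \<Rightarrow> 'k) set set) module" where
  "H_par R H = quot (tensor_algebra R H) (par_rels R H)"

definition par_class :: "'k ring \<Rightarrow> ('k, 'h) hopf \<Rightarrow> 'h \<Rightarrow> ('h list \<Rightarrow> 'k) set set" where
  "par_class R H h = par_rels R H +>\<^bsub>tensor_algebra R H\<^esub> tensor_algebra_in R H h"

definition par_eps :: "'k ring \<Rightarrow> ('k, 'h) hopf \<Rightarrow> 'h \<Rightarrow> ('h list \<Rightarrow> 'k) set set" where
  "par_eps R H h = sweedler (H_par R H) R H
     (\<lambda>x y. par_class R H x \<otimes>\<^bsub>H_par R H\<^esub> par_class R H (antipode H y)) h"

definition A_par :: "'k ring \<Rightarrow> ('k, 'h) hopf \<Rightarrow> ('k, ('h list \<Rightarrow> 'k) set set) module" where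
  "A_par R H = (H_par R H)
    \<lparr>carrier := gen_subalg R (H_par R H) (par_eps R H ` carrier H)\<rparr>"


section \<open>Partial actions and partial smash products\<close>

definition act_on :: "'k ring \<Rightarrow> ('k, 'h) hopf \<Rightarrow> ('k, 'a) module
    \<Rightarrow> (('h \<times> 'a \<Rightarrow> 'k) set \<Rightarrow> 'a) \<Rightarrow> 'h \<Rightarrow> 'a \<Rightarrow> 'a" where
  "act_on R H A \<alpha> h a = \<alpha> (tens R H A h a)"

locale partial_action = H: hopf_algebra R H + A: assoc_algebra R A
  for R :: "'k ring" and H :: "('k, 'h) hopf" and A :: "('k, 'a) module"
    and \<alpha> :: "('h \<times> 'a \<Rightarrow> 'k) set \<Rightarrow> 'a" +
  assumes act_hom: "\<alpha> \<in> mod_hom R (tensor R H A) A"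
    and act_one: "a \<in> carrier A \<Longrightarrow> act_on R H A \<alpha> \<one>\<^bsub>H\<^esub> a = a"
    and act_mult: "\<lbrakk>h \<in> carrier H; a \<in> carrier A; b \<in> carrier A\<rbrakk> \<Longrightarrow>
      act_on R H A \<alpha> h (a \<otimes>\<^bsub>A\<^esub> b) =
      sweedler A R H (\<lambda>x y. act_on R H A \<alpha> x a \<otimes>\<^bsub>A\<^esub> act_on R H A \<alpha> y b) h"
    and act_act: "\<lbrakk>h \<in> carrier H; l \<in> carrier H; a \<in> carrier A\<rbrakk> \<Longrightarrow>
      act_on R H A \<alpha> h (act_on R H A \<alpha> l a) =
      sweedler A R H
        (\<lambda>x y. act_on R H A \<alpha> x \<one>\<^bsub>A\<^esub> \<otimes>\<^bsub>A\<^esub> act_on R H A \<alpha> (y \<otimes>\<^bsub>H\<^esub> l) a) h"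

definition smash_mult :: "'k ring \<Rightarrow> ('k, 'h) hopf \<Rightarrow> ('k, 'a) module
    \<Rightarrow> (('h \<times> 'a \<Rightarrow> 'k) set \<Rightarrow> 'a)
    \<Rightarrow> ('a \<times> 'h \<Rightarrow> 'k) set \<Rightarrow> ('a \<times> 'h \<Rightarrow> 'k) set \<Rightarrow> ('a \<times> 'h \<Rightarrow> 'k) set" where
  "smash_mult R H A \<alpha> t u = (let Q = tensor R A H in
     tensor_lift Q R (\<lambda>a h. tensor_lift Q R (\<lambda>b l.
       sweedler Q R H
         (\<lambda>x y. tens R A H (a \<otimes>\<^bsub>A\<^esub> act_on R H A \<alpha> x b) (y \<otimes>\<^bsub>H\<^esub> l)) h) u) t)"

definition partial_smash :: "'k ring \<Rightarrow> ('k, 'h) hopf \<Rightarrow> ('k, 'a) module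
    \<Rightarrow> (('h \<times> 'a \<Rightarrow> 'k) set \<Rightarrow> 'a) \<Rightarrow> ('k, ('a \<times> 'h \<Rightarrow> 'k) set) module" where
  "partial_smash R H A \<alpha> = (tensor R A H)
    \<lparr>carrier := (\<lambda>t. smash_mult R H A \<alpha> t (tens R A H \<one>\<^bsub>A\<^esub> \<one>\<^bsub>H\<^esub>)) ` carrier (tensor R A H),
     mult := smash_mult R H A \<alpha>,
     one := sweedler (tensor R A H) R H
       (\<lambda>x y. tens R A H (\<one>\<^bsub>A\<^esub> \<otimes>\<^bsub>A\<^esub> act_on R H A \<alpha> x \<one>\<^bsub>A\<^esub>) y) \<one>\<^bsub>H\<^esub>\<rparr>"

end

theory Submission
  imports Defs
begin

text \<open>
  The map \<open>h \<mapsto> [h]\<close> is the universal partial representation of \<open>H\<close>, so the algebra is done for an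
  arbitrary partial representation \<open>\<pi>\<close> in an algebra \<open>B\<close> (locale \<open>partial_rep\<close>), with base algebra
  \<open>A\<close> generated by the elements \<open>\<epsilon>\<^sub>h = \<pi>(h\<^sub>1) \<pi>(S h\<^sub>2)\<close>.

  \<^bold>\<open>The action.\<close>  Put \<open>h \<rhd> b = \<pi>(h\<^sub>1) b \<pi>(S h\<^sub>2)\<close>.  This is not compatible with products on all of \<open>B\<close>,
  but it is on \<open>A\<close>: the elements \<open>\<epsilon>'\<^sub>h = \<pi>(S h\<^sub>1) \<pi>(h\<^sub>2)\<close> commute with every \<open>\<epsilon>\<^sub>k\<close>
  (\<open>e'_e_commute\<close>) and hence with \<open>A\<close>, and \<open>\<pi>(h\<^sub>1) \<epsilon>'\<^sub>h\<^sub>2 = \<pi>(h)\<close>, so that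
  \<open>(h\<^sub>1 \<rhd> a)(h\<^sub>2 \<rhd> b) = \<pi>(h\<^sub>1) a \<epsilon>'\<^sub>h\<^sub>2 b \<pi>(S h\<^sub>3) = \<pi>(h\<^sub>1) ab \<pi>(S h\<^sub>2) = h \<rhd> ab\<close>.  In the same way one
  obtains the other laws of a partial action, the symmetric law
  \<open>h \<rhd> (l \<rhd> a) = (h\<^sub>1 l \<rhd> a)(h\<^sub>2 \<rhd> 1)\<close>, and the rule \<open>\<pi>(h) b \<pi>(l) = (h\<^sub>1 \<rhd> b) \<pi>(h\<^sub>2 l)\<close>
  (\<open>SB_act_pi_mult\<close>), which says that \<open>\<Phi>(a \<otimes> h) = a \<pi>(h)\<close> turns smash products into products.

  \<^bold>\<open>The inverse of \<open>\<Phi>\<close>.\<close>  A map out of \<open>H\<^sub>p\<^sub>a\<^sub>r\<close> comes from a partial representation.  By the two laws for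
  \<open>h \<rhd> (l \<rhd> a)\<close>, the operators \<open>a \<mapsto> h \<rhd> a\<close> form a partial representation of \<open>H\<close> on \<open>A\<close>
  (\<open>rho_partial_rep\<close>), and tensoring it with the left regular representation of \<open>H\<close> gives another
  one, \<open>L\<^sub>h(b \<otimes> l) = (h\<^sub>1 \<rhd> b) \<otimes> h\<^sub>2 l\<close>, on \<open>A \<otimes> H\<close> (\<open>tensor_partial_rep\<close>).  Thus \<open>H\<^sub>p\<^sub>a\<^sub>r\<close> acts on
  \<open>A \<otimes> H\<close>; put \<open>\<psi>(x) = x \<cdot> (1 \<otimes> 1)\<close>.  An element \<open>a\<close> of \<open>A\<close> acts by multiplication on the first
  factor, because \<open>k\<^sub>1 \<rhd> (S k\<^sub>2 \<rhd> b) = \<epsilon>\<^sub>k b\<close>.  Hence \<open>a \<pi>(h)\<close> acts as left smash multiplication by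
  \<open>a \<otimes> h\<close>, that is, \<open>\<psi>(\<Phi>(t) y) = t \<psi>(y)\<close>.  Moreover \<open>\<Phi>(\<psi>(x)) = x\<close>, because \<open>\<Phi>(L\<^sub>h t) = \<pi>(h) \<Phi>(t)\<close> and
  \<open>H\<^sub>p\<^sub>a\<^sub>r\<close> is generated by the classes.  These two identities finish the proof (\<open>smash_iso\<close>): \<open>\<psi>\<close> is injective,
  it is multiplicative by \<open>t = \<psi>(x)\<close>, and its image is \<open>(A \<otimes> H)(1 \<otimes> 1)\<close> by \<open>y = 1\<close>.

  \<^bold>\<open>Sweedler sums.\<close>  For a chosen representative of \<open>\<Delta>(h)\<close>, a Sweedler sum is a finite linear combination
  of values; so it can be moved through linear maps and past other Sweedler sums.  The Hopf algebra
  axioms, in contrast, hold for sums of multilinear expressions only.  The rules collected in \<open>lin\<close>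
  and its extensions prove the multilinearity that each step requires.  In the calculations, \<open>SW_coassoc\<close>
  rebrackets, and \<open>SW_cancel_left\<close> and \<open>SW_cancel_right\<close> remove adjacent factors \<open>S(h\<^sub>i) h\<^sub>i\<^sub>+\<^sub>1\<close> or
  \<open>h\<^sub>i S(h\<^sub>i\<^sub>+\<^sub>1)\<close>.
\<close>

section \<open>Linear maps and submodules\<close>

lemma mod_homI:
  assumes "\<And>x. x \<in> carrier M \<Longrightarrow> f x \<in> carrier N"
    and "\<And>x y. \<lbrakk>x \<in> carrier M; y \<in> carrier M\<rbrakk> \<Longrightarrow> f (x \<oplus>\<^bsub>M\<^esub> y) = f x \<oplus>\<^bsub>N\<^esub> f y"
    and "\<And>c x. \<lbrakk>c \<in> carrier R; x \<in> carrier M\<rbrakk> \<Longrightarrow> f (c \<odot>\<^bsub>M\<^esub> x) = c \<odot>\<^bsub>N\<^esub> f x"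
  shows "f \<in> mod_hom R M N"
  using assms by (auto simp: mod_hom_def)

lemma mod_hom_closed: "\<lbrakk>f \<in> mod_hom R M N; x \<in> carrier M\<rbrakk> \<Longrightarrow> f x \<in> carrier N"
  and mod_hom_add: "\<lbrakk>f \<in> mod_hom R M N; x \<in> carrier M; y \<in> carrier M\<rbrakk>
    \<Longrightarrow> f (x \<oplus>\<^bsub>M\<^esub> y) = f x \<oplus>\<^bsub>N\<^esub> f y"
  and mod_hom_smult: "\<lbrakk>f \<in> mod_hom R M N; c \<in> carrier R; x \<in> carrier M\<rbrakk>
    \<Longrightarrow> f (c \<odot>\<^bsub>M\<^esub> x) = c \<odot>\<^bsub>N\<^esub> f x"
  by (auto simp: mod_hom_def)

lemma mod_hom_zero:
  assumes "module R M" "module R N" "f \<in> mod_hom R M N"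
  shows "f \<zero>\<^bsub>M\<^esub> = \<zero>\<^bsub>N\<^esub>"
proof -
  interpret M: module R M by fact
  interpret N: module R N by fact
  have "f (\<zero>\<^bsub>R\<^esub> \<odot>\<^bsub>M\<^esub> \<zero>\<^bsub>M\<^esub>) = \<zero>\<^bsub>R\<^esub> \<odot>\<^bsub>N\<^esub> f \<zero>\<^bsub>M\<^esub>"
    using assms(3) by (intro mod_hom_smult) auto
  then show ?thesis using mod_hom_closed[OF assms(3) M.zero_closed] by simp
qed

lemma mod_hom_minus:
  assumes "module R M" "module R N" "f \<in> mod_hom R M N" "x \<in> carrier M" "y \<in> carrier M"
  shows "f (x \<ominus>\<^bsub>M\<^esub> y) = f x \<ominus>\<^bsub>N\<^esub> f y"
proof -
  interpret M: module R M by fact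
  interpret N: module R N by fact
  have c: "f x \<in> carrier N" "f y \<in> carrier N"
    using assms(4,5) by (auto intro: mod_hom_closed[OF assms(3)])
  have "x = (x \<ominus>\<^bsub>M\<^esub> y) \<oplus>\<^bsub>M\<^esub> y"
    using assms by (simp add: a_minus_def M.M.add.m_assoc M.M.l_neg)
  then have "f x = f (x \<ominus>\<^bsub>M\<^esub> y) \<oplus>\<^bsub>N\<^esub> f y"
    using mod_hom_add[OF assms(3), of "x \<ominus>\<^bsub>M\<^esub> y" y] assms by auto
  moreover have "f (x \<ominus>\<^bsub>M\<^esub> y) \<in> carrier N"
    using assms by (auto intro: mod_hom_closed)
  ultimately show ?thesis
    using c by (simp add: a_minus_def N.M.add.m_assoc N.M.r_neg)
qed

lemma mod_hom_finsum:
  assumes "module R M" "module R N" "f \<in> mod_hom R M N" "g \<in> A \<rightarrow> carrier M"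
  shows "f (finsum M g A) = finsum N (\<lambda>x. f (g x)) A"
proof -
  interpret M: module R M by fact
  interpret N: module R N by fact
  show ?thesis
    using assms(4)
  proof (induction A rule: infinite_finite_induct)
    case (infinite A)
    then show ?case using mod_hom_zero[OF assms(1-3)] by simp
  next
    case empty
    then show ?case using mod_hom_zero[OF assms(1-3)] by simp
  next
    case (insert x F)
    then have "f (finsum M g (insert x F)) = f (g x \<oplus>\<^bsub>M\<^esub> finsum M g F)"
      by (subst M.finsum_insert) (auto simp: Pi_def)
    also have "\<dots> = f (g x) \<oplus>\<^bsub>N\<^esub> finsum N (\<lambda>x. f (g x)) F"
      using insert by (subst mod_hom_add[OF assms(3)]) (auto simp: Pi_def)
    also have "\<dots> = finsum N (\<lambda>x. f (g x)) (insert x F)"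
      using insert mod_hom_closed[OF assms(3)] by (subst N.finsum_insert) (auto simp: Pi_def)
    finally show ?case .
  qed
qed

lemma mod_hom_id: "(\<lambda>x. x) \<in> mod_hom R M M"
  by (auto simp: mod_hom_def)

lemma mod_hom_compose:
  "\<lbrakk>f \<in> mod_hom R M N; g \<in> mod_hom R N P\<rbrakk> \<Longrightarrow> (\<lambda>x. g (f x)) \<in> mod_hom R M P"
  by (auto simp: mod_hom_def Pi_def)

lemma mod_hom_cong:
  assumes "module R M" "f \<in> mod_hom R M N" "\<And>x. x \<in> carrier M \<Longrightarrow> g x = f x"
  shows "g \<in> mod_hom R M N"
proof -
  interpret M: module R M by fact
  show ?thesis using assms(2,3) by (auto simp: mod_hom_def Pi_def)
qed

lemma mod_hom_fun_smult:
  assumes "module R N" "f \<in> mod_hom R M N" "c \<in> carrier R"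
  shows "(\<lambda>x. c \<odot>\<^bsub>N\<^esub> f x) \<in> mod_hom R M N"
proof -
  interpret N: module R N by fact
  show ?thesis
    using assms by (auto simp: mod_hom_def Pi_def N.smult_r_distr
        N.smult_assoc1[symmetric] N.R.m_comm)
qed

lemma mod_hom_fun_finsum:
  assumes "module R M" "module R N" "\<And>i. i \<in> A \<Longrightarrow> (\<lambda>x. f x i) \<in> mod_hom R M N"
  shows "(\<lambda>x. finsum N (f x) A) \<in> mod_hom R M N"
proof -
  interpret M: module R M by fact
  interpret N: module R N by fact
  show ?thesis
    using assms(3)
  proof (induction A rule: infinite_finite_induct)
    case (insert i F)
    have *: "finsum N (f x) (insert i F) = f x i \<oplus>\<^bsub>N\<^esub> finsum N (f x) F" if "x \<in> carrier M" for x
      using insert that mod_hom_closed[OF insert.prems that]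
      by (subst N.finsum_insert) (auto simp: Pi_def)
    have F: "(\<lambda>x. finsum N (f x) F) \<in> mod_hom R M N"
      using insert by auto
    have i: "(\<lambda>x. f x i) \<in> mod_hom R M N"
      using insert by auto
    have "(\<lambda>x. f x i \<oplus>\<^bsub>N\<^esub> finsum N (f x) F) \<in> mod_hom R M N"
      using F i mod_hom_closed[OF F] mod_hom_closed[OF i]
      by (intro mod_homI)
        (auto simp: mod_hom_add[OF F] mod_hom_add[OF i] mod_hom_smult[OF F] mod_hom_smult[OF i]
          N.smult_r_distr N.M.add.m_ac)
    then show ?case
      by (rule mod_hom_cong[OF assms(1)]) (simp add: *)
  qed (auto intro!: mod_homI)
qed

text \<open>
  Closure under negatives follows from closure under scalars.
\<close>

lemma submodule_criterion:
  assumes "module R M" "S \<subseteq> carrier M" "\<zero>\<^bsub>M\<^esub> \<in> S"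
    and "\<And>a b. \<lbrakk>a \<in> S; b \<in> S\<rbrakk> \<Longrightarrow> a \<oplus>\<^bsub>M\<^esub> b \<in> S"
    and "\<And>c a. \<lbrakk>c \<in> carrier R; a \<in> S\<rbrakk> \<Longrightarrow> c \<odot>\<^bsub>M\<^esub> a \<in> S"
  shows "submodule S R M"
proof -
  interpret M: module R M by fact
  show ?thesis
  proof (rule M.submoduleI)
    fix a assume a: "a \<in> S"
    then have "\<ominus>\<^bsub>M\<^esub> a = (\<ominus>\<^bsub>R\<^esub> \<one>\<^bsub>R\<^esub>) \<odot>\<^bsub>M\<^esub> a"
      using assms(2) by (subst M.smult_l_minus) auto
    then show "\<ominus>\<^bsub>M\<^esub> a \<in> S" using assms(5)[OF _ a] by simp
  qed (use assms in auto)
qed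

lemma submodule_subset: "submodule S R M \<Longrightarrow> x \<in> S \<Longrightarrow> x \<in> carrier M"
  using subgroup.subset[of S "add_monoid M"] by (auto simp: submodule_def)

lemma submodule_zero: "submodule S R M \<Longrightarrow> \<zero>\<^bsub>M\<^esub> \<in> S"
  using subgroup.one_closed[of S "add_monoid M"] by (auto simp: submodule_def)

lemma submodule_add: "submodule S R M \<Longrightarrow> x \<in> S \<Longrightarrow> y \<in> S \<Longrightarrow> x \<oplus>\<^bsub>M\<^esub> y \<in> S"
  using subgroup.m_closed[of S "add_monoid M"] by (auto simp: submodule_def)

lemma submodule_smult: "submodule S R M \<Longrightarrow> c \<in> carrier R \<Longrightarrow> x \<in> S \<Longrightarrow> c \<odot>\<^bsub>M\<^esub> x \<in> S"
  by (rule submodule.smult_closed)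

lemma submodule_equalizer:
  assumes "module R M" "module R N" "f \<in> mod_hom R M N" "g \<in> mod_hom R M N"
  shows "submodule {x \<in> carrier M. f x = g x} R M"
proof -
  interpret M: module R M by fact
  show ?thesis
    using assms mod_hom_zero[OF assms(1,2,3)] mod_hom_zero[OF assms(1,2,4)]
    by (intro submodule_criterion) (auto simp: mod_hom_add[OF assms(3)] mod_hom_add[OF assms(4)]
        mod_hom_smult[OF assms(3)] mod_hom_smult[OF assms(4)])
qed

lemma submodule_kernel:
  assumes "module R M" "module R N" "f \<in> mod_hom R M N"
  shows "submodule {x \<in> carrier M. f x = \<zero>\<^bsub>N\<^esub>} R M"
proof -
  interpret N: module R N by fact
  have "(\<lambda>x. \<zero>\<^bsub>N\<^esub>) \<in> mod_hom R M N" by (auto intro!: mod_homI)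
  from submodule_equalizer[OF assms this] show ?thesis .
qed

lemma gen_submodule_submodule:
  assumes "module R M" "E \<subseteq> carrier M"
  shows "submodule (gen_submodule R M E) R M"
proof -
  interpret M: module R M by fact
  have "submodule (carrier M) R M"
    by (intro submodule_criterion) (auto intro: assms)
  then show ?thesis
    using assms unfolding gen_submodule_def
    by (intro submodule_criterion)
      (auto intro: submodule_zero submodule_add submodule_smult)
qed

lemma gen_submodule_incl: "E \<subseteq> gen_submodule R M E"
  and gen_submodule_least: "submodule N R M \<Longrightarrow> E \<subseteq> N \<Longrightarrow> gen_submodule R M E \<subseteq> N"
  by (auto simp: gen_submodule_def)

section \<open>Quotients\<close>

lemma quot_simps:
  "carrier (quot M N) = (+>\<^bsub>M\<^esub>) N ` carrier M"
  "zero (quot M N) = N"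
  "add (quot M N) = set_add M"
  "mult (quot M N) = rcoset_mult M N"
  "one (quot M N) = N +>\<^bsub>M\<^esub> \<one>\<^bsub>M\<^esub>"
  "smult (quot M N) = (\<lambda>c E. \<Union>x\<in>E. N +>\<^bsub>M\<^esub> (c \<odot>\<^bsub>M\<^esub> x))"
  by (auto simp: quot_def ring.extend_def module.fields_def FactRing_def
      A_RCOSETS_def' a_r_coset_def')

context
  fixes R :: "'k ring" and M :: "('k, 'a) module" and N
  assumes M: "module R M" and N: "submodule N R M"
begin

interpretation M: module R M by (rule M)
interpretation N: abelian_subgroup N M
  using N by (intro abelian_subgroupI3 additive_subgroup.intro)
    (auto simp: submodule_def M.abelian_group_axioms)

lemma in_coset_iff:
  "x \<in> carrier M \<Longrightarrow> y \<in> N +>\<^bsub>M\<^esub> x \<longleftrightarrow> y \<in> carrier M \<and> y \<ominus>\<^bsub>M\<^esub> x \<in> N"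
  using N.a_rcos_module[of x y] N.a_elemrcos_carrier[of x y] by (auto simp: a_minus_def)

lemma coset_eq_iff:
  "\<lbrakk>x \<in> carrier M; y \<in> carrier M\<rbrakk> \<Longrightarrow> N +>\<^bsub>M\<^esub> x = N +>\<^bsub>M\<^esub> y \<longleftrightarrow> x \<ominus>\<^bsub>M\<^esub> y \<in> N"
  by (metis N.a_rcos_self N.a_repr_independence' in_coset_iff)

lemma coset_self: "x \<in> carrier M \<Longrightarrow> x \<in> N +>\<^bsub>M\<^esub> x"
  by (rule N.a_rcos_self)

lemma quot_coset_zero: "x \<in> N \<Longrightarrow> N +>\<^bsub>M\<^esub> x = \<zero>\<^bsub>quot M N\<^esub>"
  by (simp add: quot_simps N.a_rcos_const)

lemma coset_add: "\<lbrakk>x \<in> carrier M; y \<in> carrier M\<rbrakk>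
    \<Longrightarrow> (N +>\<^bsub>M\<^esub> x) \<oplus>\<^bsub>quot M N\<^esub> (N +>\<^bsub>M\<^esub> y) = N +>\<^bsub>M\<^esub> (x \<oplus>\<^bsub>M\<^esub> y)"
  by (simp add: quot_simps N.a_rcos_sum)

lemma coset_smult:
  assumes "c \<in> carrier R" "x \<in> carrier M"
  shows "c \<odot>\<^bsub>quot M N\<^esub> (N +>\<^bsub>M\<^esub> x) = N +>\<^bsub>M\<^esub> (c \<odot>\<^bsub>M\<^esub> x)"
proof -
  have "N +>\<^bsub>M\<^esub> (c \<odot>\<^bsub>M\<^esub> y) = N +>\<^bsub>M\<^esub> (c \<odot>\<^bsub>M\<^esub> x)" if "y \<in> N +>\<^bsub>M\<^esub> x" for y
  proof -
    have y: "y \<in> carrier M" "y \<ominus>\<^bsub>M\<^esub> x \<in> N" using that assms in_coset_iff by auto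
    have "c \<odot>\<^bsub>M\<^esub> (y \<ominus>\<^bsub>M\<^esub> x) \<in> N" using y assms submodule_smult[OF N] by auto
    then show ?thesis using y assms
      by (subst coset_eq_iff) (auto simp: a_minus_def M.smult_r_distr M.smult_r_minus)
  qed
  then show ?thesis
    unfolding quot_simps by (intro UN_constant_eq[OF coset_self[OF assms(2)]] ballI)
qed

lemma quot_module: "module R (quot M N)"
proof (rule moduleI)
  show "cring R" by (rule M.R.is_cring)
  show "abelian_group (quot M N)"
  proof (rule abelian_groupI)
    fix x assume "x \<in> carrier (quot M N)"
    then obtain a where a: "a \<in> carrier M" "x = N +>\<^bsub>M\<^esub> a" by (auto simp: quot_simps)
    show "\<exists>y\<in>carrier (quot M N). y \<oplus>\<^bsub>quot M N\<^esub> x = \<zero>\<^bsub>quot M N\<^esub>"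
      using a by (intro bexI[of _ "N +>\<^bsub>M\<^esub> (\<ominus>\<^bsub>M\<^esub> a)"])
        (auto simp: coset_add M.M.l_neg quot_simps(1) intro!: quot_coset_zero submodule_zero[OF N])
  next
    have z: "\<zero>\<^bsub>quot M N\<^esub> = N +>\<^bsub>M\<^esub> \<zero>\<^bsub>M\<^esub>"
      by (simp add: quot_coset_zero submodule_zero[OF N])
    show "\<zero>\<^bsub>quot M N\<^esub> \<in> carrier (quot M N)"
      unfolding z by (auto simp: quot_simps(1))
    show "\<And>x. x \<in> carrier (quot M N) \<Longrightarrow> \<zero>\<^bsub>quot M N\<^esub> \<oplus>\<^bsub>quot M N\<^esub> x = x"
      unfolding z by (auto simp: quot_simps(1) coset_add)
  qed (auto simp: quot_simps(1) coset_add M.M.add.m_ac)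
qed (auto simp: quot_simps(1) coset_add coset_smult M.smult_l_distr M.smult_r_distr
      M.smult_assoc1)

lemma coset_hom: "(+>\<^bsub>M\<^esub>) N \<in> mod_hom R M (quot M N)"
  by (intro mod_homI) (auto simp: coset_add coset_smult, auto simp: quot_simps)

lemma coset_mult:
  assumes "ideal N M" "x \<in> carrier M" "y \<in> carrier M"
  shows "(N +>\<^bsub>M\<^esub> x) \<otimes>\<^bsub>quot M N\<^esub> (N +>\<^bsub>M\<^esub> y) = N +>\<^bsub>M\<^esub> (x \<otimes>\<^bsub>M\<^esub> y)"
  using ideal.rcoset_mult_add[OF assms] by (simp add: quot_simps)

end

text \<open>
  Scalars act as multiplication by \<open>c \<odot> 1\<close>.
\<close>

lemma ideal_submodule:
  assumes "assoc_algebra R A" "ideal I A"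
  shows "submodule I R A"
proof -
  interpret A: assoc_algebra R A by fact
  interpret I: ideal I A by fact
  show ?thesis
  proof (rule submodule_criterion)
    fix c a assume "c \<in> carrier R" "a \<in> I"
    then have "c \<odot>\<^bsub>A\<^esub> a = (c \<odot>\<^bsub>A\<^esub> \<one>\<^bsub>A\<^esub>) \<otimes>\<^bsub>A\<^esub> a"
      by (simp add: A.smult_mult_left I.a_Hcarr)
    then show "c \<odot>\<^bsub>A\<^esub> a \<in> I" using \<open>c \<in> carrier R\<close> \<open>a \<in> I\<close> by (simp add: I.I_l_closed)
  qed (auto intro: A.module_axioms I.a_Hcarr)
qed

lemma alg_homI:
  assumes "f \<in> mod_hom R A B"
    and "\<And>x y. \<lbrakk>x \<in> carrier A; y \<in> carrier A\<rbrakk> \<Longrightarrow> f (x \<otimes>\<^bsub>A\<^esub> y) = f x \<otimes>\<^bsub>B\<^esub> f y"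
    and "f \<one>\<^bsub>A\<^esub> = \<one>\<^bsub>B\<^esub>"
  shows "f \<in> alg_hom R A B"
  using assms by (auto simp: alg_hom_def ring_hom_def mod_hom_def)

lemma alg_hom_mod_hom: "f \<in> alg_hom R A B \<Longrightarrow> f \<in> mod_hom R A B"
  and alg_hom_mult: "\<lbrakk>f \<in> alg_hom R A B; x \<in> carrier A; y \<in> carrier A\<rbrakk>
     \<Longrightarrow> f (x \<otimes>\<^bsub>A\<^esub> y) = f x \<otimes>\<^bsub>B\<^esub> f y"
  and alg_hom_one: "f \<in> alg_hom R A B \<Longrightarrow> f \<one>\<^bsub>A\<^esub> = \<one>\<^bsub>B\<^esub>"
  by (auto simp: alg_hom_def ring_hom_def)

lemma assoc_algebraI:
  assumes "module R A"
    and "\<And>x y. \<lbrakk>x \<in> carrier A; y \<in> carrier A\<rbrakk> \<Longrightarrow> x \<otimes>\<^bsub>A\<^esub> y \<in> carrier A"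
    and "\<one>\<^bsub>A\<^esub> \<in> carrier A"
    and "\<And>x y z. \<lbrakk>x \<in> carrier A; y \<in> carrier A; z \<in> carrier A\<rbrakk>
      \<Longrightarrow> (x \<otimes>\<^bsub>A\<^esub> y) \<otimes>\<^bsub>A\<^esub> z = x \<otimes>\<^bsub>A\<^esub> (y \<otimes>\<^bsub>A\<^esub> z)"
    and "\<And>x. x \<in> carrier A \<Longrightarrow> \<one>\<^bsub>A\<^esub> \<otimes>\<^bsub>A\<^esub> x = x"
    and "\<And>x. x \<in> carrier A \<Longrightarrow> x \<otimes>\<^bsub>A\<^esub> \<one>\<^bsub>A\<^esub> = x"
    and l: "\<And>y. y \<in> carrier A \<Longrightarrow> (\<lambda>x. x \<otimes>\<^bsub>A\<^esub> y) \<in> mod_hom R A A"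
    and r: "\<And>x. x \<in> carrier A \<Longrightarrow> (\<lambda>y. x \<otimes>\<^bsub>A\<^esub> y) \<in> mod_hom R A A"
  shows "assoc_algebra R A"
proof -
  interpret A: module R A by fact
  have "ring A"
    using assms by (intro ringI monoidI A.abelian_group_axioms) (auto simp: mod_hom_def)
  then show ?thesis
    using assms by (intro assoc_algebra.intro assoc_algebra_axioms.intro) (auto simp: mod_hom_def)
qed

lemma quot_algebra:
  fixes A :: "('k, 'a) module"
  assumes "assoc_algebra R A" "ideal I A"
  shows "assoc_algebra R (quot A I)"
    and "(+>\<^bsub>A\<^esub>) I \<in> alg_hom R A (quot A I)"
proof -
  interpret A: assoc_algebra R A by fact
  note M = A.module_axioms
  note I = ideal_submodule[OF assms]
  note c = coset_mult[OF M I assms(2)] coset_add[OF M I] coset_smult[OF M I]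
  show "assoc_algebra R (quot A I)"
    by (rule assoc_algebraI[OF quot_module[OF M I]])
      (auto simp: quot_simps(1,5) mod_hom_def c A.m_assoc A.l_distr A.r_distr
         A.smult_mult_left A.smult_mult_right)
  show "(+>\<^bsub>A\<^esub>) I \<in> alg_hom R A (quot A I)"
    by (rule alg_homI[OF coset_hom[OF M I]]) (auto simp: c quot_simps(5))
qed

lemma quot_lift:
  fixes A :: "('k, 'a) module"
  assumes A: "assoc_algebra R A" "ideal I A" and B: "assoc_algebra R B"
    and f: "f \<in> alg_hom R A B" "\<And>x. x \<in> I \<Longrightarrow> f x = \<zero>\<^bsub>B\<^esub>"
  obtains g where "g \<in> alg_hom R (quot A I) B"
    "\<And>x. x \<in> carrier A \<Longrightarrow> g (I +>\<^bsub>A\<^esub> x) = f x"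
proof -
  interpret A: assoc_algebra R A by fact
  interpret B: assoc_algebra R B by fact
  note M = A.module_axioms
  note I = ideal_submodule[OF assms(1,2)]
  note c = coset_mult[OF M I assms(2)] coset_add[OF M I] coset_smult[OF M I]
  note fm = alg_hom_mod_hom[OF f(1)]
  define g where "g E = f (SOME x. x \<in> E)" for E
  have g: "g (I +>\<^bsub>A\<^esub> x) = f x" if x: "x \<in> carrier A" for x
  proof -
    let ?y = "SOME y. y \<in> I +>\<^bsub>A\<^esub> x"
    have "?y \<in> I +>\<^bsub>A\<^esub> x" by (rule someI[of _ x]) (rule coset_self[OF M I x])
    then have y: "?y \<in> carrier A" "?y \<ominus>\<^bsub>A\<^esub> x \<in> I" using in_coset_iff[OF M I x] by auto
    then have "f ?y \<ominus>\<^bsub>B\<^esub> f x = \<zero>\<^bsub>B\<^esub>"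
      using mod_hom_minus[OF M B.module_axioms fm y(1) x] f(2) by simp
    then show ?thesis
      using mod_hom_closed[OF fm x] mod_hom_closed[OF fm y(1)] by (simp add: g_def)
  qed
  have "g \<in> alg_hom R (quot A I) B"
    by (intro alg_homI mod_homI)
      (auto simp: quot_simps(1,5) c g mod_hom_closed[OF fm] mod_hom_add[OF fm]
        mod_hom_smult[OF fm] alg_hom_mult[OF f(1)] alg_hom_one[OF f(1)])
  with g show ?thesis by (rule that[rotated])
qed

lemma module_minus_eq_zero_iff:
  assumes "module R P" "x \<in> carrier P" "y \<in> carrier P"
  shows "x \<ominus>\<^bsub>P\<^esub> y = \<zero>\<^bsub>P\<^esub> \<longleftrightarrow> x = y"
proof -
  interpret P: module R P by fact
  have "x = (x \<ominus>\<^bsub>P\<^esub> y) \<oplus>\<^bsub>P\<^esub> y"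
    using assms by (simp add: a_minus_def P.M.add.m_assoc P.M.l_neg)
  then show ?thesis
    using assms by (metis P.M.r_neg P.M.l_zero a_minus_def)
qed

section \<open>Free modules and tensor products\<close>

text \<open>
  The linear extension of a function on a basis.  For a basis of pairs this is the expression that
  \<open>tensor_lift\<close> evaluates on a representative.
\<close>

definition lin_ext :: "('k, 'p, 'w) module_scheme \<Rightarrow> 'k ring \<Rightarrow> ('x \<Rightarrow> 'p) \<Rightarrow> ('x \<Rightarrow> 'k) \<Rightarrow> 'p" where
  "lin_ext P R f p = (\<Oplus>\<^bsub>P\<^esub>z\<in>{z. p z \<noteq> \<zero>\<^bsub>R\<^esub>}. p z \<odot>\<^bsub>P\<^esub> f z)"

lemma free_mod_carrier:
  "p \<in> carrier (free_mod R E) \<longleftrightarrow>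
    (\<forall>x. p x \<in> carrier R) \<and> {x. p x \<noteq> \<zero>\<^bsub>R\<^esub>} \<subseteq> E \<and> finite {x. p x \<noteq> \<zero>\<^bsub>R\<^esub>}"
  by (simp add: free_mod_def)

lemma free_mod_ops:
  "zero (free_mod R E) = (\<lambda>x. \<zero>\<^bsub>R\<^esub>)"
  "add (free_mod R E) = (\<lambda>p q x. p x \<oplus>\<^bsub>R\<^esub> q x)"
  "smult (free_mod R E) = (\<lambda>c p x. c \<otimes>\<^bsub>R\<^esub> p x)"
  by (auto simp: free_mod_def)

context
  fixes R :: "'k ring"
  assumes R: "cring R"
begin

interpretation R: cring R by (rule R)

lemma free_mod_module: "module R (free_mod R E)"
proof (rule moduleI)
  have supp_add: "{x. p x \<oplus>\<^bsub>R\<^esub> q x \<noteq> \<zero>\<^bsub>R\<^esub>} \<subseteq> {x. p x \<noteq> \<zero>\<^bsub>R\<^esub>} \<union> {x. q x \<noteq> \<zero>\<^bsub>R\<^esub>}" for p q :: "'a \<Rightarrow> 'k"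
    by auto
  have supp_smult: "{x. c \<otimes>\<^bsub>R\<^esub> p x \<noteq> \<zero>\<^bsub>R\<^esub>} \<subseteq> {x. p x \<noteq> \<zero>\<^bsub>R\<^esub>}" if "c \<in> carrier R" for c and p :: "'a \<Rightarrow> 'k"
    using that by auto
  show "abelian_group (free_mod R E)"
  proof (rule abelian_groupI)
    fix p q assume "p \<in> carrier (free_mod R E)" "q \<in> carrier (free_mod R E)"
    then show "p \<oplus>\<^bsub>free_mod R E\<^esub> q \<in> carrier (free_mod R E)"
      using supp_add[of p q] by (auto simp: free_mod_carrier free_mod_ops elim!: finite_subset)
  next
    fix p assume "p \<in> carrier (free_mod R E)"
    then have "(\<lambda>x. \<ominus>\<^bsub>R\<^esub> p x) \<in> carrier (free_mod R E)"
      by (auto simp: free_mod_carrier)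
    moreover have "(\<lambda>x. \<ominus>\<^bsub>R\<^esub> p x) \<oplus>\<^bsub>free_mod R E\<^esub> p = \<zero>\<^bsub>free_mod R E\<^esub>"
      using \<open>p \<in> _\<close> by (auto simp: free_mod_carrier free_mod_ops R.l_neg)
    ultimately show "\<exists>q\<in>carrier (free_mod R E). q \<oplus>\<^bsub>free_mod R E\<^esub> p = \<zero>\<^bsub>free_mod R E\<^esub>"
      by blast
  qed (auto simp: free_mod_carrier free_mod_ops R.add.m_ac)
  fix c p assume "c \<in> carrier R" "p \<in> carrier (free_mod R E)"
  then show "c \<odot>\<^bsub>free_mod R E\<^esub> p \<in> carrier (free_mod R E)"
    using supp_smult[of c p] by (auto simp: free_mod_carrier free_mod_ops elim!: finite_subset)
qed (auto simp: free_mod_carrier free_mod_ops R.l_distr R.r_distr R.m_assoc R)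

lemma single_closed: "x \<in> E \<Longrightarrow> single R x \<in> carrier (free_mod R E)"
  by (auto simp: free_mod_carrier single_def intro: finite_subset[of _ "{x}"])

text \<open>
  This is the induction principle for free modules, in a form that makes every linear statement a
  statement about basis elements.  The proof removes the points of the support one at a time.
\<close>

lemma free_mod_span:
  assumes S: "submodule S R (free_mod R E)" and single: "\<And>x. x \<in> E \<Longrightarrow> single R x \<in> S"
    and p: "p \<in> carrier (free_mod R E)"
  shows "p \<in> S"
proof -
  interpret F: module R "free_mod R E" by (rule free_mod_module)
  have "p \<in> S" if "finite X" "{x. p x \<noteq> \<zero>\<^bsub>R\<^esub>} \<subseteq> X" "p \<in> carrier (free_mod R E)" for X p
    using that
  proof (induction X arbitrary: p)
    case empty
    then have "p = \<zero>\<^bsub>free_mod R E\<^esub>" by (auto simp: free_mod_ops)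
    then show ?case using submodule_zero[OF S] by simp
  next
    case (insert x X)
    let ?q = "p(x := \<zero>\<^bsub>R\<^esub>)"
    have q: "?q \<in> carrier (free_mod R E)"
      using insert.prems by (auto simp: free_mod_carrier elim!: finite_subset[rotated])
    have "?q \<in> S" using insert.prems by (intro insert.IH q) auto
    show ?case
    proof (cases "p x = \<zero>\<^bsub>R\<^esub>")
      case True
      then have "?q = p" by auto
      then show ?thesis using \<open>?q \<in> S\<close> by simp
    next
      case False
      have "(p x \<odot>\<^bsub>free_mod R E\<^esub> single R x) \<oplus>\<^bsub>free_mod R E\<^esub> ?q = p"
        using insert.prems by (auto simp: free_mod_ops free_mod_carrier single_def)
      moreover have "x \<in> E" "p x \<in> carrier R"
        using False insert.prems by (auto simp: free_mod_carrier)
      ultimately show ?thesis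
        using submodule_add[OF S submodule_smult[OF S _ single] \<open>?q \<in> S\<close>] by metis
    qed
  qed
  then show ?thesis using p by (auto simp: free_mod_carrier)
qed

lemma lin_ext_superset:
  assumes "module R P" "p \<in> carrier (free_mod R E)" "f \<in> E \<rightarrow> carrier P"
    and "finite X" "{x. p x \<noteq> \<zero>\<^bsub>R\<^esub>} \<subseteq> X" "X \<subseteq> E"
  shows "lin_ext P R f p = (\<Oplus>\<^bsub>P\<^esub>z\<in>X. p z \<odot>\<^bsub>P\<^esub> f z)"
proof -
  interpret P: module R P by fact
  show ?thesis
    unfolding lin_ext_def using assms(2-)
    by (intro P.add.finprod_mono_neutral_cong_left) (auto simp: free_mod_carrier Pi_def)
qed

lemma lin_ext_hom:
  assumes P: "module R P" and f: "f \<in> E \<rightarrow> carrier P"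
  shows "lin_ext P R f \<in> mod_hom R (free_mod R E) P"
proof (rule mod_homI)
  interpret P: module R P by fact
  interpret F: module R "free_mod R E" by (rule free_mod_module)
  note sup = lin_ext_superset[OF P _ f]
  fix p assume p: "p \<in> carrier (free_mod R E)"
  then have p': "\<And>x. p x \<in> carrier R" "{x. p x \<noteq> \<zero>\<^bsub>R\<^esub>} \<subseteq> E" "finite {x. p x \<noteq> \<zero>\<^bsub>R\<^esub>}"
    by (auto simp: free_mod_carrier)
  show "lin_ext P R f p \<in> carrier P"
    unfolding lin_ext_def using f p' by (intro P.finsum_closed) auto
  {
    fix q assume q: "q \<in> carrier (free_mod R E)"
    then have q': "\<And>x. q x \<in> carrier R" "{x. q x \<noteq> \<zero>\<^bsub>R\<^esub>} \<subseteq> E" "finite {x. q x \<noteq> \<zero>\<^bsub>R\<^esub>}"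
      by (auto simp: free_mod_carrier)
    let ?X = "{x. p x \<noteq> \<zero>\<^bsub>R\<^esub>} \<union> {x. q x \<noteq> \<zero>\<^bsub>R\<^esub>}"
    have X: "finite ?X" "?X \<subseteq> E" using p' q' by auto
    have fX: "x \<in> ?X \<Longrightarrow> f x \<in> carrier P" for x using X f by auto
    have "lin_ext P R f (p \<oplus>\<^bsub>free_mod R E\<^esub> q) = (\<Oplus>\<^bsub>P\<^esub>z\<in>?X. (p z \<oplus>\<^bsub>R\<^esub> q z) \<odot>\<^bsub>P\<^esub> f z)"
      using X F.add.m_closed[OF p q] by (subst sup[of _ ?X]) (auto simp: free_mod_ops(2))
    also have "\<dots> = (\<Oplus>\<^bsub>P\<^esub>z\<in>?X. p z \<odot>\<^bsub>P\<^esub> f z \<oplus>\<^bsub>P\<^esub> q z \<odot>\<^bsub>P\<^esub> f z)"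
      using p' q' fX by (intro P.finsum_cong') (auto simp: P.smult_l_distr)
    also have "\<dots> = (\<Oplus>\<^bsub>P\<^esub>z\<in>?X. p z \<odot>\<^bsub>P\<^esub> f z) \<oplus>\<^bsub>P\<^esub> (\<Oplus>\<^bsub>P\<^esub>z\<in>?X. q z \<odot>\<^bsub>P\<^esub> f z)"
      using p' q' fX by (intro P.finsum_addf) auto
    also have "\<dots> = lin_ext P R f p \<oplus>\<^bsub>P\<^esub> lin_ext P R f q"
      using p q X by (simp add: sup[of _ ?X])
    finally show "lin_ext P R f (p \<oplus>\<^bsub>free_mod R E\<^esub> q) = lin_ext P R f p \<oplus>\<^bsub>P\<^esub> lin_ext P R f q" .
  }
  fix c assume c: "c \<in> carrier R"
  let ?X = "{x. p x \<noteq> \<zero>\<^bsub>R\<^esub>}"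
  have fX: "x \<in> ?X \<Longrightarrow> f x \<in> carrier P" for x using p' f by auto
  have "lin_ext P R f (c \<odot>\<^bsub>free_mod R E\<^esub> p) = (\<Oplus>\<^bsub>P\<^esub>z\<in>?X. (c \<otimes>\<^bsub>R\<^esub> p z) \<odot>\<^bsub>P\<^esub> f z)"
    using p' c F.smult_closed[OF c p] by (subst sup[of _ ?X]) (auto simp: free_mod_ops(3))
  also have "\<dots> = (\<Oplus>\<^bsub>P\<^esub>z\<in>?X. c \<odot>\<^bsub>P\<^esub> (p z \<odot>\<^bsub>P\<^esub> f z))"
    using p' c fX by (intro P.finsum_cong') (auto simp: P.smult_assoc1)
  also have "\<dots> = c \<odot>\<^bsub>P\<^esub> lin_ext P R f p"
    unfolding lin_ext_def using p' c fX by (intro P.finsum_smult_ldistr[symmetric]) auto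
  finally show "lin_ext P R f (c \<odot>\<^bsub>free_mod R E\<^esub> p) = c \<odot>\<^bsub>P\<^esub> lin_ext P R f p" .
qed

lemma lin_ext_single:
  assumes P: "module R P" and f: "f x \<in> carrier P"
  shows "lin_ext P R f (single R x) = f x"
proof -
  interpret P: module R P by fact
  have "lin_ext P R f (single R x) = (\<Oplus>\<^bsub>P\<^esub>z\<in>{x}. single R x z \<odot>\<^bsub>P\<^esub> f z)"
    using f by (intro lin_ext_superset[where E = "{x}"] single_closed P) (auto simp: single_def)
  also have "\<dots> = f x" using f by (simp add: single_def)
  finally show ?thesis .
qed

end

definition bilin :: "'k ring \<Rightarrow> ('k, 'a, 'u) module_scheme \<Rightarrow> ('k, 'b, 'v) module_scheme
    \<Rightarrow> ('k, 'c, 'w) module_scheme \<Rightarrow> ('a \<Rightarrow> 'b \<Rightarrow> 'c) \<Rightarrow> bool" where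
  "bilin R M N P f \<longleftrightarrow> (\<forall>x\<in>carrier M. f x \<in> mod_hom R N P) \<and>
     (\<forall>y\<in>carrier N. (\<lambda>x. f x y) \<in> mod_hom R M P)"

lemma bilinI:
  "\<lbrakk>\<And>x. x \<in> carrier M \<Longrightarrow> f x \<in> mod_hom R N P;
    \<And>y. y \<in> carrier N \<Longrightarrow> (\<lambda>x. f x y) \<in> mod_hom R M P\<rbrakk> \<Longrightarrow> bilin R M N P f"
  by (auto simp: bilin_def)

lemma bilin_right: "\<lbrakk>bilin R M N P f; x \<in> carrier M\<rbrakk> \<Longrightarrow> f x \<in> mod_hom R N P"
  and bilin_left: "\<lbrakk>bilin R M N P f; y \<in> carrier N\<rbrakk> \<Longrightarrow> (\<lambda>x. f x y) \<in> mod_hom R M P"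
  by (auto simp: bilin_def)

lemma bilin_closed: "\<lbrakk>bilin R M N P f; x \<in> carrier M; y \<in> carrier N\<rbrakk> \<Longrightarrow> f x y \<in> carrier P"
  by (auto simp: bilin_def intro: mod_hom_closed)

text \<open>
  The representative and the finite index set which \<open>tensor_lift\<close> uses do not depend on the
  function that is lifted, nor on its target.  This is why a lift may be treated as one and the same
  linear combination for all functions, bilinear or not.
\<close>

definition tensor_rep :: "('a \<times> 'b \<Rightarrow> 'k) set \<Rightarrow> 'a \<times> 'b \<Rightarrow> 'k" where
  "tensor_rep t = (SOME p. p \<in> t)"

definition tensor_supp :: "'k ring \<Rightarrow> ('a \<times> 'b \<Rightarrow> 'k) set \<Rightarrow> ('a \<times> 'b) set" where
  "tensor_supp R t = {z. tensor_rep t z \<noteq> \<zero>\<^bsub>R\<^esub>}"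

lemma tensor_lift_eq_finsum: "tensor_lift P R f t =
    (\<Oplus>\<^bsub>P\<^esub>z\<in>tensor_supp R t. tensor_rep t z \<odot>\<^bsub>P\<^esub> f (fst z) (snd z))"
  by (simp add: tensor_lift_def tensor_supp_def tensor_rep_def Let_def)

context
  fixes R :: "'k ring" and M :: "('k, 'a, 'u) module_scheme" and N :: "('k, 'b, 'v) module_scheme"
  assumes M: "module R M" and N: "module R N"
begin

interpretation M: module R M by (rule M)
interpretation N: module R N by (rule N)

abbreviation (input) "pairs \<equiv> free_mod R (carrier M \<times> carrier N)"

lemmas tensor_base_cring = M.R.is_cring
lemmas pairs_module = free_mod_module[OF tensor_base_cring, of "carrier M \<times> carrier N"]

interpretation F: module R pairs by (rule pairs_module)

lemma single_pair: "\<lbrakk>x \<in> carrier M; y \<in> carrier N\<rbrakk> \<Longrightarrow> single R (x, y) \<in> carrier pairs"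
  by (intro single_closed tensor_base_cring) auto

lemma tensor_rels_submodule: "submodule (tensor_rels R M N) R pairs"
  unfolding tensor_rels_def Let_def
  by (intro gen_submodule_submodule pairs_module)
    (auto intro!: F.minus_closed F.add.m_closed F.smult_closed single_pair)

lemma tensor_rels_memb:
  "\<lbrakk>x \<in> carrier M; x' \<in> carrier M; y \<in> carrier N\<rbrakk> \<Longrightarrow>
    single R (x \<oplus>\<^bsub>M\<^esub> x', y) \<ominus>\<^bsub>pairs\<^esub> (single R (x, y) \<oplus>\<^bsub>pairs\<^esub> single R (x', y)) \<in> tensor_rels R M N"
  "\<lbrakk>x \<in> carrier M; y \<in> carrier N; y' \<in> carrier N\<rbrakk> \<Longrightarrow>
    single R (x, y \<oplus>\<^bsub>N\<^esub> y') \<ominus>\<^bsub>pairs\<^esub> (single R (x, y) \<oplus>\<^bsub>pairs\<^esub> single R (x, y')) \<in> tensor_rels R M N"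
  "\<lbrakk>c \<in> carrier R; x \<in> carrier M; y \<in> carrier N\<rbrakk> \<Longrightarrow>
    single R (c \<odot>\<^bsub>M\<^esub> x, y) \<ominus>\<^bsub>pairs\<^esub> (c \<odot>\<^bsub>pairs\<^esub> single R (x, y)) \<in> tensor_rels R M N"
  "\<lbrakk>c \<in> carrier R; x \<in> carrier M; y \<in> carrier N\<rbrakk> \<Longrightarrow>
    single R (x, c \<odot>\<^bsub>N\<^esub> y) \<ominus>\<^bsub>pairs\<^esub> (c \<odot>\<^bsub>pairs\<^esub> single R (x, y)) \<in> tensor_rels R M N"
  unfolding tensor_rels_def Let_def
  by (rule subsetD[OF gen_submodule_incl], blast)+

lemma tensor_module: "module R (tensor R M N)"
  unfolding tensor_def by (rule quot_module[OF pairs_module tensor_rels_submodule])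

lemma tens_closed: "\<lbrakk>x \<in> carrier M; y \<in> carrier N\<rbrakk> \<Longrightarrow> tens R M N x y \<in> carrier (tensor R M N)"
  by (auto simp: tensor_def tens_def quot_simps(1) intro!: imageI single_pair)

lemma tens_bilin: "bilin R M N (tensor R M N) (tens R M N)"
proof -
  show ?thesis
    unfolding tens_def tensor_def
    by (intro bilinI mod_homI)
      (simp_all add: coset_add[OF pairs_module tensor_rels_submodule] quot_simps(1)
        coset_smult[OF pairs_module tensor_rels_submodule] single_pair tensor_rels_memb
        coset_eq_iff[OF pairs_module tensor_rels_submodule] F.add.m_closed F.smult_closed)
qed

text \<open>
  The relations have been chosen such that they vanish under bilinear maps; this is what makes
  \<open>tensor_lift\<close> independent of the representative.
\<close>

lemma lin_ext_tensor_rels: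
  assumes P: "module R P" and f: "bilin R M N P f" and p: "p \<in> tensor_rels R M N"
  shows "lin_ext P R (\<lambda>z. f (fst z) (snd z)) p = \<zero>\<^bsub>P\<^esub>"
proof -
  interpret P: module R P by fact
  let ?L = "lin_ext P R (\<lambda>z. f (fst z) (snd z))"
  have L: "?L \<in> mod_hom R pairs P"
    using f by (intro lin_ext_hom tensor_base_cring P) (auto intro: bilin_closed)
  have s: "?L (single R (x, y)) = f x y" if "x \<in> carrier M" "y \<in> carrier N" for x y
    using that f by (subst lin_ext_single[OF tensor_base_cring P]) (auto intro: bilin_closed)
  note L_rules = mod_hom_minus[OF pairs_module P L] mod_hom_add[OF L] mod_hom_smult[OF L] s
  note r = mod_hom_add[OF bilin_right[OF f]] mod_hom_smult[OF bilin_right[OF f]]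
    mod_hom_add[OF bilin_left[OF f]] mod_hom_smult[OF bilin_left[OF f]]
  have "tensor_rels R M N \<subseteq> {p \<in> carrier pairs. ?L p = \<zero>\<^bsub>P\<^esub>}"
    unfolding tensor_rels_def Let_def
    apply (intro gen_submodule_least submodule_kernel pairs_module P L)
    using bilin_closed[OF f]
    by (auto intro!: F.minus_closed F.add.m_closed F.smult_closed single_pair
        simp: L_rules single_pair r module_minus_eq_zero_iff[OF P])
  then show ?thesis using p by auto
qed

lemma tensor_lift_coset:
  assumes P: "module R P" and f: "bilin R M N P f" and p: "p \<in> carrier pairs"
  shows "tensor_lift P R f (tensor_rels R M N +>\<^bsub>pairs\<^esub> p) = lin_ext P R (\<lambda>z. f (fst z) (snd z)) p"
proof -
  interpret P: module R P by fact
  let ?L = "lin_ext P R (\<lambda>z. f (fst z) (snd z))"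
  have L: "?L \<in> mod_hom R pairs P"
    using f by (intro lin_ext_hom tensor_base_cring P) (auto intro: bilin_closed)
  let ?q = "SOME q. q \<in> tensor_rels R M N +>\<^bsub>pairs\<^esub> p"
  have "?q \<in> tensor_rels R M N +>\<^bsub>pairs\<^esub> p"
    by (rule someI[of _ p]) (rule coset_self[OF pairs_module tensor_rels_submodule p])
  then have q: "?q \<in> carrier pairs" "?q \<ominus>\<^bsub>pairs\<^esub> p \<in> tensor_rels R M N"
    using in_coset_iff[OF pairs_module tensor_rels_submodule p] by auto
  then have "?L ?q \<ominus>\<^bsub>P\<^esub> ?L p = \<zero>\<^bsub>P\<^esub>"
    using mod_hom_minus[OF pairs_module P L q(1) p] lin_ext_tensor_rels[OF P f q(2)] by simp
  then have "?L ?q = ?L p"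
    using mod_hom_closed[OF L q(1)] mod_hom_closed[OF L p]
    by (simp add: module_minus_eq_zero_iff[OF P])
  then show ?thesis by (simp add: tensor_lift_def lin_ext_def Let_def)
qed

lemma tensor_lift_hom:
  assumes P: "module R P" and f: "bilin R M N P f"
  shows "tensor_lift P R f \<in> mod_hom R (tensor R M N) P"
proof -
  have L: "lin_ext P R (\<lambda>z. f (fst z) (snd z)) \<in> mod_hom R pairs P"
    using f by (intro lin_ext_hom tensor_base_cring P) (auto intro: bilin_closed)
  note c = tensor_lift_coset[OF P f]
    coset_add[OF pairs_module tensor_rels_submodule]
    coset_smult[OF pairs_module tensor_rels_submodule]
  show ?thesis
    by (rule mod_homI) (auto simp: tensor_def quot_simps(1) c mod_hom_add[OF L]
        mod_hom_smult[OF L] intro!: mod_hom_closed[OF L])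
qed

lemma tensor_lift_tens:
  assumes P: "module R P" and f: "bilin R M N P f" and "x \<in> carrier M" "y \<in> carrier N"
  shows "tensor_lift P R f (tens R M N x y) = f x y"
  using assms unfolding tens_def
  by (subst tensor_lift_coset[OF P f]) (auto intro: single_pair
      simp: lin_ext_single[OF tensor_base_cring P] bilin_closed[OF f])

lemma tensor_span:
  assumes S: "submodule S R (tensor R M N)"
    and tens: "\<And>x y. \<lbrakk>x \<in> carrier M; y \<in> carrier N\<rbrakk> \<Longrightarrow> tens R M N x y \<in> S"
    and t: "t \<in> carrier (tensor R M N)"
  shows "t \<in> S"
proof -
  let ?k = "(+>\<^bsub>pairs\<^esub>) (tensor_rels R M N)"
  have k: "?k \<in> mod_hom R pairs (tensor R M N)"
    unfolding tensor_def by (rule coset_hom[OF pairs_module tensor_rels_submodule])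
  have "submodule {p \<in> carrier pairs. ?k p \<in> S} R pairs"
    using mod_hom_zero[OF pairs_module tensor_module k]
    by (intro submodule_criterion pairs_module)
      (auto simp: mod_hom_add[OF k] mod_hom_smult[OF k] submodule_zero[OF S]
        submodule_add[OF S] submodule_smult[OF S])
  moreover obtain p where p: "p \<in> carrier pairs" "t = ?k p"
    using t by (auto simp: tensor_def quot_simps(1))
  ultimately have "p \<in> {p \<in> carrier pairs. ?k p \<in> S}"
    using tens by - (rule free_mod_span[OF tensor_base_cring], auto simp: tens_def intro: single_pair)
  then show ?thesis using p by simp
qed

lemma tensor_hom_eqI:
  assumes P: "module R P" and f: "f \<in> mod_hom R (tensor R M N) P"
    and g: "g \<in> mod_hom R (tensor R M N) P"
    and eq: "\<And>x y. \<lbrakk>x \<in> carrier M; y \<in> carrier N\<rbrakk> \<Longrightarrow> f (tens R M N x y) = g (tens R M N x y)"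
    and t: "t \<in> carrier (tensor R M N)"
  shows "f t = g t"
proof -
  have "t \<in> {t \<in> carrier (tensor R M N). f t = g t}"
    by (rule tensor_span[OF submodule_equalizer[OF tensor_module P f g] _ t])
      (simp add: eq tens_closed)
  then show ?thesis by simp
qed

lemma tensor_supp:
  assumes t: "t \<in> carrier (tensor R M N)"
  shows "finite (tensor_supp R t)" "tensor_supp R t \<subseteq> carrier M \<times> carrier N"
    "tensor_rep t z \<in> carrier R"
proof -
  obtain q where q: "q \<in> carrier pairs" "t = tensor_rels R M N +>\<^bsub>pairs\<^esub> q"
    using t by (auto simp: tensor_def quot_simps(1))
  have "tensor_rep t \<in> t" using coset_self[OF pairs_module tensor_rels_submodule q(1)] q(2)
    unfolding tensor_rep_def by (intro someI[of "\<lambda>p. p \<in> t" q]) simp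
  then have "tensor_rep t \<in> carrier pairs"
    using q in_coset_iff[OF pairs_module tensor_rels_submodule q(1)] by auto
  then show "finite (tensor_supp R t)" "tensor_supp R t \<subseteq> carrier M \<times> carrier N"
    "tensor_rep t z \<in> carrier R"
    unfolding free_mod_carrier tensor_supp_def by blast+
qed

end

section \<open>Free algebras and tensor algebras\<close>

lemma module_mult_one_update:
  "module R M \<Longrightarrow> module R (M\<lparr>mult := m, one := e\<rparr>)"
  by (simp add: module_def module_axioms_def abelian_group_def abelian_group_axioms_def
      abelian_monoid_def)

lemma free_alg_simps:
  "carrier (free_alg R E) = carrier (free_mod R (lists E))"
  "zero (free_alg R E) = (\<lambda>x. \<zero>\<^bsub>R\<^esub>)"
  "add (free_alg R E) = (\<lambda>p q x. p x \<oplus>\<^bsub>R\<^esub> q x)"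
  "smult (free_alg R E) = (\<lambda>c p x. c \<otimes>\<^bsub>R\<^esub> p x)"
  "one (free_alg R E) = single R []"
  by (auto simp: free_alg_def free_mod_def)

text \<open>
  The multiplication of the free algebra.  It satisfies a recursion on the word: if \<open>\<partial>\<^sub>x p\<close> denotes
  the function \<open>w \<mapsto> p (x # w)\<close>, then \<open>\<partial>\<^sub>x (p q) = p [] (\<partial>\<^sub>x q) + (\<partial>\<^sub>x p) q\<close>.
\<close>

definition word_conv :: "'k ring \<Rightarrow> ('x list \<Rightarrow> 'k) \<Rightarrow> ('x list \<Rightarrow> 'k) \<Rightarrow> 'x list \<Rightarrow> 'k" where
  "word_conv R p q w = (\<Oplus>\<^bsub>R\<^esub>i\<in>{..length w}. p (take i w) \<otimes>\<^bsub>R\<^esub> q (drop i w))"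

context
  fixes R :: "'k ring"
  assumes R: "cring R"
begin

interpretation R: cring R by (rule R)

lemma free_alg_mult: "p \<otimes>\<^bsub>free_alg R E\<^esub> q = word_conv R p q"
  by (auto simp: free_alg_def word_conv_def)

lemma word_conv_Nil:
  "\<lbrakk>\<And>u. p u \<in> carrier R; \<And>u. q u \<in> carrier R\<rbrakk> \<Longrightarrow> word_conv R p q [] = p [] \<otimes>\<^bsub>R\<^esub> q []"
  by (simp add: word_conv_def)

lemma word_conv_Cons:
  "\<lbrakk>\<And>u. p u \<in> carrier R; \<And>u. q u \<in> carrier R\<rbrakk> \<Longrightarrow>
    word_conv R p q (x # w) = p [] \<otimes>\<^bsub>R\<^esub> q (x # w) \<oplus>\<^bsub>R\<^esub> word_conv R (\<lambda>u. p (x # u)) q w"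
  unfolding word_conv_def by (subst length_Cons, subst R.finsum_Suc2) (auto simp: R.add.m_comm)

lemma word_conv_closed:
  "\<lbrakk>\<And>u. p u \<in> carrier R; \<And>u. q u \<in> carrier R\<rbrakk> \<Longrightarrow> word_conv R p q w \<in> carrier R"
  by (auto simp: word_conv_def)

lemma word_conv_zero_left: "(\<And>u. q u \<in> carrier R) \<Longrightarrow> word_conv R (\<lambda>u. \<zero>\<^bsub>R\<^esub>) q w = \<zero>\<^bsub>R\<^esub>"
  by (simp add: word_conv_def)

lemma word_conv_add_left:
  assumes "\<And>u. p u \<in> carrier R" "\<And>u. p' u \<in> carrier R" "\<And>u. q u \<in> carrier R"
  shows "word_conv R (\<lambda>u. p u \<oplus>\<^bsub>R\<^esub> p' u) q w = word_conv R p q w \<oplus>\<^bsub>R\<^esub> word_conv R p' q w"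
  using assms by (simp add: word_conv_def R.l_distr R.finsum_addf)

lemma word_conv_add_right:
  assumes "\<And>u. p u \<in> carrier R" "\<And>u. q' u \<in> carrier R" "\<And>u. q u \<in> carrier R"
  shows "word_conv R p (\<lambda>u. q u \<oplus>\<^bsub>R\<^esub> q' u) w = word_conv R p q w \<oplus>\<^bsub>R\<^esub> word_conv R p q' w"
  using assms by (simp add: word_conv_def R.r_distr R.finsum_addf)

lemma word_conv_smult_left:
  assumes "\<And>u. p u \<in> carrier R" "\<And>u. q u \<in> carrier R" "c \<in> carrier R"
  shows "word_conv R (\<lambda>u. c \<otimes>\<^bsub>R\<^esub> p u) q w = c \<otimes>\<^bsub>R\<^esub> word_conv R p q w"
  using assms by (simp add: word_conv_def R.m_assoc R.finsum_rdistr)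

lemma word_conv_smult_right:
  assumes "\<And>u. p u \<in> carrier R" "\<And>u. q u \<in> carrier R" "c \<in> carrier R"
  shows "word_conv R p (\<lambda>u. c \<otimes>\<^bsub>R\<^esub> q u) w = c \<otimes>\<^bsub>R\<^esub> word_conv R p q w"
  using assms by (simp add: word_conv_def R.m_lcomm R.finsum_rdistr)

text \<open>
  By the recursion on the word, the induction hypothesis being used for \<open>\<partial>\<^sub>x p\<close> in place of \<open>p\<close>.
  This avoids the interchange of double sums over factorizations.
\<close>

lemma word_conv_assoc:
  assumes "\<And>u. p u \<in> carrier R" "\<And>u. q u \<in> carrier R" "\<And>u. r u \<in> carrier R"
  shows "word_conv R (word_conv R p q) r w = word_conv R p (word_conv R q r) w"
  using assms
proof (induction w arbitrary: p)
  case Nil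
  then show ?case by (simp add: word_conv_Nil word_conv_closed R.m_assoc)
next
  case (Cons x w)
  let ?p = "\<lambda>u. p (x # u)"
  have cl: "word_conv R a b u \<in> carrier R"
    if "\<And>u. a u \<in> carrier R" "\<And>u. b u \<in> carrier R" for a b :: "'b list \<Rightarrow> 'k" and u
    using that by (rule word_conv_closed)
  have "word_conv R (word_conv R p q) r (x # w) =
      word_conv R p q [] \<otimes>\<^bsub>R\<^esub> r (x # w) \<oplus>\<^bsub>R\<^esub> word_conv R (\<lambda>u. word_conv R p q (x # u)) r w"
    using Cons.prems by (intro word_conv_Cons cl)
  also have "(\<lambda>u. word_conv R p q (x # u)) = (\<lambda>u. p [] \<otimes>\<^bsub>R\<^esub> q (x # u) \<oplus>\<^bsub>R\<^esub> word_conv R ?p q u)"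
    using Cons.prems by (intro ext word_conv_Cons)
  also have "word_conv R (\<lambda>u. p [] \<otimes>\<^bsub>R\<^esub> q (x # u) \<oplus>\<^bsub>R\<^esub> word_conv R ?p q u) r w =
      word_conv R (\<lambda>u. p [] \<otimes>\<^bsub>R\<^esub> q (x # u)) r w \<oplus>\<^bsub>R\<^esub> word_conv R (word_conv R ?p q) r w"
    using Cons.prems by (intro word_conv_add_left cl) auto
  also have "word_conv R (\<lambda>u. p [] \<otimes>\<^bsub>R\<^esub> q (x # u)) r w =
      p [] \<otimes>\<^bsub>R\<^esub> word_conv R (\<lambda>u. q (x # u)) r w"
    using Cons.prems by (intro word_conv_smult_left) auto
  also have "word_conv R (word_conv R ?p q) r w = word_conv R ?p (word_conv R q r) w"
    using Cons.prems by (intro Cons.IH)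
  also have "word_conv R p q [] = p [] \<otimes>\<^bsub>R\<^esub> q []"
    using Cons.prems by (intro word_conv_Nil)
  also have "p [] \<otimes>\<^bsub>R\<^esub> q [] \<otimes>\<^bsub>R\<^esub> r (x # w) \<oplus>\<^bsub>R\<^esub>
      (p [] \<otimes>\<^bsub>R\<^esub> word_conv R (\<lambda>u. q (x # u)) r w \<oplus>\<^bsub>R\<^esub> word_conv R ?p (word_conv R q r) w) =
      p [] \<otimes>\<^bsub>R\<^esub> (q [] \<otimes>\<^bsub>R\<^esub> r (x # w) \<oplus>\<^bsub>R\<^esub> word_conv R (\<lambda>u. q (x # u)) r w) \<oplus>\<^bsub>R\<^esub>
      word_conv R ?p (word_conv R q r) w"
    using Cons.prems cl[of "\<lambda>u. q (x # u)" r w] cl[of ?p "word_conv R q r" w] cl[of q r]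
    by (simp add: R.r_distr R.m_assoc R.a_assoc)
  also have "q [] \<otimes>\<^bsub>R\<^esub> r (x # w) \<oplus>\<^bsub>R\<^esub> word_conv R (\<lambda>u. q (x # u)) r w = word_conv R q r (x # w)"
    using Cons.prems by (intro word_conv_Cons[symmetric])
  also have "p [] \<otimes>\<^bsub>R\<^esub> word_conv R q r (x # w) \<oplus>\<^bsub>R\<^esub> word_conv R ?p (word_conv R q r) w =
      word_conv R p (word_conv R q r) (x # w)"
    using Cons.prems by (intro word_conv_Cons[symmetric] cl)
  finally show ?case .
qed

lemma single_value: "single R x y \<in> carrier R"
  by (simp add: single_def)

lemma word_conv_single_Nil:
  assumes "\<And>u. q u \<in> carrier R"
  shows "word_conv R (single R []) q w = q w"
proof (cases w)
  case Nil
  then show ?thesis using assms by (simp add: word_conv_Nil single_value) (simp add: single_def)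
next
  case (Cons x v)
  have "(\<lambda>u. single R [] (x # u)) = (\<lambda>u. \<zero>\<^bsub>R\<^esub>)" by (auto simp: single_def)
  then show ?thesis
    using assms unfolding Cons
    by (subst word_conv_Cons) (auto simp: single_value word_conv_zero_left, simp add: single_def)
qed

lemma word_conv_single_Cons:
  assumes "\<And>u. q u \<in> carrier R"
  shows "word_conv R (single R (y # v)) q w =
    (case w of [] \<Rightarrow> \<zero>\<^bsub>R\<^esub> | x # u \<Rightarrow> if x = y then word_conv R (single R v) q u else \<zero>\<^bsub>R\<^esub>)"
proof (cases w)
  case Nil
  then show ?thesis using assms by (simp add: word_conv_Nil single_value) (simp add: single_def)
next
  case (Cons x u)
  have "(\<lambda>u. single R (y # v) (x # u)) = (if x = y then single R v else (\<lambda>u. \<zero>\<^bsub>R\<^esub>))"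
    by (auto simp: single_def)
  moreover have "single R (y # v) [] = \<zero>\<^bsub>R\<^esub>" by (simp add: single_def)
  moreover have "word_conv R (single R v) q u \<in> carrier R"
    using assms by (intro word_conv_closed single_value)
  ultimately show ?thesis
    using assms unfolding Cons
    by (subst word_conv_Cons) (auto simp: single_value word_conv_zero_left)
qed

lemma word_conv_single: "word_conv R (single R u) (single R v) = single R (u @ v)"
proof (induction u)
  case Nil
  then show ?case by (intro ext) (simp add: word_conv_single_Nil single_value)
next
  case (Cons y u)
  show ?case
  proof
    fix w
    show "word_conv R (single R (y # u)) (single R v) w = single R ((y # u) @ v) w"
      unfolding word_conv_single_Cons[of "single R v" y u w, OF single_value] Cons.IH
      by (auto simp: single_def split: list.splits)
  qed
qed

lemma word_conv_one_right:
  assumes "\<And>u. p u \<in> carrier R"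
  shows "word_conv R p (single R []) w = p w"
  using assms
proof (induction w arbitrary: p)
  case Nil
  then show ?case by (simp add: word_conv_Nil single_value) (simp add: single_def)
next
  case (Cons x w)
  then have "word_conv R p (single R []) (x # w) =
      p [] \<otimes>\<^bsub>R\<^esub> single R [] (x # w) \<oplus>\<^bsub>R\<^esub> word_conv R (\<lambda>u. p (x # u)) (single R []) w"
    by (intro word_conv_Cons single_value)
  also have "word_conv R (\<lambda>u. p (x # u)) (single R []) w = p (x # w)"
    by (intro Cons.IH Cons.prems)
  finally show ?case using Cons.prems by (simp add: single_def)
qed

lemma word_conv_support:
  assumes "\<And>u. p u \<in> carrier R" "\<And>u. q u \<in> carrier R"
  shows "{w. word_conv R p q w \<noteq> \<zero>\<^bsub>R\<^esub>} \<subseteq>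
    (\<lambda>(u, v). u @ v) ` ({u. p u \<noteq> \<zero>\<^bsub>R\<^esub>} \<times> {v. q v \<noteq> \<zero>\<^bsub>R\<^esub>})"
proof
  fix w assume w: "w \<in> {w. word_conv R p q w \<noteq> \<zero>\<^bsub>R\<^esub>}"
  have "\<exists>i. p (take i w) \<noteq> \<zero>\<^bsub>R\<^esub> \<and> q (drop i w) \<noteq> \<zero>\<^bsub>R\<^esub>"
  proof (rule ccontr)
    assume "\<not> ?thesis"
    then have "p (take i w) \<otimes>\<^bsub>R\<^esub> q (drop i w) = \<zero>\<^bsub>R\<^esub>" for i
      using assms by (metis R.l_null R.r_null)
    then show False using w by (simp add: word_conv_def)
  qed
  then obtain i where "p (take i w) \<noteq> \<zero>\<^bsub>R\<^esub>" "q (drop i w) \<noteq> \<zero>\<^bsub>R\<^esub>" by blast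
  then show "w \<in> (\<lambda>(u, v). u @ v) ` ({u. p u \<noteq> \<zero>\<^bsub>R\<^esub>} \<times> {v. q v \<noteq> \<zero>\<^bsub>R\<^esub>})"
    by (intro image_eqI[of _ _ "(take i w, drop i w)"]) auto
qed

lemma free_alg_module: "module R (free_alg R E)"
  unfolding free_alg_def by (intro module_mult_one_update free_mod_module R)

lemma free_alg_carrierD: "p \<in> carrier (free_alg R E) \<Longrightarrow> p w \<in> carrier R"
  by (simp add: free_alg_simps free_mod_carrier)

lemma free_alg_algebra: "assoc_algebra R (free_alg R E)"
proof (rule assoc_algebraI[OF free_alg_module])
  note [simp del] = free_alg_mult
  show m: "p \<otimes>\<^bsub>free_alg R E\<^esub> q \<in> carrier (free_alg R E)"
    if "p \<in> carrier (free_alg R E)" "q \<in> carrier (free_alg R E)" for p q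
  proof -
    have pq: "\<And>u. p u \<in> carrier R" "\<And>u. q u \<in> carrier R"
      using that free_alg_carrierD by auto
    let ?X = "(\<lambda>(u, v). u @ v) ` ({u. p u \<noteq> \<zero>\<^bsub>R\<^esub>} \<times> {v. q v \<noteq> \<zero>\<^bsub>R\<^esub>})"
    have fin: "finite {u. p u \<noteq> \<zero>\<^bsub>R\<^esub>}" "finite {u. q u \<noteq> \<zero>\<^bsub>R\<^esub>}"
      and sub: "{u. p u \<noteq> \<zero>\<^bsub>R\<^esub>} \<subseteq> lists E" "{u. q u \<noteq> \<zero>\<^bsub>R\<^esub>} \<subseteq> lists E"
      using that by (auto simp: free_alg_simps free_mod_carrier)
    have "finite ?X" using fin by auto
    moreover have "?X \<subseteq> lists E"
      using sub by (fastforce simp: subset_iff)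
    ultimately show ?thesis
      using word_conv_support[of p q, OF pq] word_conv_closed[of p q, OF pq]
      unfolding free_alg_mult free_alg_simps free_mod_carrier
      by (blast intro: finite_subset)
  qed
  show "\<one>\<^bsub>free_alg R E\<^esub> \<in> carrier (free_alg R E)"
    unfolding free_alg_simps by (intro single_closed R) auto
  fix p assume p: "p \<in> carrier (free_alg R E)"
  note pR = free_alg_carrierD[OF p]
  show "\<one>\<^bsub>free_alg R E\<^esub> \<otimes>\<^bsub>free_alg R E\<^esub> p = p"
    using pR by (intro ext) (simp only: free_alg_mult free_alg_simps word_conv_single_Nil)
  show "p \<otimes>\<^bsub>free_alg R E\<^esub> \<one>\<^bsub>free_alg R E\<^esub> = p"
    using pR by (intro ext) (simp only: free_alg_mult free_alg_simps word_conv_one_right)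
  show "(\<lambda>x. x \<otimes>\<^bsub>free_alg R E\<^esub> p) \<in> mod_hom R (free_alg R E) (free_alg R E)"
    by (intro mod_homI m p; (rule ext)?)
      (simp_all only: free_alg_mult free_alg_simps(3,4) word_conv_add_left word_conv_smult_left
        free_alg_carrierD pR)
  show "(\<lambda>x. p \<otimes>\<^bsub>free_alg R E\<^esub> x) \<in> mod_hom R (free_alg R E) (free_alg R E)"
    by (intro mod_homI m p; (rule ext)?)
      (simp_all only: free_alg_mult free_alg_simps(3,4) word_conv_add_right word_conv_smult_right
        free_alg_carrierD pR)
  fix q r assume "q \<in> carrier (free_alg R E)" "r \<in> carrier (free_alg R E)"
  then show "(p \<otimes>\<^bsub>free_alg R E\<^esub> q) \<otimes>\<^bsub>free_alg R E\<^esub> r = p \<otimes>\<^bsub>free_alg R E\<^esub> (q \<otimes>\<^bsub>free_alg R E\<^esub> r)"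
    using pR free_alg_carrierD unfolding free_alg_mult by (intro ext word_conv_assoc)
qed

lemma free_alg_span:
  assumes S: "submodule S R (free_alg R E)" and "\<And>w. w \<in> lists E \<Longrightarrow> single R w \<in> S"
    and "p \<in> carrier (free_alg R E)"
  shows "p \<in> S"
proof -
  have "submodule S R (free_mod R (lists E))"
    using submodule_subset[OF S] submodule_zero[OF S] submodule_add[OF S] submodule_smult[OF S]
    by (intro submodule_criterion free_mod_module R)
      (auto simp: free_alg_simps free_mod_ops)
  then show ?thesis
    using assms(2,3) unfolding free_alg_simps by (rule free_mod_span[OF R])
qed

text \<open>
  The linear extension of \<open>x\<^sub>1 \<dots> x\<^sub>n \<mapsto> f(x\<^sub>1) \<dots> f(x\<^sub>n)\<close>.  Multiplicativity is bilinear in the two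
  arguments, hence reduces to words, where it is the product rule for concatenation.
\<close>

lemma free_alg_lift:
  assumes B: "assoc_algebra R B" and f: "f \<in> E \<rightarrow> carrier B"
  obtains F where "F \<in> alg_hom R (free_alg R E) B" "\<And>x. x \<in> E \<Longrightarrow> F (single R [x]) = f x"
proof -
  interpret B: assoc_algebra R B by fact
  interpret A: assoc_algebra R "free_alg R E" by (rule free_alg_algebra)
  note Am = free_alg_module[of E]
  define W where "W w = foldr (\<lambda>x b. f x \<otimes>\<^bsub>B\<^esub> b) w \<one>\<^bsub>B\<^esub>" for w
  have W: "W w \<in> carrier B" if "w \<in> lists E" for w
    using that f by (induction w) (auto simp: W_def)
  have W_app: "W (u @ v) = W u \<otimes>\<^bsub>B\<^esub> W v" if "u \<in> lists E" "v \<in> lists E" for u v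
    using that(1)
  proof (induction u)
    case (Cons x u)
    then have "f x \<in> carrier B" "W u \<in> carrier B" "W v \<in> carrier B"
      using f W that(2) by auto
    then show ?case using Cons by (simp add: W_def B.m_assoc)
  qed (use W[OF that(2)] in \<open>simp add: W_def\<close>)
  define F where "F = lin_ext B R W"
  have "F \<in> mod_hom R (free_mod R (lists E)) B"
    unfolding F_def using W by (intro lin_ext_hom R B.module_axioms) auto
  then have F: "F \<in> mod_hom R (free_alg R E) B"
    by (simp add: mod_hom_def free_alg_simps free_mod_ops)
  have Fs: "F (single R w) = W w" if "w \<in> lists E" for w
    unfolding F_def using W[OF that] by (intro lin_ext_single R B.module_axioms)
  have s: "single R w \<in> carrier (free_alg R E)" if "w \<in> lists E" for w
    using that unfolding free_alg_simps by (intro single_closed R)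
  note cl = mod_hom_closed[OF F]
  have mult: "F (p \<otimes>\<^bsub>free_alg R E\<^esub> q) = F p \<otimes>\<^bsub>B\<^esub> F q"
    if p: "p \<in> carrier (free_alg R E)" and q: "q \<in> carrier (free_alg R E)" for p q
  proof -
    have 1: "F (single R u \<otimes>\<^bsub>free_alg R E\<^esub> q) = F (single R u) \<otimes>\<^bsub>B\<^esub> F q"
      if u: "u \<in> lists E" and q: "q \<in> carrier (free_alg R E)" for u q
    proof -
      let ?S = "{q \<in> carrier (free_alg R E).
        F (single R u \<otimes>\<^bsub>free_alg R E\<^esub> q) = F (single R u) \<otimes>\<^bsub>B\<^esub> F q}"
      have "submodule ?S R (free_alg R E)"
        using u s cl by (intro submodule_equalizer[OF Am B.module_axioms] mod_homI)
          (auto simp: A.r_distr B.r_distr A.smult_mult_right B.smult_mult_right mod_hom_add[OF F]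
            mod_hom_smult[OF F])
      then have "q \<in> ?S"
        by (rule free_alg_span[OF _ _ q])
          (use u s in \<open>auto simp: Fs W_app free_alg_mult word_conv_single\<close>)
      then show ?thesis by simp
    qed
    let ?S = "{p \<in> carrier (free_alg R E). F (p \<otimes>\<^bsub>free_alg R E\<^esub> q) = F p \<otimes>\<^bsub>B\<^esub> F q}"
    have "submodule ?S R (free_alg R E)"
      using q cl by (intro submodule_equalizer[OF Am B.module_axioms] mod_homI)
        (auto simp: A.l_distr B.l_distr A.smult_mult_left B.smult_mult_left mod_hom_add[OF F]
          mod_hom_smult[OF F])
    then have "p \<in> ?S"
      by (rule free_alg_span[OF _ _ p]) (use 1 q s in auto)
    then show ?thesis by simp
  qed
  have "F \<in> alg_hom R (free_alg R E) B"
    by (intro alg_homI F mult) (auto simp: free_alg_simps(5) Fs, simp add: W_def)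
  moreover have "F (single R [x]) = f x" if "x \<in> E" for x
    using that funcset_mem[OF f that] by (subst Fs) (auto simp: W_def)
  ultimately show ?thesis by (rule that)
qed

end

lemma alg_hom_kernel_ideal:
  assumes A: "assoc_algebra R A" and B: "assoc_algebra R B" and f: "f \<in> alg_hom R A B"
  shows "ideal {x \<in> carrier A. f x = \<zero>\<^bsub>B\<^esub>} A"
proof -
  interpret A: assoc_algebra R A by fact
  interpret B: assoc_algebra R B by fact
  have "ring_hom_ring A B f"
    using f by (intro ring_hom_ringI2 A.ring_axioms B.ring_axioms) (auto simp: alg_hom_def)
  from ring_hom_ring.kernel_is_ideal[OF this] show ?thesis
    by (simp add: a_kernel_def')
qed

context
  fixes R :: "'k ring" and M :: "('k, 'a, 'u) module_scheme"
  assumes M: "module R M"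
begin

interpretation M: module R M by (rule M)
interpretation F: assoc_algebra R "free_alg R (carrier M)"
  by (rule free_alg_algebra[OF M.R.is_cring])

abbreviation (input) "words \<equiv> free_alg R (carrier M)"

lemma letter_closed: "x \<in> carrier M \<Longrightarrow> single R [x] \<in> carrier words"
  unfolding free_alg_simps by (intro single_closed M.R.is_cring) auto

lemma tensor_algebra_rels_ideal: "ideal (tensor_algebra_rels R M) words"
  unfolding tensor_algebra_rels_def Let_def
  by (intro F.genideal_ideal)
    (auto intro!: F.minus_closed F.add.m_closed F.smult_closed letter_closed)

lemma tensor_algebra_rels_memb:
  "\<lbrakk>x \<in> carrier M; y \<in> carrier M\<rbrakk> \<Longrightarrow>
    single R [x \<oplus>\<^bsub>M\<^esub> y] \<ominus>\<^bsub>words\<^esub> (single R [x] \<oplus>\<^bsub>words\<^esub> single R [y]) \<in> tensor_algebra_rels R M"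
  "\<lbrakk>c \<in> carrier R; x \<in> carrier M\<rbrakk> \<Longrightarrow>
    single R [c \<odot>\<^bsub>M\<^esub> x] \<ominus>\<^bsub>words\<^esub> (c \<odot>\<^bsub>words\<^esub> single R [x]) \<in> tensor_algebra_rels R M"
  unfolding tensor_algebra_rels_def Let_def
  by (rule subsetD[OF F.genideal_self],
     auto intro!: F.minus_closed F.add.m_closed F.smult_closed letter_closed)+

lemmas words_module = F.module_axioms
lemmas words_algebra = F.assoc_algebra_axioms
lemmas tensor_algebra_rels_submodule = ideal_submodule[OF words_algebra tensor_algebra_rels_ideal]

lemma tensor_algebra_algebra: "assoc_algebra R (tensor_algebra R M)"
  unfolding tensor_algebra_def
  by (rule quot_algebra[OF words_algebra tensor_algebra_rels_ideal])

lemma tensor_algebra_in_hom: "tensor_algebra_in R M \<in> mod_hom R M (tensor_algebra R M)"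
  unfolding tensor_algebra_def tensor_algebra_in_def
  by (intro mod_homI)
    (simp_all add: coset_add[OF words_module tensor_algebra_rels_submodule] quot_simps(1)
      coset_smult[OF words_module tensor_algebra_rels_submodule] letter_closed
      tensor_algebra_rels_memb coset_eq_iff[OF words_module tensor_algebra_rels_submodule]
      F.add.m_closed F.smult_closed)

lemma tensor_algebra_lift:
  assumes B: "assoc_algebra R B" and f: "f \<in> mod_hom R M B"
  obtains g where "g \<in> alg_hom R (tensor_algebra R M) B"
    "\<And>x. x \<in> carrier M \<Longrightarrow> g (tensor_algebra_in R M x) = f x"
proof -
  interpret B: assoc_algebra R B by fact
  obtain F where F: "F \<in> alg_hom R words B" "\<And>x. x \<in> carrier M \<Longrightarrow> F (single R [x]) = f x"
    using free_alg_lift[OF M.R.is_cring B, of f "carrier M"] mod_hom_closed[OF f] by blast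
  note Fm = alg_hom_mod_hom[OF F(1)]
  have "tensor_algebra_rels R M \<subseteq> {x \<in> carrier words. F x = \<zero>\<^bsub>B\<^esub>}"
    unfolding tensor_algebra_rels_def Let_def
    by (intro F.genideal_minimal alg_hom_kernel_ideal[OF words_algebra B F(1)])
      (auto simp: mod_hom_minus[OF words_module B.module_axioms Fm] mod_hom_add[OF Fm]
        mod_hom_smult[OF Fm] F(2) letter_closed mod_hom_add[OF f] mod_hom_smult[OF f]
        module_minus_eq_zero_iff[OF B.module_axioms] mod_hom_closed[OF f])
  then obtain g where g: "g \<in> alg_hom R (tensor_algebra R M) B"
    "\<And>x. x \<in> carrier words \<Longrightarrow> g (tensor_algebra_rels R M +>\<^bsub>words\<^esub> x) = F x"
    using quot_lift[OF words_algebra tensor_algebra_rels_ideal B F(1)]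
    unfolding tensor_algebra_def by blast
  show ?thesis
    by (rule that[OF g(1)]) (simp add: tensor_algebra_in_def g(2) letter_closed F(2))
qed

text \<open>
  The tensor algebra is spanned by words, and words are built by left multiplication with letters.
\<close>

lemma tensor_algebra_span:
  assumes S: "submodule S R (tensor_algebra R M)" and one: "\<one>\<^bsub>tensor_algebra R M\<^esub> \<in> S"
    and mult: "\<And>x y. \<lbrakk>x \<in> carrier M; y \<in> S\<rbrakk>
      \<Longrightarrow> tensor_algebra_in R M x \<otimes>\<^bsub>tensor_algebra R M\<^esub> y \<in> S"
    and t: "t \<in> carrier (tensor_algebra R M)"
  shows "t \<in> S"
proof -
  let ?k = "(+>\<^bsub>words\<^esub>) (tensor_algebra_rels R M)"
  interpret T: assoc_algebra R "tensor_algebra R M" by (rule tensor_algebra_algebra)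
  have k: "?k \<in> alg_hom R words (tensor_algebra R M)"
    unfolding tensor_algebra_def by (rule quot_algebra[OF words_algebra tensor_algebra_rels_ideal])
  note km = alg_hom_mod_hom[OF k]
  have sub: "submodule {p \<in> carrier words. ?k p \<in> S} R words"
    using mod_hom_zero[OF words_module T.module_axioms km]
    by (intro submodule_criterion words_module)
      (auto simp: mod_hom_add[OF km] mod_hom_smult[OF km] submodule_zero[OF S]
        submodule_add[OF S] submodule_smult[OF S])
  have w: "single R w \<in> carrier words \<and> ?k (single R w) \<in> S" if "w \<in> lists (carrier M)" for w
    using that
  proof (induction w)
    case Nil
    then show ?case using one alg_hom_one[OF k] F.one_closed by (simp add: free_alg_simps(5))
  next
    case (Cons x w)
    have "single R (x # w) = single R [x] \<otimes>\<^bsub>words\<^esub> single R w"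
      using word_conv_single[OF M.R.is_cring, of "[x]" w]
      by (simp only: free_alg_mult[OF M.R.is_cring] append_Cons append_Nil)
    moreover have "?k (single R [x]) = tensor_algebra_in R M x"
      by (simp add: tensor_algebra_in_def)
    ultimately show ?case
      using Cons letter_closed mult alg_hom_mult[OF k] by auto
  qed
  obtain p where p: "p \<in> carrier words" "t = ?k p"
    using t by (auto simp: tensor_algebra_def quot_simps(1))
  have "p \<in> {p \<in> carrier words. ?k p \<in> S}"
    by (rule free_alg_span[OF M.R.is_cring sub _ p(1)]) (use w in auto)
  then show ?thesis using p by simp
qed

end

section \<open>Lifts as finite linear combinations\<close>

context
  fixes R :: "'k ring" and M :: "('k, 'a, 'u) module_scheme" and N :: "('k, 'b, 'v) module_scheme"
    and t
  assumes M: "module R M" and N: "module R N" and t: "t \<in> carrier (tensor R M N)"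
begin

lemma tensor_supp_memb:
  "z \<in> tensor_supp R t \<Longrightarrow> fst z \<in> carrier M" "z \<in> tensor_supp R t \<Longrightarrow> snd z \<in> carrier N"
  "tensor_rep t z \<in> carrier R"
  using tensor_supp[OF M N t] by auto

lemma tensor_lift_closed:
  assumes P: "module R P" and f: "\<And>x y. \<lbrakk>x \<in> carrier M; y \<in> carrier N\<rbrakk> \<Longrightarrow> f x y \<in> carrier P"
  shows "tensor_lift P R f t \<in> carrier P"
proof -
  interpret P: module R P by fact
  show ?thesis
    unfolding tensor_lift_eq_finsum using tensor_supp_memb f by (intro P.finsum_closed) auto
qed

lemma tensor_lift_cong:
  assumes P: "module R P" and f: "\<And>x y. \<lbrakk>x \<in> carrier M; y \<in> carrier N\<rbrakk> \<Longrightarrow> f x y \<in> carrier P"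
    and eq: "\<And>x y. \<lbrakk>x \<in> carrier M; y \<in> carrier N\<rbrakk> \<Longrightarrow> f x y = g x y"
  shows "tensor_lift P R f t = tensor_lift P R g t"
proof -
  interpret P: module R P by fact
  show ?thesis
    unfolding tensor_lift_eq_finsum using tensor_supp_memb f by (intro P.finsum_cong') (auto simp: eq[symmetric])
qed

lemma tensor_lift_image:
  assumes P: "module R P" and Q: "module R Q" and g: "g \<in> mod_hom R P Q"
    and f: "\<And>x y. \<lbrakk>x \<in> carrier M; y \<in> carrier N\<rbrakk> \<Longrightarrow> f x y \<in> carrier P"
  shows "g (tensor_lift P R f t) = tensor_lift Q R (\<lambda>x y. g (f x y)) t"
proof -
  interpret P: module R P by fact
  interpret Q: module R Q by fact
  show ?thesis
    unfolding tensor_lift_eq_finsum using tensor_supp_memb f mod_hom_closed[OF g]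
    by (subst mod_hom_finsum[OF P Q g]) (auto simp: mod_hom_smult[OF g] intro!: Q.finsum_cong')
qed

lemma tensor_lift_param:
  assumes L: "module R L" and P: "module R P"
    and f: "\<And>x y. \<lbrakk>x \<in> carrier M; y \<in> carrier N\<rbrakk> \<Longrightarrow> (\<lambda>u. f u x y) \<in> mod_hom R L P"
  shows "(\<lambda>u. tensor_lift P R (f u) t) \<in> mod_hom R L P"
proof -
  interpret P: module R P by fact
  have "(\<lambda>u. tensor_rep t z \<odot>\<^bsub>P\<^esub> f u (fst z) (snd z)) \<in> mod_hom R L P"
    if "z \<in> tensor_supp R t" for z
    using tensor_supp_memb that by (intro mod_hom_fun_smult P f) auto
  then show ?thesis
    unfolding tensor_lift_eq_finsum by (intro mod_hom_fun_finsum L P)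
qed

end

text \<open>
  For Sweedler sums over two independent variables.
\<close>

lemma (in abelian_monoid) finsum_swap:
  assumes "finite X" "finite Y" "\<And>x y. \<lbrakk>x \<in> X; y \<in> Y\<rbrakk> \<Longrightarrow> f x y \<in> carrier G"
  shows "(\<Oplus>x\<in>X. \<Oplus>y\<in>Y. f x y) = (\<Oplus>y\<in>Y. \<Oplus>x\<in>X. f x y)"
  using assms(1,3)
proof (induction X)
  case (insert x X)
  have "(\<Oplus>x\<in>insert x X. \<Oplus>y\<in>Y. f x y) = (\<Oplus>y\<in>Y. f x y) \<oplus> (\<Oplus>x\<in>X. \<Oplus>y\<in>Y. f x y)"
    using insert by (intro finsum_insert) auto
  also have "\<dots> = (\<Oplus>y\<in>Y. f x y) \<oplus> (\<Oplus>y\<in>Y. \<Oplus>x\<in>X. f x y)"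
    using insert by simp
  also have "\<dots> = (\<Oplus>y\<in>Y. f x y \<oplus> (\<Oplus>x\<in>X. f x y))"
    using insert by (intro finsum_addf[symmetric]) auto
  also have "\<dots> = (\<Oplus>y\<in>Y. \<Oplus>x\<in>insert x X. f x y)"
    using insert by (intro finsum_cong') auto
  finally show ?case .
qed simp

lemma tensor_lift_swap:
  assumes M: "module R M" "module R N" "t \<in> carrier (tensor R M N)"
    and M': "module R M'" "module R N'" "t' \<in> carrier (tensor R M' N')"
    and P: "module R P"
    and f: "\<And>x y u v. \<lbrakk>x \<in> carrier M; y \<in> carrier N; u \<in> carrier M'; v \<in> carrier N'\<rbrakk>
      \<Longrightarrow> f x y u v \<in> carrier P"
  shows "tensor_lift P R (\<lambda>x y. tensor_lift P R (f x y) t') t =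
    tensor_lift P R (\<lambda>u v. tensor_lift P R (\<lambda>x y. f x y u v) t) t'"
proof -
  interpret P: module R P by fact
  note z = tensor_supp_memb[OF M] and w = tensor_supp_memb[OF M']
  note fin = tensor_supp(1)[OF M] tensor_supp(1)[OF M']
  let ?p = "tensor_rep t" and ?q = "tensor_rep t'"
  let ?X = "tensor_supp R t" and ?Y = "tensor_supp R t'"
  let ?f = "\<lambda>z w. f (fst z) (snd z) (fst w) (snd w)"
  have fc: "?f z w \<in> carrier P" if "z \<in> ?X" "w \<in> ?Y" for z w
    using that z w by (intro f) auto
  have "(\<Oplus>\<^bsub>P\<^esub>z\<in>?X. ?p z \<odot>\<^bsub>P\<^esub> (\<Oplus>\<^bsub>P\<^esub>w\<in>?Y. ?q w \<odot>\<^bsub>P\<^esub> ?f z w)) =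
      (\<Oplus>\<^bsub>P\<^esub>z\<in>?X. \<Oplus>\<^bsub>P\<^esub>w\<in>?Y. ?p z \<odot>\<^bsub>P\<^esub> (?q w \<odot>\<^bsub>P\<^esub> ?f z w))"
    using fin z w fc by (intro P.finsum_cong' P.finsum_smult_ldistr) (auto intro!: P.finsum_closed)
  also have "\<dots> = (\<Oplus>\<^bsub>P\<^esub>w\<in>?Y. \<Oplus>\<^bsub>P\<^esub>z\<in>?X. ?p z \<odot>\<^bsub>P\<^esub> (?q w \<odot>\<^bsub>P\<^esub> ?f z w))"
    using fin z w fc by (intro P.finsum_swap) auto
  also have "\<dots> = (\<Oplus>\<^bsub>P\<^esub>w\<in>?Y. \<Oplus>\<^bsub>P\<^esub>z\<in>?X. ?q w \<odot>\<^bsub>P\<^esub> (?p z \<odot>\<^bsub>P\<^esub> ?f z w))"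
    using z w fc by (intro P.finsum_cong')
      (auto simp: P.smult_assoc1[symmetric] P.R.m_comm intro!: P.finsum_closed)
  also have "\<dots> = (\<Oplus>\<^bsub>P\<^esub>w\<in>?Y. ?q w \<odot>\<^bsub>P\<^esub> (\<Oplus>\<^bsub>P\<^esub>z\<in>?X. ?p z \<odot>\<^bsub>P\<^esub> ?f z w))"
    using fin z w fc
    by (intro P.finsum_cong' P.finsum_smult_ldistr[symmetric]) (auto intro!: P.finsum_closed)
  finally show ?thesis unfolding tensor_lift_eq_finsum .
qed

section \<open>Sweedler calculus\<close>

lemma tensor_alg_simps:
  "carrier (tensor_alg R A B) = carrier (tensor R A B)"
  "add (tensor_alg R A B) = add (tensor R A B)"
  "smult (tensor_alg R A B) = smult (tensor R A B)"
  "one (tensor_alg R A B) = tens R A B \<one>\<^bsub>A\<^esub> \<one>\<^bsub>B\<^esub>"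
  "mult (tensor_alg R A B) = (\<lambda>t u. tensor_lift (tensor R A B) R
     (\<lambda>a b. tensor_lift (tensor R A B) R
         (\<lambda>a' b'. tens R A B (a \<otimes>\<^bsub>A\<^esub> a') (b \<otimes>\<^bsub>B\<^esub> b')) u) t)"
  by (simp_all add: tensor_alg_def)

lemma tensor_lift_bilin_param:
  assumes M: "module R M" and N: "module R N" and L: "module R L" and P: "module R P"
    and f: "\<And>x. x \<in> carrier L \<Longrightarrow> bilin R M N P (f x)"
    and p: "\<And>y z. \<lbrakk>y \<in> carrier M; z \<in> carrier N\<rbrakk> \<Longrightarrow> (\<lambda>x. f x y z) \<in> mod_hom R L P"
  shows "bilin R L (tensor R M N) P (\<lambda>x. tensor_lift P R (f x))"
  by (rule bilinI) (rule tensor_lift_hom tensor_lift_param M N L P f p | assumption)+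

lemma lin_mult_right:
  assumes "assoc_algebra R A" "f \<in> mod_hom R M A" "c \<in> carrier A"
  shows "(\<lambda>x. f x \<otimes>\<^bsub>A\<^esub> c) \<in> mod_hom R M A"
proof -
  interpret A: assoc_algebra R A by fact
  show ?thesis
    using assms(2,3) by (auto simp: mod_hom_def Pi_def A.l_distr A.smult_mult_left)
qed

lemma lin_mult_left:
  assumes "assoc_algebra R A" "f \<in> mod_hom R M A" "c \<in> carrier A"
  shows "(\<lambda>x. c \<otimes>\<^bsub>A\<^esub> f x) \<in> mod_hom R M A"
proof -
  interpret A: assoc_algebra R A by fact
  show ?thesis
    using assms(2,3) by (auto simp: mod_hom_def Pi_def A.r_distr A.smult_mult_right)
qed

lemma bilin_compose_left:
  "\<lbrakk>bilin R M N P F; f \<in> mod_hom R L M; y \<in> carrier N\<rbrakk> \<Longrightarrow> (\<lambda>x. F (f x) y) \<in> mod_hom R L P"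
  by (rule mod_hom_compose[OF _ bilin_left])

lemma bilin_compose_right:
  "\<lbrakk>bilin R M N P F; f \<in> mod_hom R L N; x \<in> carrier M\<rbrakk> \<Longrightarrow> (\<lambda>y. F x (f y)) \<in> mod_hom R L P"
  by (rule mod_hom_compose[OF _ bilin_right])

context hopf_algebra
begin

abbreviation S :: "'h \<Rightarrow> 'h" where "S \<equiv> antipode H"
abbreviation SW where "SW P \<equiv> sweedler P R H"

lemma module_H: "module R H" by (rule module_axioms)
lemma algebra_H: "assoc_algebra R H" by (rule assoc_algebra_axioms)

lemma S_closed: "x \<in> carrier H \<Longrightarrow> S x \<in> carrier H"
  by (rule mod_hom_closed[OF antipode_hom])

lemma counit_closed: "x \<in> carrier H \<Longrightarrow> counit H x \<in> carrier R"
  using mod_hom_closed[OF alg_hom_mod_hom[OF counit_hom]]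
  by (simp add: scalar_alg_def ring.extend_def module.fields_def)

lemma counit_mult: "\<lbrakk>x \<in> carrier H; y \<in> carrier H\<rbrakk>
    \<Longrightarrow> counit H (x \<otimes> y) = counit H x \<otimes>\<^bsub>R\<^esub> counit H y"
  using alg_hom_mult[OF counit_hom]
  by (simp add: scalar_alg_def ring.extend_def module.fields_def)

lemma counit_one: "counit H \<one> = \<one>\<^bsub>R\<^esub>"
  using alg_hom_one[OF counit_hom]
  by (simp add: scalar_alg_def ring.extend_def module.fields_def)

lemma comult_mod_hom: "comult H \<in> mod_hom R H (tensor R H H)"
  using alg_hom_mod_hom[OF comult_hom] by (simp add: mod_hom_def tensor_alg_simps)

lemma comult_closed: "x \<in> carrier H \<Longrightarrow> comult H x \<in> carrier (tensor R H H)"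
  by (rule mod_hom_closed[OF comult_mod_hom])

lemmas module_HH = tensor_module[OF module_H module_H]

lemma SW_closed:
  assumes "module R P" "h \<in> carrier H"
    and "\<And>x y. \<lbrakk>x \<in> carrier H; y \<in> carrier H\<rbrakk> \<Longrightarrow> f x y \<in> carrier P"
  shows "SW P f h \<in> carrier P"
  unfolding sweedler_def
  by (rule tensor_lift_closed[OF module_H module_H comult_closed[OF assms(2)] assms(1,3)])

lemma SW_cong:
  assumes "module R P" "h \<in> carrier H"
    and "\<And>x y. \<lbrakk>x \<in> carrier H; y \<in> carrier H\<rbrakk> \<Longrightarrow> f x y \<in> carrier P"
    and "\<And>x y. \<lbrakk>x \<in> carrier H; y \<in> carrier H\<rbrakk> \<Longrightarrow> f x y = g x y"
  shows "SW P f h = SW P g h"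
  unfolding sweedler_def
  by (rule tensor_lift_cong[OF module_H module_H comult_closed[OF assms(2)] assms(1,3,4)])

lemma SW_image:
  assumes "module R P" "module R Q" "g \<in> mod_hom R P Q" "h \<in> carrier H"
    and "\<And>x y. \<lbrakk>x \<in> carrier H; y \<in> carrier H\<rbrakk> \<Longrightarrow> f x y \<in> carrier P"
  shows "g (SW P f h) = SW Q (\<lambda>x y. g (f x y)) h"
  unfolding sweedler_def
  by (rule tensor_lift_image[OF module_H module_H comult_closed[OF assms(4)] assms(1,2,3,5)])

lemma SW_param:
  assumes "module R L" "module R P" "h \<in> carrier H"
    and "\<And>x y. \<lbrakk>x \<in> carrier H; y \<in> carrier H\<rbrakk> \<Longrightarrow> (\<lambda>u. f u x y) \<in> mod_hom R L P"
  shows "(\<lambda>u. SW P (f u) h) \<in> mod_hom R L P"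
  unfolding sweedler_def
  by (rule tensor_lift_param[OF module_H module_H comult_closed[OF assms(3)] assms(1,2,4)])

lemma SW_swap:
  assumes "module R P" "h \<in> carrier H" "l \<in> carrier H"
    and "\<And>x y u v. \<lbrakk>x \<in> carrier H; y \<in> carrier H; u \<in> carrier H; v \<in> carrier H\<rbrakk>
      \<Longrightarrow> f x y u v \<in> carrier P"
  shows "SW P (\<lambda>x y. SW P (f x y) l) h = SW P (\<lambda>u v. SW P (\<lambda>x y. f x y u v) h) l"
  unfolding sweedler_def
  by (rule tensor_lift_swap[OF module_H module_H comult_closed[OF assms(2)]
        module_H module_H comult_closed[OF assms(3)] assms(1,4)])

lemma SW_lin:
  assumes "module R P"
    and "\<And>x. x \<in> carrier H \<Longrightarrow> f x \<in> mod_hom R H P"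
    and "\<And>y. y \<in> carrier H \<Longrightarrow> (\<lambda>x. f x y) \<in> mod_hom R H P"
    and "g \<in> mod_hom R L H"
  shows "(\<lambda>u. SW P f (g u)) \<in> mod_hom R L P"
  unfolding sweedler_def
  by (rule mod_hom_compose[OF mod_hom_compose[OF assms(4) comult_mod_hom]
        tensor_lift_hom[OF module_H module_H assms(1) bilinI[OF assms(2,3)]]])

lemma S_lin: "f \<in> mod_hom R M H \<Longrightarrow> (\<lambda>x. S (f x)) \<in> mod_hom R M H"
  by (rule mod_hom_compose[OF _ antipode_hom])

lemma counit_smult_lin:
  assumes "module R P" "f \<in> mod_hom R M H" "c \<in> carrier P"
  shows "(\<lambda>x. counit H (f x) \<odot>\<^bsub>P\<^esub> c) \<in> mod_hom R M P"
proof -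
  interpret P: module R P by fact
  have c: "counit H (x \<oplus>\<^bsub>H\<^esub> y) = counit H x \<oplus>\<^bsub>R\<^esub> counit H y"
    if "x \<in> carrier H" "y \<in> carrier H" for x y
    using mod_hom_add[OF alg_hom_mod_hom[OF counit_hom] that]
    by (simp add: scalar_alg_def ring.extend_def module.fields_def)
  have s: "counit H (a \<odot>\<^bsub>H\<^esub> x) = a \<otimes>\<^bsub>R\<^esub> counit H x"
    if "a \<in> carrier R" "x \<in> carrier H" for x a
    using mod_hom_smult[OF alg_hom_mod_hom[OF counit_hom] that]
    by (simp add: scalar_alg_def ring.extend_def module.fields_def)
  show ?thesis
    using assms(2,3) by (intro mod_homI)
      (auto simp: mod_hom_add[OF assms(2)] mod_hom_smult[OF assms(2)] mod_hom_closed[OF assms(2)]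
        c s counit_closed P.smult_l_distr P.smult_assoc1)
qed

lemma smult_closed': "\<lbrakk>module R P; a \<in> carrier R; x \<in> carrier P\<rbrakk> \<Longrightarrow> a \<odot>\<^bsub>P\<^esub> x \<in> carrier P"
  by (rule module.smult_closed)

text \<open>Together these rules establish that an expression is linear in a variable that occurs
  exactly once in it, by recursion on the expression.\<close>

lemmas lin = module_H module_HH mod_hom_id antipode_hom
  lin_mult_left[OF algebra_H] lin_mult_right[OF algebra_H] S_lin
  SW_param SW_lin counit_smult_lin mod_hom_fun_smult
  SW_closed S_closed counit_closed m_closed one_closed smult_closed'

lemma SW_times_left:
  assumes A: "assoc_algebra R A" and "h \<in> carrier H" "c \<in> carrier A"
    and "\<And>x y. \<lbrakk>x \<in> carrier H; y \<in> carrier H\<rbrakk> \<Longrightarrow> f x y \<in> carrier A"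
  shows "c \<otimes>\<^bsub>A\<^esub> SW A f h = SW A (\<lambda>x y. c \<otimes>\<^bsub>A\<^esub> f x y) h"
proof -
  interpret A: assoc_algebra R A by fact
  show ?thesis
    by (rule SW_image[OF A.module_axioms A.module_axioms lin_mult_left[OF A mod_hom_id] assms(2,4)])
      (use assms in auto)
qed

lemma SW_times_right:
  assumes A: "assoc_algebra R A" and "h \<in> carrier H" "c \<in> carrier A"
    and "\<And>x y. \<lbrakk>x \<in> carrier H; y \<in> carrier H\<rbrakk> \<Longrightarrow> f x y \<in> carrier A"
  shows "SW A f h \<otimes>\<^bsub>A\<^esub> c = SW A (\<lambda>x y. f x y \<otimes>\<^bsub>A\<^esub> c) h"
proof -
  interpret A: assoc_algebra R A by fact
  show ?thesis
    by (rule SW_image[OF A.module_axioms A.module_axioms lin_mult_right[OF A mod_hom_id] assms(2,4)])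
      (use assms in auto)
qed

text \<open>
  Both sides are the images of the two sides of the coassociativity axiom under the linear map on
  \<open>H \<otimes> (H \<otimes> H)\<close> which is induced by the trilinear function \<open>f\<close>.
\<close>

lemma SW_coassoc:
  assumes P: "module R P"
    and f1: "\<And>y z. \<lbrakk>y \<in> carrier H; z \<in> carrier H\<rbrakk> \<Longrightarrow> (\<lambda>x. f x y z) \<in> mod_hom R H P"
    and f2: "\<And>x z. \<lbrakk>x \<in> carrier H; z \<in> carrier H\<rbrakk> \<Longrightarrow> (\<lambda>y. f x y z) \<in> mod_hom R H P"
    and f3: "\<And>x y. \<lbrakk>x \<in> carrier H; y \<in> carrier H\<rbrakk> \<Longrightarrow> (\<lambda>z. f x y z) \<in> mod_hom R H P"
    and h: "h \<in> carrier H"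
  shows "SW P (\<lambda>x z. SW P (\<lambda>u v. f u v z) x) h = SW P (\<lambda>x z. SW P (\<lambda>u v. f x u v) z) h"
proof -
  let ?T = "tensor R H H" and ?T3 = "tensor R H (tensor R H H)"
  note T = module_HH
  have T3: "module R ?T3" by (rule tensor_module[OF module_H T])
  have f: "bilin R H H P (f x)" if "x \<in> carrier H" for x
    using that by (intro bilinI f2 f3)
  let ?g = "\<lambda>x. tensor_lift P R (f x)"
  have g: "bilin R H ?T P ?g"
    by (rule tensor_lift_bilin_param[OF module_H module_H module_H P f f1])
  let ?G = "tensor_lift P R ?g"
  have G: "?G \<in> mod_hom R ?T3 P" by (rule tensor_lift_hom[OF module_H T P g])
  note tb = tens_bilin[OF module_H module_H] tens_bilin[OF module_H T]
  have tc: "tens R H H x y \<in> carrier ?T" if "x \<in> carrier H" "y \<in> carrier H" for x y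
    using that by (rule tens_closed[OF module_H module_H])
  have tc3: "tens R H ?T x y \<in> carrier ?T3" if "x \<in> carrier H" "y \<in> carrier ?T" for x y
    using that by (rule tens_closed[OF module_H T])
  have Gt: "?G (tens R H ?T x (tens R H H y z)) = f x y z"
    if "x \<in> carrier H" "y \<in> carrier H" "z \<in> carrier H" for x y z
    using that by (simp add: tensor_lift_tens[OF module_H T P g] tc
        tensor_lift_tens[OF module_H module_H P f])
  have fc: "f x y z \<in> carrier P" if "x \<in> carrier H" "y \<in> carrier H" "z \<in> carrier H" for x y z
    using mod_hom_closed[OF f3] that by blast
  have "SW P (\<lambda>x z. SW P (\<lambda>u v. f u v z) x) h =
      SW P (\<lambda>x z. SW P (\<lambda>u v. ?G (tens R H ?T u (tens R H H v z))) x) h"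
    by (intro SW_cong SW_closed P h Gt[symmetric] fc)
  also have "\<dots> = SW P (\<lambda>x z. ?G (SW ?T3 (\<lambda>u v. tens R H ?T u (tens R H H v z)) x)) h"
    by (intro SW_cong h P SW_closed mod_hom_closed[OF G] tc tc3 SW_image[OF T3 P G, symmetric])
  also have "\<dots> = ?G (SW ?T3 (\<lambda>x z. SW ?T3 (\<lambda>u v. tens R H ?T u (tens R H H v z)) x) h)"
    by (intro h P SW_closed T3 tc tc3 SW_image[OF T3 P G, symmetric])
  also have "\<dots> = ?G (SW ?T3 (\<lambda>x z. tens R H ?T x (comult H z)) h)"
    by (simp only: coassoc[OF h])
  also have "\<dots> = SW P (\<lambda>x z. ?G (tens R H ?T x (comult H z))) h"
    by (intro h P SW_image T3 G tc3 comult_closed)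
  also have "\<dots> = SW P (\<lambda>x z. SW P (\<lambda>u v. f x u v) z) h"
    using mod_hom_closed[OF G] tc3 comult_closed
      mod_hom_closed[OF tensor_lift_hom[OF module_H module_H P f]]
    by (intro SW_cong P h) (auto simp: tensor_lift_tens[OF module_H T P g] sweedler_def)
  finally show ?thesis .
qed

lemma SW_counit_left:
  assumes P: "module R P" and f: "f \<in> mod_hom R H P" and h: "h \<in> carrier H"
  shows "SW P (\<lambda>x y. counit H x \<odot>\<^bsub>P\<^esub> f y) h = f h"
proof -
  have "f h = f (SW H (\<lambda>x y. counit H x \<odot>\<^bsub>H\<^esub> y) h)"
    by (simp only: counit_left[OF h])
  also have "\<dots> = SW P (\<lambda>x y. f (counit H x \<odot>\<^bsub>H\<^esub> y)) h"
    by (intro SW_image f h P lin)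
  also have "\<dots> = SW P (\<lambda>x y. counit H x \<odot>\<^bsub>P\<^esub> f y) h"
    by (intro SW_cong P h mod_hom_closed[OF f] mod_hom_smult[OF f] lin)
  finally show ?thesis by simp
qed

lemma SW_counit_right:
  assumes P: "module R P" and f: "f \<in> mod_hom R H P" and h: "h \<in> carrier H"
  shows "SW P (\<lambda>x y. counit H y \<odot>\<^bsub>P\<^esub> f x) h = f h"
proof -
  have "f h = f (SW H (\<lambda>x y. counit H y \<odot>\<^bsub>H\<^esub> x) h)"
    by (simp only: counit_right[OF h])
  also have "\<dots> = SW P (\<lambda>x y. f (counit H y \<odot>\<^bsub>H\<^esub> x)) h"
    by (intro SW_image f h P lin)
  also have "\<dots> = SW P (\<lambda>x y. counit H y \<odot>\<^bsub>P\<^esub> f x) h"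
    by (intro SW_cong P h mod_hom_closed[OF f] mod_hom_smult[OF f] lin)
  finally show ?thesis by simp
qed

lemma SW_antipode_left:
  assumes P: "module R P" and f: "f \<in> mod_hom R H P" and h: "h \<in> carrier H"
  shows "SW P (\<lambda>x y. f (S x \<otimes> y)) h = counit H h \<odot>\<^bsub>P\<^esub> f \<one>"
proof -
  have "SW P (\<lambda>x y. f (S x \<otimes> y)) h = f (SW H (\<lambda>x y. S x \<otimes> y) h)"
    by (intro SW_image[symmetric] f h P lin)
  then show ?thesis
    using mod_hom_smult[OF f counit_closed[OF h] one_closed] by (simp only: antipode_left[OF h])
qed

lemma SW_antipode_right:
  assumes P: "module R P" and f: "f \<in> mod_hom R H P" and h: "h \<in> carrier H"
  shows "SW P (\<lambda>x y. f (x \<otimes> S y)) h = counit H h \<odot>\<^bsub>P\<^esub> f \<one>"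
proof -
  have "SW P (\<lambda>x y. f (x \<otimes> S y)) h = f (SW H (\<lambda>x y. x \<otimes> S y) h)"
    by (intro SW_image[symmetric] f h P lin)
  then show ?thesis
    using mod_hom_smult[OF f counit_closed[OF h] one_closed] by (simp only: antipode_right[OF h])
qed

lemma SW_mult:
  assumes P: "module R P" and f: "bilin R H H P f" and h: "h \<in> carrier H" and l: "l \<in> carrier H"
  shows "SW P f (h \<otimes> l) = SW P (\<lambda>x y. SW P (\<lambda>u v. f (x \<otimes> u) (y \<otimes> v)) l) h"
proof -
  let ?T = "tensor R H H"
  let ?f = "tensor_lift P R f"
  have L: "?f \<in> mod_hom R ?T P" by (rule tensor_lift_hom[OF module_H module_H P f])
  note tc = tens_closed[OF module_H module_H]
  have "comult H (h \<otimes> l) = SW ?T (\<lambda>x y. SW ?T (\<lambda>u v. tens R H H (x \<otimes> u) (y \<otimes> v)) l) h"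
    using alg_hom_mult[OF comult_hom h l] by (simp add: tensor_alg_simps sweedler_def)
  then have "SW P f (h \<otimes> l) = ?f (SW ?T (\<lambda>x y. SW ?T (\<lambda>u v. tens R H H (x \<otimes> u) (y \<otimes> v)) l) h)"
    by (simp only: sweedler_def)
  also have "\<dots> = SW P (\<lambda>x y. ?f (SW ?T (\<lambda>u v. tens R H H (x \<otimes> u) (y \<otimes> v)) l)) h"
    by (intro SW_image module_HH P L h l tc lin)
  also have "\<dots> = SW P (\<lambda>x y. SW P (\<lambda>u v. ?f (tens R H H (x \<otimes> u) (y \<otimes> v))) l) h"
    by (intro SW_cong SW_image mod_hom_closed[OF L] module_HH P L h l tc lin)
  also have "\<dots> = SW P (\<lambda>x y. SW P (\<lambda>u v. f (x \<otimes> u) (y \<otimes> v)) l) h"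
    by (intro SW_cong SW_closed tensor_lift_tens[OF module_H module_H P f] mod_hom_closed[OF L]
        P h l tc m_closed)
  finally show ?thesis .
qed

lemma SW_one:
  assumes P: "module R P" and f: "bilin R H H P f"
  shows "SW P f \<one> = f \<one> \<one>"
  using alg_hom_one[OF comult_hom]
  by (simp add: sweedler_def tensor_alg_simps tensor_lift_tens[OF module_H module_H P f])

lemma S_one: "S \<one> = \<one>"
proof -
  have "SW H (\<lambda>x y. S x \<otimes> y) \<one> = S \<one> \<otimes> \<one>"
    by (intro SW_one module_H bilinI) (rule lin | assumption)+
  then show ?thesis
    using antipode_left[OF one_closed] S_closed[OF one_closed] by (simp add: counit_one)
qed

text \<open>
  \<open>G(h\<^sub>1, S(h\<^sub>2) h\<^sub>3) = G(h\<^sub>1, h\<^sub>2 S(h\<^sub>3)) = G(h, 1)\<close>: the antipode axiom leaves a counit, which the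
  counit axiom removes.
\<close>

lemma SW_cancel_right:
  assumes P: "module R P" and G: "bilin R H H P G" and h: "h \<in> carrier H"
  shows "SW P (\<lambda>x z. SW P (\<lambda>u v. G x (S u \<otimes> v)) z) h = G h \<one>"
    and "SW P (\<lambda>x z. SW P (\<lambda>u v. G x (u \<otimes> S v)) z) h = G h \<one>"
proof -
  note l = P G h bilin_compose_left[OF G] bilin_compose_right[OF G] bilin_closed[OF G]
    bilin_left[OF G] bilin_right[OF G] lin
  have c: "SW P (\<lambda>x z. counit H z \<odot>\<^bsub>P\<^esub> G x \<one>) h = G h \<one>"
    by (rule SW_counit_right) (rule l | assumption)+
  have "SW P (\<lambda>x z. SW P (\<lambda>u v. G x (S u \<otimes> v)) z) h = SW P (\<lambda>x z. counit H z \<odot>\<^bsub>P\<^esub> G x \<one>) h"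
    by (rule SW_cong) (rule SW_antipode_left l | assumption)+
  with c show "SW P (\<lambda>x z. SW P (\<lambda>u v. G x (S u \<otimes> v)) z) h = G h \<one>" by simp
  have "SW P (\<lambda>x z. SW P (\<lambda>u v. G x (u \<otimes> S v)) z) h = SW P (\<lambda>x z. counit H z \<odot>\<^bsub>P\<^esub> G x \<one>) h"
    by (rule SW_cong) (rule SW_antipode_right l | assumption)+
  with c show "SW P (\<lambda>x z. SW P (\<lambda>u v. G x (u \<otimes> S v)) z) h = G h \<one>" by simp
qed

text \<open>
  \<open>G(S(h\<^sub>1) h\<^sub>2, h\<^sub>3) = G(h\<^sub>1 S(h\<^sub>2), h\<^sub>3) = G(1, h)\<close>.  The sums are bracketed to the right, so that both
  cancellation rules apply in the middle of longer sums.
\<close>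

lemma SW_cancel_left:
  assumes P: "module R P" and G: "bilin R H H P G" and h: "h \<in> carrier H"
  shows "SW P (\<lambda>x z. SW P (\<lambda>u v. G (S x \<otimes> u) v) z) h = G \<one> h"
    and "SW P (\<lambda>x z. SW P (\<lambda>u v. G (x \<otimes> S u) v) z) h = G \<one> h"
proof -
  note l = P G h bilin_compose_left[OF G] bilin_compose_right[OF G] bilin_closed[OF G]
    bilin_left[OF G] bilin_right[OF G] lin
  have c: "SW P (\<lambda>x z. counit H x \<odot>\<^bsub>P\<^esub> G \<one> z) h = G \<one> h"
    by (rule SW_counit_left) (rule l | assumption)+
  have "SW P (\<lambda>x z. SW P (\<lambda>u v. G (S x \<otimes> u) v) z) h = SW P (\<lambda>x z. SW P (\<lambda>u v. G (S u \<otimes> v) z) x) h"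
    by (rule SW_coassoc[symmetric]) (rule l | assumption)+
  also have "\<dots> = SW P (\<lambda>x z. counit H x \<odot>\<^bsub>P\<^esub> G \<one> z) h"
    by (rule SW_cong, (rule l | assumption)+, rule SW_antipode_left) (rule l | assumption)+
  also note c
  finally show "SW P (\<lambda>x z. SW P (\<lambda>u v. G (S x \<otimes> u) v) z) h = G \<one> h" .
  have "SW P (\<lambda>x z. SW P (\<lambda>u v. G (x \<otimes> S u) v) z) h = SW P (\<lambda>x z. SW P (\<lambda>u v. G (u \<otimes> S v) z) x) h"
    by (rule SW_coassoc[symmetric]) (rule l | assumption)+
  also have "\<dots> = SW P (\<lambda>x z. counit H x \<odot>\<^bsub>P\<^esub> G \<one> z) h"
    by (rule SW_cong, (rule l | assumption)+, rule SW_antipode_right) (rule l | assumption)+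
  also note c
  finally show "SW P (\<lambda>x z. SW P (\<lambda>u v. G (x \<otimes> S u) v) z) h = G \<one> h" .
qed

text \<open>
  Both \<open>S(hl)\<close> and \<open>S(l) S(h)\<close> are convolution inverse to \<open>hl\<close>.  Written out, this is the evaluation of
  \<open>S(h\<^sub>1l\<^sub>1) (h\<^sub>2l\<^sub>2) S(l\<^sub>3) S(h\<^sub>3)\<close> in two ways: cancelling on the right gives \<open>S(hl)\<close>, and cancelling
  on the left, where \<open>\<Delta>\<close> is multiplicative, gives \<open>S(l) S(h)\<close>.
\<close>

lemma S_mult:
  assumes h: "h \<in> carrier H" and l: "l \<in> carrier H"
  shows "S (h \<otimes> l) = S l \<otimes> S h"
proof -
  note r = h l lin
  let ?F = "\<lambda>x u v y a b. (S (x \<otimes> y) \<otimes> (u \<otimes> a)) \<otimes> (S b \<otimes> S v)"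
  have "S (h \<otimes> l) = S (h \<otimes> l) \<otimes> \<one>"
    using h l by (simp add: S_closed)
  also have "\<dots> = SW H (\<lambda>x z. SW H (\<lambda>u v. S (x \<otimes> l) \<otimes> (u \<otimes> S v)) z) h"
    \<comment> \<open>insert \<open>h\<^sub>2 S(h\<^sub>3)\<close>, and then \<open>l\<^sub>2 S(l\<^sub>3)\<close> between these two factors\<close>
    by (rule SW_cancel_right(2)[symmetric, where G = "\<lambda>x t. S (x \<otimes> l) \<otimes> t"])
      (rule bilinI r | assumption)+
  also have "\<dots> = SW H (\<lambda>x z. SW H (\<lambda>u v. SW H (\<lambda>y w. SW H (\<lambda>a b. ?F x u v y a b) w) l) z) h"
  proof -
    have "S (x \<otimes> l) \<otimes> (u \<otimes> S v) = SW H (\<lambda>y w. SW H (\<lambda>a b. ?F x u v y a b) w) l"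
      if x: "x \<in> carrier H" and u: "u \<in> carrier H" and v: "v \<in> carrier H" for x u v
    proof -
      have "S (x \<otimes> l) \<otimes> (u \<otimes> S v) = S (x \<otimes> l) \<otimes> ((u \<otimes> \<one>) \<otimes> S v)"
        using u by simp
      also have "\<dots> = SW H (\<lambda>y w. SW H (\<lambda>a b. S (x \<otimes> y) \<otimes> ((u \<otimes> (a \<otimes> S b)) \<otimes> S v)) w) l"
        by (rule SW_cancel_right(2)[symmetric, where G = "\<lambda>y t. S (x \<otimes> y) \<otimes> ((u \<otimes> t) \<otimes> S v)"])
          (rule bilinI r x u v | assumption)+
      also have "\<dots> = SW H (\<lambda>y w. SW H (\<lambda>a b. ?F x u v y a b) w) l"
      proof -
        have "S (x \<otimes> y) \<otimes> ((u \<otimes> (a \<otimes> S b)) \<otimes> S v) = ?F x u v y a b"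
          if "y \<in> carrier H" "a \<in> carrier H" "b \<in> carrier H" for y a b
          using that x u v by (simp add: m_assoc S_closed)
        then show ?thesis
          by - (assumption | rule SW_cong r x u v)+
      qed
      finally show ?thesis .
    qed
    then show ?thesis
      by - (assumption | rule SW_cong r)+
  qed
  also have "\<dots> = SW H (\<lambda>x z. SW H (\<lambda>u v. SW H (\<lambda>w b. SW H (\<lambda>y a. ?F x u v y a b) w) l) z) h"
    by (rule SW_cong r SW_coassoc[symmetric] refl | assumption)+
  also have "\<dots> = SW H (\<lambda>z v. SW H (\<lambda>x u. SW H (\<lambda>w b. SW H (\<lambda>y a. ?F x u v y a b) w) l) z) h"
    by (rule SW_coassoc[symmetric]) (rule r | assumption)+
  also have "\<dots> = SW H (\<lambda>z v. counit H z \<odot> (S l \<otimes> S v)) h"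
  proof -
    have "SW H (\<lambda>x u. SW H (\<lambda>w b. SW H (\<lambda>y a. ?F x u v y a b) w) l) z =
        counit H z \<odot> (S l \<otimes> S v)"
      if z: "z \<in> carrier H" and v: "v \<in> carrier H" for z v
    proof -
      have "SW H (\<lambda>x u. SW H (\<lambda>w b. SW H (\<lambda>y a. ?F x u v y a b) w) l) z =
          SW H (\<lambda>w b. SW H (\<lambda>x u. SW H (\<lambda>y a. ?F x u v y a b) w) z) l"
        by (rule SW_swap) (rule r z v | assumption)+
      also have "\<dots> = SW H (\<lambda>w b. counit H w \<odot> (counit H z \<odot> (S b \<otimes> S v))) l"
      proof -
        have "SW H (\<lambda>x u. SW H (\<lambda>y a. ?F x u v y a b) w) z =
            counit H w \<odot> (counit H z \<odot> (S b \<otimes> S v))"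
          if w: "w \<in> carrier H" and b: "b \<in> carrier H" for w b
        proof -
          have "SW H (\<lambda>x u. SW H (\<lambda>y a. ?F x u v y a b) w) z =
              SW H (\<lambda>p q. (S p \<otimes> q) \<otimes> (S b \<otimes> S v)) (z \<otimes> w)"
            by (rule SW_mult[symmetric]) (rule bilinI r z v w b | assumption)+
          also have "\<dots> = counit H (z \<otimes> w) \<odot> (\<one> \<otimes> (S b \<otimes> S v))"
            by (rule SW_antipode_left[where f = "\<lambda>t. t \<otimes> (S b \<otimes> S v)"])
              (rule r z v w b | assumption)+
          also have "\<dots> = counit H w \<odot> (counit H z \<odot> (S b \<otimes> S v))"
            using z w v b by (simp add: counit_mult S_closed counit_closed smult_assoc1[symmetric] R.m_comm)
          finally show ?thesis .
        qed
        then show ?thesis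
          by - (assumption | rule SW_cong r z v)+
      qed
      also have "\<dots> = counit H z \<odot> (S l \<otimes> S v)"
        by (rule SW_counit_left[where f = "\<lambda>b. counit H z \<odot> (S b \<otimes> S v)"])
          (rule r z v | assumption)+
      finally show ?thesis .
    qed
    then show ?thesis
      by - (assumption | rule SW_cong r)+
  qed
  also have "\<dots> = S l \<otimes> S h"
    by (rule SW_counit_left[where f = "\<lambda>v. S l \<otimes> S v"]) (rule r | assumption)+
  finally show ?thesis .
qed

text \<open>
  The antipode reverses the comultiplication, because \<open>\<Delta>(S h)\<close> and \<open>S h\<^sub>2 \<otimes> S h\<^sub>1\<close> are both convolution
  inverse to \<open>\<Delta>\<close>.  Written out, this is the evaluation of \<open>\<Delta>(S h\<^sub>1) (h\<^sub>2 \<otimes> h\<^sub>3) (S h\<^sub>5 \<otimes> S h\<^sub>4)\<close> in two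
  ways.
\<close>

lemma SW_S:
  assumes P: "module R P" and f: "bilin R H H P f" and h: "h \<in> carrier H"
  shows "SW P f (S h) = SW P (\<lambda>x y. f (S y) (S x)) h"
proof -
  note r = P h bilin_compose_left[OF f] bilin_compose_right[OF f] bilin_closed[OF f]
    bilin_left[OF f] bilin_right[OF f] lin
  \<comment> \<open>\<open>K x t t'\<close> is the value of \<open>f\<close> on \<open>\<Delta>(S x) (t \<otimes> t')\<close>\<close>
  define K where "K x t t' = SW P (\<lambda>p q. f (p \<otimes> t) (q \<otimes> t')) (S x)" for x t t'
  have K: "(\<lambda>x. K (g x) t t') \<in> mod_hom R H P" "(\<lambda>x. K t (g x) t') \<in> mod_hom R H P"
    "(\<lambda>x. K t t' (g x)) \<in> mod_hom R H P"
    if "g \<in> mod_hom R H H" "t \<in> carrier H" "t' \<in> carrier H" for g t t'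
    unfolding K_def using that by - (rule r | assumption)+
  have Kc: "K x t t' \<in> carrier P" if "x \<in> carrier H" "t \<in> carrier H" "t' \<in> carrier H" for x t t'
    unfolding K_def using that by - (rule r | assumption)+
  note r = r K Kc
  have "SW P f (S h) = K h \<one> \<one>"
    unfolding K_def
    by (rule SW_cong) (rule r | assumption | simp only: r_one)+
  also have "\<dots> = SW P (\<lambda>x z. SW P (\<lambda>u v. K x (u \<otimes> S v) \<one>) z) h"
    by (rule SW_cancel_right(2)[symmetric, where G = "\<lambda>x t. K x t \<one>"])
      (rule bilinI r | assumption)+
  also have "\<dots> = SW P (\<lambda>x z. SW P (\<lambda>w b. SW P (\<lambda>u a. SW P (\<lambda>c d. K x (u \<otimes> S d) (a \<otimes> S c)) b) w) z) h"
  proof -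
    have "SW P (\<lambda>u v. K x (u \<otimes> S v) \<one>) z =
        SW P (\<lambda>w b. SW P (\<lambda>u a. SW P (\<lambda>c d. K x (u \<otimes> S d) (a \<otimes> S c)) b) w) z"
      if x: "x \<in> carrier H" and z: "z \<in> carrier H" for x z
    proof -
      have "K x (u \<otimes> S v) \<one> = SW P (\<lambda>a b. SW P (\<lambda>c d. K x (u \<otimes> S d) (a \<otimes> S c)) b) v"
        if "u \<in> carrier H" "v \<in> carrier H" for u v
        using that by - (rule SW_cancel_left(2)[symmetric, where G = "\<lambda>t w. K x (u \<otimes> S w) t"],
            (rule bilinI r x z | assumption)+)
      then have "SW P (\<lambda>u v. K x (u \<otimes> S v) \<one>) z =
          SW P (\<lambda>u v. SW P (\<lambda>a b. SW P (\<lambda>c d. K x (u \<otimes> S d) (a \<otimes> S c)) b) v) z"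
        by - (assumption | rule SW_cong r x z)+
      also have "\<dots> = SW P (\<lambda>w b. SW P (\<lambda>u a. SW P (\<lambda>c d. K x (u \<otimes> S d) (a \<otimes> S c)) b) w) z"
        by (rule SW_coassoc[symmetric]) (rule r x z | assumption)+
      finally show ?thesis .
    qed
    then show ?thesis
      by - (assumption | rule SW_cong r)+
  qed
  also have "\<dots> = SW P (\<lambda>z b. SW P (\<lambda>x w. SW P (\<lambda>u a. SW P (\<lambda>c d. K x (u \<otimes> S d) (a \<otimes> S c)) b) w) z) h"
    by (rule SW_coassoc[symmetric]) (rule r | assumption)+
  also have "\<dots> = SW P (\<lambda>z b. counit H z \<odot>\<^bsub>P\<^esub> SW P (\<lambda>c d. f (S d) (S c)) b) h"
  proof -
    have "SW P (\<lambda>x w. SW P (\<lambda>u a. SW P (\<lambda>c d. K x (u \<otimes> S d) (a \<otimes> S c)) b) w) z =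
        counit H z \<odot>\<^bsub>P\<^esub> SW P (\<lambda>c d. f (S d) (S c)) b"
      if z: "z \<in> carrier H" and b: "b \<in> carrier H" for z b
    proof -
      have "SW P (\<lambda>x w. SW P (\<lambda>u a. SW P (\<lambda>c d. K x (u \<otimes> S d) (a \<otimes> S c)) b) w) z =
          SW P (\<lambda>x w. SW P (\<lambda>c d. SW P (\<lambda>u a. K x (u \<otimes> S d) (a \<otimes> S c)) w) b) z"
        by (rule SW_cong, (rule r z b | assumption)+, rule SW_swap) (rule r z b | assumption)+
      also have "\<dots> = SW P (\<lambda>c d. SW P (\<lambda>x w. SW P (\<lambda>u a. K x (u \<otimes> S d) (a \<otimes> S c)) w) z) b"
        by (rule SW_swap) (rule r z b | assumption)+
      also have "\<dots> = SW P (\<lambda>c d. counit H z \<odot>\<^bsub>P\<^esub> f (S d) (S c)) b"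
      proof -
        have "SW P (\<lambda>x w. SW P (\<lambda>u a. K x (u \<otimes> S d) (a \<otimes> S c)) w) z =
            counit H z \<odot>\<^bsub>P\<^esub> f (S d) (S c)"
          if c: "c \<in> carrier H" and d: "d \<in> carrier H" for c d
        proof -
          let ?g = "\<lambda>p q. f (p \<otimes> S d) (q \<otimes> S c)"
          have "SW P (\<lambda>u a. K x (u \<otimes> S d) (a \<otimes> S c)) w = SW P ?g (S x \<otimes> w)"
            if x: "x \<in> carrier H" and w: "w \<in> carrier H" for x w
          proof -
            have "SW P (\<lambda>u a. K x (u \<otimes> S d) (a \<otimes> S c)) w =
                SW P (\<lambda>p q. SW P (\<lambda>u a. f (p \<otimes> (u \<otimes> S d)) (q \<otimes> (a \<otimes> S c))) w) (S x)"
              unfolding K_def by (rule SW_swap) (rule r c d x w | assumption)+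
            also have "\<dots> = SW P (\<lambda>p q. SW P (\<lambda>u a. ?g (p \<otimes> u) (q \<otimes> a)) w) (S x)"
            proof -
              have "f (p \<otimes> (u \<otimes> S d)) (q \<otimes> (a \<otimes> S c)) = ?g (p \<otimes> u) (q \<otimes> a)"
                if "p \<in> carrier H" "q \<in> carrier H" "u \<in> carrier H" "a \<in> carrier H" for p q u a
                using that c d by (simp add: m_assoc S_closed)
              then show ?thesis
                by - (assumption | rule SW_cong r c d x w)+
            qed
            also have "\<dots> = SW P ?g (S x \<otimes> w)"
              by (rule SW_mult[symmetric]) (rule bilinI r c d x w | assumption)+
            finally show ?thesis .
          qed
          then have "SW P (\<lambda>x w. SW P (\<lambda>u a. K x (u \<otimes> S d) (a \<otimes> S c)) w) z =
              SW P (\<lambda>x w. SW P ?g (S x \<otimes> w)) z"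
            by - (assumption | rule SW_cong r c d z)+
          also have "\<dots> = counit H z \<odot>\<^bsub>P\<^esub> SW P ?g \<one>"
            by (rule SW_antipode_left[where f = "SW P ?g"]) (rule r c d z | assumption)+
          also have "SW P ?g \<one> = ?g \<one> \<one>"
            by (rule SW_one) (rule bilinI r c d z | assumption)+
          finally show ?thesis using c d by (simp add: S_closed)
        qed
        then show ?thesis
          by - (assumption | rule SW_cong r z b)+
      qed
      also have "\<dots> = counit H z \<odot>\<^bsub>P\<^esub> SW P (\<lambda>c d. f (S d) (S c)) b"
        by (rule SW_image[symmetric, where g = "\<lambda>t. counit H z \<odot>\<^bsub>P\<^esub> t"])
          (rule r z b | assumption)+
      finally show ?thesis .
    qed
    then show ?thesis
      by - (assumption | rule SW_cong r)+
  qed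
  also have "\<dots> = SW P (\<lambda>c d. f (S d) (S c)) h"
    by (rule SW_counit_left) (rule r | assumption)+
  finally show ?thesis .
qed

end

section \<open>Partial representations\<close>

text \<open>
  For \<open>\<epsilon>\<^sub>h = \<pi>(h\<^sub>1) \<pi>(S h\<^sub>2)\<close> and \<open>\<epsilon>'\<^sub>h = \<pi>(S h\<^sub>1) \<pi>(h\<^sub>2)\<close>, the four identities describe \<open>\<pi>(h) \<epsilon>\<^sub>l\<close>,
  \<open>\<epsilon>\<^sub>h \<pi>(l)\<close>, \<open>\<pi>(h) \<epsilon>'\<^sub>l\<close> and \<open>\<epsilon>'\<^sub>h \<pi>(l)\<close>: next to one of these elements, \<open>\<pi>\<close> is multiplicative.
\<close>

locale partial_rep = hopf_algebra R H + B: assoc_algebra R B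
  for R :: "'k ring" and H :: "('k, 'h) hopf" (structure) and B :: "('k, 'b) module" +
  fixes \<pi> :: "'h \<Rightarrow> 'b"
  assumes pi_hom: "\<pi> \<in> mod_hom R H B"
    and pi_one: "\<pi> \<one> = \<one>\<^bsub>B\<^esub>"
    and mult_eps: "\<lbrakk>h \<in> carrier H; l \<in> carrier H\<rbrakk> \<Longrightarrow>
      SW B (\<lambda>x y. \<pi> h \<otimes>\<^bsub>B\<^esub> \<pi> x \<otimes>\<^bsub>B\<^esub> \<pi> (S y)) l = SW B (\<lambda>x y. \<pi> (h \<otimes> x) \<otimes>\<^bsub>B\<^esub> \<pi> (S y)) l"
    and eps_mult: "\<lbrakk>h \<in> carrier H; l \<in> carrier H\<rbrakk> \<Longrightarrow>
      SW B (\<lambda>x y. \<pi> x \<otimes>\<^bsub>B\<^esub> \<pi> (S y) \<otimes>\<^bsub>B\<^esub> \<pi> l) h = SW B (\<lambda>x y. \<pi> x \<otimes>\<^bsub>B\<^esub> \<pi> (S y \<otimes> l)) h"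
    and mult_eps': "\<lbrakk>h \<in> carrier H; l \<in> carrier H\<rbrakk> \<Longrightarrow>
      SW B (\<lambda>x y. \<pi> h \<otimes>\<^bsub>B\<^esub> \<pi> (S x) \<otimes>\<^bsub>B\<^esub> \<pi> y) l = SW B (\<lambda>x y. \<pi> (h \<otimes> S x) \<otimes>\<^bsub>B\<^esub> \<pi> y) l"
    and eps'_mult: "\<lbrakk>h \<in> carrier H; l \<in> carrier H\<rbrakk> \<Longrightarrow>
      SW B (\<lambda>x y. \<pi> (S x) \<otimes>\<^bsub>B\<^esub> \<pi> y \<otimes>\<^bsub>B\<^esub> \<pi> l) h = SW B (\<lambda>x y. \<pi> (S x) \<otimes>\<^bsub>B\<^esub> \<pi> (y \<otimes> l)) h"
begin

abbreviation SB where "SB \<equiv> sweedler B R H"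
abbreviation Bmult (infixl \<open>\<cdot>\<close> 70) where "x \<cdot> y \<equiv> x \<otimes>\<^bsub>B\<^esub> y"

definition e where "e h = SB (\<lambda>x y. \<pi> x \<cdot> \<pi> (S y)) h"
definition e' where "e' h = SB (\<lambda>x y. \<pi> (S x) \<cdot> \<pi> y) h"
definition act where "act h a = SB (\<lambda>x y. \<pi> x \<cdot> a \<cdot> \<pi> (S y)) h"

lemma module_B: "module R B" by (rule B.module_axioms)
lemma algebra_B: "assoc_algebra R B" by (rule B.assoc_algebra_axioms)

lemma pi_closed: "x \<in> carrier H \<Longrightarrow> \<pi> x \<in> carrier B"
  by (rule mod_hom_closed[OF pi_hom])

lemma pi_lin: "f \<in> mod_hom R M H \<Longrightarrow> (\<lambda>x. \<pi> (f x)) \<in> mod_hom R M B"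
  by (rule mod_hom_compose[OF _ pi_hom])

lemmas lin_pi = lin module_B lin_mult_left[OF algebra_B] lin_mult_right[OF algebra_B]
  pi_hom pi_lin pi_closed B.m_closed B.one_closed

lemma e_lin: "f \<in> mod_hom R M H \<Longrightarrow> (\<lambda>x. e (f x)) \<in> mod_hom R M B"
  unfolding e_def by (rule lin_pi | assumption)+

lemma e'_lin: "f \<in> mod_hom R M H \<Longrightarrow> (\<lambda>x. e' (f x)) \<in> mod_hom R M B"
  unfolding e'_def by (rule lin_pi | assumption)+

lemma act_lin_left: "\<lbrakk>f \<in> mod_hom R M H; a \<in> carrier B\<rbrakk> \<Longrightarrow> (\<lambda>x. act (f x) a) \<in> mod_hom R M B"
  unfolding act_def by (rule lin_pi | assumption)+

lemma act_lin_right: "\<lbrakk>module R M; f \<in> mod_hom R M B; h \<in> carrier H\<rbrakk> \<Longrightarrow> (\<lambda>x. act h (f x)) \<in> mod_hom R M B"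
  unfolding act_def by (rule lin_pi | assumption)+

lemma e_closed: "h \<in> carrier H \<Longrightarrow> e h \<in> carrier B"
  unfolding e_def by (rule lin_pi | assumption)+

lemma e'_closed: "h \<in> carrier H \<Longrightarrow> e' h \<in> carrier B"
  unfolding e'_def by (rule lin_pi | assumption)+

lemma act_closed: "\<lbrakk>h \<in> carrier H; a \<in> carrier B\<rbrakk> \<Longrightarrow> act h a \<in> carrier B"
  unfolding act_def by (rule lin_pi | assumption)+

lemmas linB = e_lin e'_lin act_lin_left act_lin_right e_closed e'_closed act_closed lin_pi
lemmas clB = e_closed e'_closed act_closed pi_closed S_closed SW_closed[OF module_B]

lemmas SB_mult_left = SW_times_left[OF algebra_B]
lemmas SB_mult_right = SW_times_right[OF algebra_B]
lemmas SB_coassoc = SW_coassoc[OF module_B]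
lemmas SB_cong = SW_cong[OF module_B]

lemma pi_e:
  assumes "h \<in> carrier H" "l \<in> carrier H"
  shows "\<pi> h \<cdot> e l = SB (\<lambda>x y. \<pi> (h \<otimes> x) \<cdot> \<pi> (S y)) l"
proof -
  have "\<pi> h \<cdot> e l = SB (\<lambda>x y. \<pi> h \<cdot> (\<pi> x \<cdot> \<pi> (S y))) l"
    unfolding e_def by (rule SB_mult_left) (rule linB assms | assumption)+
  also have "\<dots> = SB (\<lambda>x y. \<pi> h \<cdot> \<pi> x \<cdot> \<pi> (S y)) l"
    using assms by (intro SB_cong) (simp_all add: B.m_assoc clB)
  finally show ?thesis by (simp only: mult_eps[OF assms])
qed

lemma e_pi:
  assumes "h \<in> carrier H" "l \<in> carrier H"
  shows "e h \<cdot> \<pi> l = SB (\<lambda>x y. \<pi> x \<cdot> \<pi> (S y \<otimes> l)) h"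
proof -
  have "e h \<cdot> \<pi> l = SB (\<lambda>x y. \<pi> x \<cdot> \<pi> (S y) \<cdot> \<pi> l) h"
    unfolding e_def by (rule SB_mult_right) (rule linB assms | assumption)+
  then show ?thesis by (simp only: eps_mult[OF assms])
qed

lemma pi_e':
  assumes "h \<in> carrier H" "l \<in> carrier H"
  shows "\<pi> h \<cdot> e' l = SB (\<lambda>x y. \<pi> (h \<otimes> S x) \<cdot> \<pi> y) l"
proof -
  have "\<pi> h \<cdot> e' l = SB (\<lambda>x y. \<pi> h \<cdot> (\<pi> (S x) \<cdot> \<pi> y)) l"
    unfolding e'_def by (rule SB_mult_left) (rule linB assms | assumption)+
  also have "\<dots> = SB (\<lambda>x y. \<pi> h \<cdot> \<pi> (S x) \<cdot> \<pi> y) l"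
    using assms by (intro SB_cong) (simp_all add: B.m_assoc clB)
  finally show ?thesis by (simp only: mult_eps'[OF assms])
qed

lemma e'_pi:
  assumes "h \<in> carrier H" "l \<in> carrier H"
  shows "e' h \<cdot> \<pi> l = SB (\<lambda>x y. \<pi> (S x) \<cdot> \<pi> (y \<otimes> l)) h"
proof -
  have "e' h \<cdot> \<pi> l = SB (\<lambda>x y. \<pi> (S x) \<cdot> \<pi> y \<cdot> \<pi> l) h"
    unfolding e'_def by (rule SB_mult_right) (rule linB assms | assumption)+
  then show ?thesis by (simp only: eps'_mult[OF assms])
qed

lemma SB_pi_e':
  assumes h: "h \<in> carrier H"
  shows "SB (\<lambda>x y. \<pi> x \<cdot> e' y) h = \<pi> h"
proof -
  have "SB (\<lambda>x y. \<pi> x \<cdot> e' y) h = SB (\<lambda>x z. SB (\<lambda>u v. \<pi> (x \<otimes> S u) \<cdot> \<pi> v) z) h"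
    by (assumption | rule SB_cong pi_e' h linB)+
  also have "\<dots> = \<pi> \<one> \<cdot> \<pi> h"
    by (rule SW_cancel_left(2)[where G = "\<lambda>t v. \<pi> t \<cdot> \<pi> v"])
      (assumption | rule bilinI h linB)+
  finally show ?thesis using h by (simp add: pi_one clB)
qed

lemma SB_e'_pi_S:
  assumes h: "h \<in> carrier H"
  shows "SB (\<lambda>x y. e' x \<cdot> \<pi> (S y)) h = \<pi> (S h)"
proof -
  have "SB (\<lambda>x y. e' x \<cdot> \<pi> (S y)) h = SB (\<lambda>x y. SB (\<lambda>u v. \<pi> (S u) \<cdot> \<pi> (v \<otimes> S y)) x) h"
    by (assumption | rule SB_cong e'_pi h linB)+
  also have "\<dots> = SB (\<lambda>x z. SB (\<lambda>v y. \<pi> (S x) \<cdot> \<pi> (v \<otimes> S y)) z) h"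
    by (rule SB_coassoc) (assumption | rule h linB)+
  also have "\<dots> = \<pi> (S h) \<cdot> \<pi> \<one>"
    by (rule SW_cancel_right(2)[where G = "\<lambda>x t. \<pi> (S x) \<cdot> \<pi> t"])
      (assumption | rule bilinI h linB)+
  finally show ?thesis using h by (simp add: pi_one clB)
qed

text \<open>
  \<open>\<epsilon>\<^bsub>h\<^sub>1k\<^esub> \<pi>(h\<^sub>2) = \<pi>(h\<^sub>1k\<^sub>1) \<pi>(S(h\<^sub>2k\<^sub>2) h\<^sub>3) = \<pi>(h\<^sub>1k\<^sub>1) \<pi>(S(k\<^sub>2) S(h\<^sub>2) h\<^sub>3) = \<pi>(hk\<^sub>1) \<pi>(S k\<^sub>2) = \<pi>(h) \<epsilon>\<^sub>k\<close>.
\<close>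

lemma pi_e_commute:
  assumes h: "h \<in> carrier H" and k: "k \<in> carrier H"
  shows "\<pi> h \<cdot> e k = SB (\<lambda>x y. e (x \<otimes> k) \<cdot> \<pi> y) h"
proof -
  let ?G = "\<lambda>a t. SB (\<lambda>c d. \<pi> (a \<otimes> c) \<cdot> \<pi> (S d \<otimes> t)) k"
  have "e (x \<otimes> k) \<cdot> \<pi> y = SB (\<lambda>a b. ?G a (S b \<otimes> y)) x"
    if x: "x \<in> carrier H" and y: "y \<in> carrier H" for x y
  proof -
    have "e (x \<otimes> k) \<cdot> \<pi> y = SB (\<lambda>u v. \<pi> u \<cdot> \<pi> (S v \<otimes> y)) (x \<otimes> k)"
      using x y k by (simp add: e_pi)
    also have "\<dots> = SB (\<lambda>a b. SB (\<lambda>c d. \<pi> (a \<otimes> c) \<cdot> \<pi> (S (b \<otimes> d) \<otimes> y)) k) x"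
      by (rule SW_mult) (assumption | rule bilinI x y k linB)+
    also have "\<dots> = SB (\<lambda>a b. ?G a (S b \<otimes> y)) x"
      using x y k by (intro SB_cong) (simp_all add: clB S_mult m_assoc)
    finally show ?thesis .
  qed
  then have "SB (\<lambda>x y. e (x \<otimes> k) \<cdot> \<pi> y) h = SB (\<lambda>x y. SB (\<lambda>a b. ?G a (S b \<otimes> y)) x) h"
    by - (assumption | rule SB_cong h k linB)+
  also have "\<dots> = SB (\<lambda>a z. SB (\<lambda>b y. ?G a (S b \<otimes> y)) z) h"
    by (rule SB_coassoc) (assumption | rule h k linB)+
  also have "\<dots> = ?G h \<one>"
    by (rule SW_cancel_right(1)[where G = ?G]) (assumption | rule bilinI h k linB)+
  also have "\<dots> = SB (\<lambda>c d. \<pi> (h \<otimes> c) \<cdot> \<pi> (S d)) k"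
    using h k by (intro SB_cong) (simp_all add: clB)
  finally show ?thesis using pi_e[OF h k] by simp
qed

text \<open>
  Move \<open>\<epsilon>\<^sub>k\<close> to the left through both factors of \<open>\<epsilon>'\<^sub>h\<close> by \<open>pi_e_commute\<close>; the index \<open>k\<close> becomes
  \<open>S(h\<^sub>2) h\<^sub>3 k\<close>, where \<open>h\<^sub>1\<close> and \<open>h\<^sub>4\<close> are the arguments of the remaining factors
  \<open>\<pi>(S h\<^sub>1) \<pi>(h\<^sub>4)\<close>, and hence returns to \<open>k\<close>.
\<close>

lemma e'_e_commute:
  assumes h: "h \<in> carrier H" and k: "k \<in> carrier H"
  shows "e' h \<cdot> e k = e k \<cdot> e' h"
proof -
  let ?G = "\<lambda>v p t. e (t \<otimes> k) \<cdot> \<pi> (S p) \<cdot> \<pi> v"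
  have 1: "\<pi> (S x) \<cdot> \<pi> y \<cdot> e k = SB (\<lambda>u v. SB (\<lambda>p q. ?G v p (S q \<otimes> u)) x) y"
    if x: "x \<in> carrier H" and y: "y \<in> carrier H" for x y
  proof -
    have "\<pi> (S x) \<cdot> \<pi> y \<cdot> e k = \<pi> (S x) \<cdot> SB (\<lambda>u v. e (u \<otimes> k) \<cdot> \<pi> v) y"
      using x y k by (simp add: B.m_assoc clB pi_e_commute)
    also have "\<dots> = SB (\<lambda>u v. \<pi> (S x) \<cdot> (e (u \<otimes> k) \<cdot> \<pi> v)) y"
      by (rule SB_mult_left) (assumption | rule x y k linB)+
    also have "\<dots> = SB (\<lambda>u v. SB (\<lambda>p q. ?G v p (S q \<otimes> u)) x) y"
    proof -
      have "\<pi> (S x) \<cdot> (e (u \<otimes> k) \<cdot> \<pi> v) = SB (\<lambda>p q. ?G v p (S q \<otimes> u)) x"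
        if u: "u \<in> carrier H" and v: "v \<in> carrier H" for u v
      proof -
        have "\<pi> (S x) \<cdot> (e (u \<otimes> k) \<cdot> \<pi> v) = SB (\<lambda>p q. e (p \<otimes> (u \<otimes> k)) \<cdot> \<pi> q) (S x) \<cdot> \<pi> v"
          using x u v k by (simp add: B.m_assoc[symmetric] clB pi_e_commute)
        also have "SB (\<lambda>p q. e (p \<otimes> (u \<otimes> k)) \<cdot> \<pi> q) (S x) = SB (\<lambda>p q. e (S q \<otimes> (u \<otimes> k)) \<cdot> \<pi> (S p)) x"
          by (rule SW_S) (assumption | rule bilinI x u v k linB)+
        also have "\<dots> \<cdot> \<pi> v = SB (\<lambda>p q. e (S q \<otimes> (u \<otimes> k)) \<cdot> \<pi> (S p) \<cdot> \<pi> v) x"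
          by (rule SB_mult_right) (assumption | rule x u v k linB)+
        also have "\<dots> = SB (\<lambda>p q. ?G v p (S q \<otimes> u)) x"
          using x u v k by (intro SB_cong) (simp_all add: clB m_assoc)
        finally show ?thesis .
      qed
      then show ?thesis
        by - (assumption | rule SB_cong x y k linB)+
    qed
    finally show ?thesis .
  qed
  have "e' h \<cdot> e k = SB (\<lambda>x y. \<pi> (S x) \<cdot> \<pi> y \<cdot> e k) h"
    unfolding e'_def by (rule SB_mult_right) (assumption | rule h k linB)+
  also have "\<dots> = SB (\<lambda>x y. SB (\<lambda>u v. SB (\<lambda>p q. ?G v p (S q \<otimes> u)) x) y) h"
    using 1 by - (assumption | rule SB_cong h k linB)+
  also have "\<dots> = SB (\<lambda>w v. SB (\<lambda>x u. SB (\<lambda>p q. ?G v p (S q \<otimes> u)) x) w) h"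
    by (rule SB_coassoc[symmetric]) (assumption | rule h k linB)+
  also have "\<dots> = SB (\<lambda>w v. ?G v w \<one>) h"
  proof -
    have "SB (\<lambda>x u. SB (\<lambda>p q. ?G v p (S q \<otimes> u)) x) w = ?G v w \<one>"
      if w: "w \<in> carrier H" and v: "v \<in> carrier H" for w v
    proof -
      have "SB (\<lambda>x u. SB (\<lambda>p q. ?G v p (S q \<otimes> u)) x) w =
          SB (\<lambda>p z. SB (\<lambda>q u. ?G v p (S q \<otimes> u)) z) w"
        by (rule SB_coassoc) (assumption | rule w v k linB)+
      also have "\<dots> = ?G v w \<one>"
        by (rule SW_cancel_right(1)[where G = "?G v"]) (assumption | rule bilinI w v k linB)+
      finally show ?thesis .
    qed
    then show ?thesis
      by - (assumption | rule SB_cong h k linB)+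
  qed
  also have "\<dots> = SB (\<lambda>w v. e k \<cdot> (\<pi> (S w) \<cdot> \<pi> v)) h"
    using h k by (intro SB_cong) (simp_all add: clB B.m_assoc)
  also have "\<dots> = e k \<cdot> e' h"
    unfolding e'_def by (rule SB_mult_left[symmetric]) (assumption | rule h k linB)+
  finally show ?thesis .
qed

text \<open>
  The commutant of the elements \<open>\<epsilon>'\<^sub>h\<close>.  It is where the calculations with the action take place:
  membership in it is all that they use about elements of the base algebra.
\<close>

definition cent where "cent = {a \<in> carrier B. \<forall>h\<in>carrier H. e' h \<cdot> a = a \<cdot> e' h}"

lemma centD: "a \<in> cent \<Longrightarrow> a \<in> carrier B"
  "\<lbrakk>a \<in> cent; h \<in> carrier H\<rbrakk> \<Longrightarrow> e' h \<cdot> a = a \<cdot> e' h"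
  by (auto simp: cent_def)

lemma e_cent: "k \<in> carrier H \<Longrightarrow> e k \<in> cent"
  by (auto simp: cent_def e_closed e'_e_commute)

lemma one_cent: "\<one>\<^bsub>B\<^esub> \<in> cent"
  by (auto simp: cent_def e'_closed)

lemma act_one_eq: "h \<in> carrier H \<Longrightarrow> act h \<one>\<^bsub>B\<^esub> = e h"
  unfolding act_def e_def by (intro SB_cong) (simp_all add: clB)

text \<open>
  \<open>\<pi>(h\<^sub>1) a \<pi>(S h\<^sub>2) \<pi>(h\<^sub>3) = \<pi>(h\<^sub>1) a \<epsilon>'\<^sub>h\<^sub>2 = \<pi>(h\<^sub>1) \<epsilon>'\<^sub>h\<^sub>2 a = \<pi>(h) a\<close>.
\<close>

lemma SB_act_pi:
  assumes a: "a \<in> cent" and h: "h \<in> carrier H"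
  shows "SB (\<lambda>x y. act x a \<cdot> \<pi> y) h = \<pi> h \<cdot> a"
proof -
  note aB = centD(1)[OF a]
  have "SB (\<lambda>x y. act x a \<cdot> \<pi> y) h = SB (\<lambda>x y. SB (\<lambda>u v. \<pi> u \<cdot> a \<cdot> \<pi> (S v) \<cdot> \<pi> y) x) h"
    unfolding act_def by (assumption | rule SB_cong SB_mult_right h aB linB)+
  also have "\<dots> = SB (\<lambda>x z. SB (\<lambda>v y. \<pi> x \<cdot> a \<cdot> \<pi> (S v) \<cdot> \<pi> y) z) h"
    by (rule SB_coassoc) (assumption | rule h aB linB)+
  also have "\<dots> = SB (\<lambda>x z. \<pi> x \<cdot> e' z \<cdot> a) h"
  proof -
    have "SB (\<lambda>v y. \<pi> x \<cdot> a \<cdot> \<pi> (S v) \<cdot> \<pi> y) z = \<pi> x \<cdot> e' z \<cdot> a"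
      if x: "x \<in> carrier H" and z: "z \<in> carrier H" for x z
    proof -
      have "SB (\<lambda>v y. \<pi> x \<cdot> a \<cdot> \<pi> (S v) \<cdot> \<pi> y) z = SB (\<lambda>v y. \<pi> x \<cdot> a \<cdot> (\<pi> (S v) \<cdot> \<pi> y)) z"
        using x z aB by (intro SB_cong) (simp_all add: clB B.m_assoc)
      also have "\<dots> = \<pi> x \<cdot> a \<cdot> e' z"
        unfolding e'_def by (rule SB_mult_left[symmetric]) (assumption | rule x z aB linB)+
      finally show ?thesis using x z aB by (simp add: centD(2)[OF a] B.m_assoc clB)
    qed
    then show ?thesis
      by - (assumption | rule SB_cong h aB linB)+
  qed
  also have "\<dots> = SB (\<lambda>x z. \<pi> x \<cdot> e' z) h \<cdot> a"
    by (rule SB_mult_right[symmetric]) (assumption | rule h aB linB)+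
  finally show ?thesis by (simp add: SB_pi_e' h)
qed

text \<open>
  \<open>(h\<^sub>1 \<rhd> a) \<pi>(h\<^sub>2) b \<pi>(S h\<^sub>3) = \<pi>(h\<^sub>1) a b \<pi>(S h\<^sub>2)\<close> by \<open>SB_act_pi\<close>.
\<close>

lemma act_mult_cent:
  assumes a: "a \<in> cent" and b: "b \<in> carrier B" and h: "h \<in> carrier H"
  shows "act h (a \<cdot> b) = SB (\<lambda>x y. act x a \<cdot> act y b) h"
proof -
  note aB = centD(1)[OF a]
  have "act x a \<cdot> act y b = SB (\<lambda>u v. act x a \<cdot> \<pi> u \<cdot> (b \<cdot> \<pi> (S v))) y"
    if x: "x \<in> carrier H" and y: "y \<in> carrier H" for x y
  proof -
    have "act x a \<cdot> act y b = SB (\<lambda>u v. act x a \<cdot> (\<pi> u \<cdot> b \<cdot> \<pi> (S v))) y"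
      unfolding act_def[of y b] by (rule SB_mult_left) (assumption | rule x y aB b linB)+
    also have "\<dots> = SB (\<lambda>u v. act x a \<cdot> \<pi> u \<cdot> (b \<cdot> \<pi> (S v))) y"
      using x y aB b by (intro SB_cong) (simp_all add: clB B.m_assoc)
    finally show ?thesis .
  qed
  then have "SB (\<lambda>x y. act x a \<cdot> act y b) h =
      SB (\<lambda>x y. SB (\<lambda>u v. act x a \<cdot> \<pi> u \<cdot> (b \<cdot> \<pi> (S v))) y) h"
    by - (assumption | rule SB_cong h aB b linB)+
  also have "\<dots> = SB (\<lambda>w v. SB (\<lambda>x u. act x a \<cdot> \<pi> u \<cdot> (b \<cdot> \<pi> (S v))) w) h"
    by (rule SB_coassoc[symmetric]) (assumption | rule h aB b linB)+
  also have "\<dots> = SB (\<lambda>w v. SB (\<lambda>x u. act x a \<cdot> \<pi> u) w \<cdot> (b \<cdot> \<pi> (S v))) h"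
    by (rule SB_cong, (assumption | rule h aB b linB)+, rule SB_mult_right[symmetric])
      (assumption | rule h aB b linB)+
  also have "\<dots> = SB (\<lambda>w v. \<pi> w \<cdot> (a \<cdot> b) \<cdot> \<pi> (S v)) h"
    using h aB b by (intro SB_cong) (simp_all add: SB_act_pi[OF a] clB B.m_assoc)
  finally show ?thesis by (simp add: act_def)
qed

text \<open>
  \<open>\<pi>(h\<^sub>1) \<epsilon>\<^sub>k \<pi>(S h\<^sub>2) = \<epsilon>\<^bsub>h\<^sub>1k\<^esub> \<pi>(h\<^sub>2) \<pi>(S h\<^sub>3)\<close>.  In particular the action preserves the base algebra.
\<close>

lemma act_e:
  assumes h: "h \<in> carrier H" and k: "k \<in> carrier H"
  shows "act h (e k) = SB (\<lambda>x y. e (x \<otimes> k) \<cdot> e y) h"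
proof -
  have "act h (e k) = SB (\<lambda>x y. SB (\<lambda>u v. e (u \<otimes> k) \<cdot> \<pi> v) x \<cdot> \<pi> (S y)) h"
    unfolding act_def using h k by (intro SB_cong) (simp_all add: pi_e_commute clB)
  also have "\<dots> = SB (\<lambda>x y. SB (\<lambda>u v. e (u \<otimes> k) \<cdot> \<pi> v \<cdot> \<pi> (S y)) x) h"
    by (rule SB_cong, (assumption | rule h k linB)+, rule SB_mult_right)
      (assumption | rule h k linB)+
  also have "\<dots> = SB (\<lambda>u z. SB (\<lambda>v y. e (u \<otimes> k) \<cdot> \<pi> v \<cdot> \<pi> (S y)) z) h"
    by (rule SB_coassoc) (assumption | rule h k linB)+
  also have "\<dots> = SB (\<lambda>u z. e (u \<otimes> k) \<cdot> e z) h"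
  proof -
    have "SB (\<lambda>v y. e (u \<otimes> k) \<cdot> \<pi> v \<cdot> \<pi> (S y)) z = e (u \<otimes> k) \<cdot> e z"
      if u: "u \<in> carrier H" and z: "z \<in> carrier H" for u z
    proof -
      have "SB (\<lambda>v y. e (u \<otimes> k) \<cdot> \<pi> v \<cdot> \<pi> (S y)) z = SB (\<lambda>v y. e (u \<otimes> k) \<cdot> (\<pi> v \<cdot> \<pi> (S y))) z"
        using u z k by (intro SB_cong) (simp_all add: clB B.m_assoc)
      also have "\<dots> = e (u \<otimes> k) \<cdot> e z"
        unfolding e_def[of z] by (rule SB_mult_left[symmetric]) (assumption | rule u k z linB)+
      finally show ?thesis .
    qed
    then show ?thesis
      by - (assumption | rule SB_cong h k linB)+
  qed
  finally show ?thesis .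
qed

text \<open>
  \<open>\<pi>(h\<^sub>1) \<pi>(S h\<^sub>2) \<pi>(h\<^sub>3l) = \<pi>(h\<^sub>1) \<epsilon>'\<^sub>h\<^sub>2 \<pi>(l) = \<pi>(h) \<pi>(l)\<close>.
\<close>

lemma SB_e_pi:
  assumes h: "h \<in> carrier H" and l: "l \<in> carrier H"
  shows "SB (\<lambda>x y. e x \<cdot> \<pi> (y \<otimes> l)) h = \<pi> h \<cdot> \<pi> l"
proof -
  have "SB (\<lambda>x y. e x \<cdot> \<pi> (y \<otimes> l)) h = SB (\<lambda>x y. SB (\<lambda>u v. \<pi> u \<cdot> \<pi> (S v) \<cdot> \<pi> (y \<otimes> l)) x) h"
    unfolding e_def
    by (rule SB_cong, (assumption | rule h l linB)+, rule SB_mult_right)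
      (assumption | rule h l linB)+
  also have "\<dots> = SB (\<lambda>u z. SB (\<lambda>v y. \<pi> u \<cdot> \<pi> (S v) \<cdot> \<pi> (y \<otimes> l)) z) h"
    by (rule SB_coassoc) (assumption | rule h l linB)+
  also have "\<dots> = SB (\<lambda>u z. \<pi> u \<cdot> e' z \<cdot> \<pi> l) h"
  proof -
    have "SB (\<lambda>v y. \<pi> u \<cdot> \<pi> (S v) \<cdot> \<pi> (y \<otimes> l)) z = \<pi> u \<cdot> e' z \<cdot> \<pi> l"
      if u: "u \<in> carrier H" and z: "z \<in> carrier H" for u z
    proof -
      have "SB (\<lambda>v y. \<pi> u \<cdot> \<pi> (S v) \<cdot> \<pi> (y \<otimes> l)) z = SB (\<lambda>v y. \<pi> u \<cdot> (\<pi> (S v) \<cdot> \<pi> (y \<otimes> l))) z"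
        using u z l by (intro SB_cong) (simp_all add: clB B.m_assoc)
      also have "\<dots> = \<pi> u \<cdot> SB (\<lambda>v y. \<pi> (S v) \<cdot> \<pi> (y \<otimes> l)) z"
        by (rule SB_mult_left[symmetric]) (assumption | rule u l z linB)+
      also have "\<dots> = \<pi> u \<cdot> (e' z \<cdot> \<pi> l)" using z l by (simp only: e'_pi)
      finally show ?thesis using u z l by (simp add: B.m_assoc clB)
    qed
    then show ?thesis
      by - (assumption | rule SB_cong h l linB)+
  qed
  also have "\<dots> = SB (\<lambda>u z. \<pi> u \<cdot> e' z) h \<cdot> \<pi> l"
    by (rule SB_mult_right[symmetric]) (assumption | rule h l linB)+
  finally show ?thesis by (simp add: SB_pi_e' h)
qed

lemma SB_act_e:
  assumes a: "a \<in> cent" and h: "h \<in> carrier H"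
  shows "SB (\<lambda>x y. act x a \<cdot> e y) h = act h a"
proof -
  have "SB (\<lambda>x y. act x a \<cdot> e y) h = SB (\<lambda>x y. act x a \<cdot> act y \<one>\<^bsub>B\<^esub>) h"
    using h centD(1)[OF a] by (intro SB_cong) (simp_all add: act_one_eq clB)
  then show ?thesis
    using act_mult_cent[OF a B.one_closed h] centD(1)[OF a] by simp
qed

lemma SB_e_act:
  assumes a: "a \<in> carrier B" and h: "h \<in> carrier H"
  shows "SB (\<lambda>x y. e x \<cdot> act y a) h = act h a"
proof -
  have "SB (\<lambda>x y. e x \<cdot> act y a) h = SB (\<lambda>x y. act x \<one>\<^bsub>B\<^esub> \<cdot> act y a) h"
    using h a by (intro SB_cong) (simp_all add: act_one_eq clB)
  then show ?thesis
    using act_mult_cent[OF one_cent a h] a by simp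
qed

text \<open>
  \<open>\<pi>(h\<^sub>1) a \<pi>(S(h\<^sub>2) m) = (h\<^sub>1 \<rhd> a) \<pi>(h\<^sub>2) \<pi>(S(h\<^sub>3) m) = (h\<^sub>1 \<rhd> a) \<epsilon>\<^sub>h\<^sub>2 \<pi>(m) = (h \<rhd> a) \<pi>(m)\<close>.
\<close>

lemma act_pi:
  assumes a: "a \<in> cent" and h: "h \<in> carrier H" and m: "m \<in> carrier H"
  shows "SB (\<lambda>x y. \<pi> x \<cdot> a \<cdot> \<pi> (S y \<otimes> m)) h = act h a \<cdot> \<pi> m"
proof -
  note aB = centD(1)[OF a]
  have "\<pi> x \<cdot> a \<cdot> \<pi> (S y \<otimes> m) = SB (\<lambda>p q. act p a \<cdot> (\<pi> q \<cdot> \<pi> (S y \<otimes> m))) x"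
    if x: "x \<in> carrier H" and y: "y \<in> carrier H" for x y
  proof -
    have "\<pi> x \<cdot> a \<cdot> \<pi> (S y \<otimes> m) = SB (\<lambda>p q. act p a \<cdot> \<pi> q \<cdot> \<pi> (S y \<otimes> m)) x"
      unfolding SB_act_pi[OF a x, symmetric]
      by (rule SB_mult_right) (assumption | rule x y m aB linB)+
    also have "\<dots> = SB (\<lambda>p q. act p a \<cdot> (\<pi> q \<cdot> \<pi> (S y \<otimes> m))) x"
      using x y m aB by (intro SB_cong) (simp_all add: clB B.m_assoc)
    finally show ?thesis .
  qed
  then have "SB (\<lambda>x y. \<pi> x \<cdot> a \<cdot> \<pi> (S y \<otimes> m)) h =
      SB (\<lambda>x y. SB (\<lambda>p q. act p a \<cdot> (\<pi> q \<cdot> \<pi> (S y \<otimes> m))) x) h"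
    by - (assumption | rule SB_cong h aB m linB)+
  also have "\<dots> = SB (\<lambda>p z. SB (\<lambda>q y. act p a \<cdot> (\<pi> q \<cdot> \<pi> (S y \<otimes> m))) z) h"
    by (rule SB_coassoc) (assumption | rule h m aB linB)+
  also have "\<dots> = SB (\<lambda>p z. act p a \<cdot> SB (\<lambda>q y. \<pi> q \<cdot> \<pi> (S y \<otimes> m)) z) h"
    by (rule SB_cong, (assumption | rule h aB m linB)+, rule SB_mult_left[symmetric])
      (assumption | rule h aB m linB)+
  also have "\<dots> = SB (\<lambda>p z. act p a \<cdot> e z \<cdot> \<pi> m) h"
    using h aB m by (intro SB_cong) (simp_all add: clB e_pi[symmetric] B.m_assoc)
  also have "\<dots> = SB (\<lambda>p z. act p a \<cdot> e z) h \<cdot> \<pi> m"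
    by (rule SB_mult_right[symmetric]) (assumption | rule h m aB linB)+
  finally show ?thesis by (simp add: SB_act_e[OF a h])
qed

lemma act_tensor_mult:
  assumes a: "a \<in> carrier B" and x: "x \<in> carrier H" and l: "l \<in> carrier H"
  shows "act (x \<otimes> l) a = SB (\<lambda>p q. SB (\<lambda>u v. \<pi> (p \<otimes> u) \<cdot> a \<cdot> \<pi> (S v \<otimes> S q)) l) x"
proof -
  have "act (x \<otimes> l) a = SB (\<lambda>p q. SB (\<lambda>u v. \<pi> (p \<otimes> u) \<cdot> a \<cdot> \<pi> (S (q \<otimes> v))) l) x"
    unfolding act_def by (rule SW_mult) (assumption | rule bilinI a x l linB)+
  also have "\<dots> = SB (\<lambda>p q. SB (\<lambda>u v. \<pi> (p \<otimes> u) \<cdot> a \<cdot> \<pi> (S v \<otimes> S q)) l) x"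
    using a x l by (intro SB_cong) (simp_all add: clB S_mult)
  finally show ?thesis .
qed

text \<open>
  \<open>\<epsilon>\<^sub>h\<^sub>1 \<pi>(h\<^sub>2l\<^sub>1) a \<pi>(S(l\<^sub>2) S(h\<^sub>3)) = \<pi>(h\<^sub>1) \<pi>(l\<^sub>1) a \<pi>(S(l\<^sub>2) S(h\<^sub>2))\<close> by \<open>SB_e_pi\<close>, and \<open>act_pi\<close> separates the
  last factor.
\<close>

lemma act_act:
  assumes a: "a \<in> cent" and h: "h \<in> carrier H" and l: "l \<in> carrier H"
  shows "act h (act l a) = SB (\<lambda>x y. act x \<one>\<^bsub>B\<^esub> \<cdot> act (y \<otimes> l) a) h"
proof -
  note aB = centD(1)[OF a]
  let ?F = "\<lambda>x p q u v. e x \<cdot> \<pi> (p \<otimes> u) \<cdot> (a \<cdot> \<pi> (S v \<otimes> S q))"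
  have "act x \<one>\<^bsub>B\<^esub> \<cdot> act (y \<otimes> l) a = SB (\<lambda>p q. SB (\<lambda>u v. ?F x p q u v) l) y"
    if x: "x \<in> carrier H" and y: "y \<in> carrier H" for x y
  proof -
    have "act x \<one>\<^bsub>B\<^esub> \<cdot> act (y \<otimes> l) a =
        e x \<cdot> SB (\<lambda>p q. SB (\<lambda>u v. \<pi> (p \<otimes> u) \<cdot> a \<cdot> \<pi> (S v \<otimes> S q)) l) y"
      using x y l by (simp only: act_one_eq act_tensor_mult[OF aB])
    also have "\<dots> = SB (\<lambda>p q. e x \<cdot> SB (\<lambda>u v. \<pi> (p \<otimes> u) \<cdot> a \<cdot> \<pi> (S v \<otimes> S q)) l) y"
      by (rule SB_mult_left) (assumption | rule x y l aB linB)+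
    also have "\<dots> = SB (\<lambda>p q. SB (\<lambda>u v. e x \<cdot> (\<pi> (p \<otimes> u) \<cdot> a \<cdot> \<pi> (S v \<otimes> S q))) l) y"
      by (rule SB_cong, (assumption | rule x y aB l linB)+, rule SB_mult_left)
        (assumption | rule x y aB l linB)+
    also have "\<dots> = SB (\<lambda>p q. SB (\<lambda>u v. ?F x p q u v) l) y"
      using x y l aB by (intro SB_cong) (simp_all add: clB B.m_assoc)
    finally show ?thesis .
  qed
  then have "SB (\<lambda>x y. act x \<one>\<^bsub>B\<^esub> \<cdot> act (y \<otimes> l) a) h =
      SB (\<lambda>x y. SB (\<lambda>p q. SB (\<lambda>u v. ?F x p q u v) l) y) h"
    by - (assumption | rule SB_cong h aB l linB)+
  also have "\<dots> = SB (\<lambda>w q. SB (\<lambda>x p. SB (\<lambda>u v. ?F x p q u v) l) w) h"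
    by (rule SB_coassoc[symmetric]) (assumption | rule h l aB linB)+
  also have "\<dots> = SB (\<lambda>w q. SB (\<lambda>u v. SB (\<lambda>x p. ?F x p q u v) w) l) h"
    by (rule SB_cong, (assumption | rule h aB l linB)+, rule SW_swap)
      (assumption | rule h aB l linB)+
  also have "\<dots> = SB (\<lambda>w q. \<pi> w \<cdot> act l a \<cdot> \<pi> (S q)) h"
  proof -
    have "SB (\<lambda>u v. SB (\<lambda>x p. ?F x p q u v) w) l = \<pi> w \<cdot> act l a \<cdot> \<pi> (S q)"
      if w: "w \<in> carrier H" and q: "q \<in> carrier H" for w q
    proof -
      have "SB (\<lambda>u v. SB (\<lambda>x p. ?F x p q u v) w) l =
          SB (\<lambda>u v. SB (\<lambda>x p. e x \<cdot> \<pi> (p \<otimes> u)) w \<cdot> (a \<cdot> \<pi> (S v \<otimes> S q))) l"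
        by (rule SB_cong, (assumption | rule w q aB l linB)+, rule SB_mult_right[symmetric])
          (assumption | rule w q aB l linB)+
      also have "\<dots> = SB (\<lambda>u v. \<pi> w \<cdot> (\<pi> u \<cdot> a \<cdot> \<pi> (S v \<otimes> S q))) l"
        using w q l aB by (intro SB_cong) (simp_all add: clB SB_e_pi B.m_assoc)
      also have "\<dots> = \<pi> w \<cdot> SB (\<lambda>u v. \<pi> u \<cdot> a \<cdot> \<pi> (S v \<otimes> S q)) l"
        by (rule SB_mult_left[symmetric]) (assumption | rule w q l aB linB)+
      also have "\<dots> = \<pi> w \<cdot> (act l a \<cdot> \<pi> (S q))"
        using q l by (simp only: act_pi[OF a] S_closed)
      finally show ?thesis using w q l aB by (simp add: clB B.m_assoc)
    qed
    then show ?thesis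
      by - (assumption | rule SB_cong h aB l linB)+
  qed
  finally show ?thesis by (simp add: act_def)
qed

text \<open>
  \<open>(h\<^sub>1 \<rhd> b) \<pi>(h\<^sub>2l) = (h\<^sub>1 \<rhd> b) \<epsilon>\<^sub>h\<^sub>2 \<pi>(h\<^sub>3l) = (h\<^sub>1 \<rhd> b) \<pi>(h\<^sub>2) \<pi>(l) = \<pi>(h) b \<pi>(l)\<close>.
\<close>

lemma SB_act_pi_mult:
  assumes b: "b \<in> cent" and h: "h \<in> carrier H" and l: "l \<in> carrier H"
  shows "SB (\<lambda>x y. act x b \<cdot> \<pi> (y \<otimes> l)) h = \<pi> h \<cdot> b \<cdot> \<pi> l"
proof -
  note bB = centD(1)[OF b]
  have "act x b \<cdot> \<pi> (y \<otimes> l) = SB (\<lambda>p q. act p b \<cdot> (e q \<cdot> \<pi> (y \<otimes> l))) x"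
    if x: "x \<in> carrier H" and y: "y \<in> carrier H" for x y
  proof -
    have "act x b \<cdot> \<pi> (y \<otimes> l) = SB (\<lambda>p q. act p b \<cdot> e q \<cdot> \<pi> (y \<otimes> l)) x"
      unfolding SB_act_e[OF b x, symmetric]
      by (rule SB_mult_right) (assumption | rule x y l bB linB)+
    also have "\<dots> = SB (\<lambda>p q. act p b \<cdot> (e q \<cdot> \<pi> (y \<otimes> l))) x"
      using x y l bB by (intro SB_cong) (simp_all add: clB B.m_assoc)
    finally show ?thesis .
  qed
  then have "SB (\<lambda>x y. act x b \<cdot> \<pi> (y \<otimes> l)) h =
      SB (\<lambda>x y. SB (\<lambda>p q. act p b \<cdot> (e q \<cdot> \<pi> (y \<otimes> l))) x) h"
    by - (assumption | rule SB_cong h bB l linB)+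
  also have "\<dots> = SB (\<lambda>p z. SB (\<lambda>q y. act p b \<cdot> (e q \<cdot> \<pi> (y \<otimes> l))) z) h"
    by (rule SB_coassoc) (assumption | rule h l bB linB)+
  also have "\<dots> = SB (\<lambda>p z. act p b \<cdot> SB (\<lambda>q y. e q \<cdot> \<pi> (y \<otimes> l)) z) h"
    by (rule SB_cong, (assumption | rule h bB l linB)+, rule SB_mult_left[symmetric])
      (assumption | rule h bB l linB)+
  also have "\<dots> = SB (\<lambda>p z. act p b \<cdot> \<pi> z \<cdot> \<pi> l) h"
    using h bB l by (intro SB_cong) (simp_all add: clB SB_e_pi B.m_assoc)
  also have "\<dots> = SB (\<lambda>p z. act p b \<cdot> \<pi> z) h \<cdot> \<pi> l"
    by (rule SB_mult_right[symmetric]) (assumption | rule h l bB linB)+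
  finally show ?thesis by (simp add: SB_act_pi[OF b h])
qed

text \<open>
  \<open>\<pi>(m S(h\<^sub>1)) \<pi>(h\<^sub>2) \<pi>(S h\<^sub>3) = \<pi>(m) \<epsilon>'\<^sub>h\<^sub>1 \<pi>(S h\<^sub>2) = \<pi>(m) \<pi>(S h)\<close>.
\<close>

lemma SB_pi_S_e:
  assumes h: "h \<in> carrier H" and m: "m \<in> carrier H"
  shows "SB (\<lambda>x y. \<pi> (m \<otimes> S x) \<cdot> e y) h = \<pi> m \<cdot> \<pi> (S h)"
proof -
  have "\<pi> (m \<otimes> S x) \<cdot> e y = SB (\<lambda>u v. \<pi> (m \<otimes> S x) \<cdot> \<pi> u \<cdot> \<pi> (S v)) y"
    if x: "x \<in> carrier H" and y: "y \<in> carrier H" for x y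
  proof -
    have "\<pi> (m \<otimes> S x) \<cdot> e y = SB (\<lambda>u v. \<pi> (m \<otimes> S x) \<cdot> (\<pi> u \<cdot> \<pi> (S v))) y"
      unfolding e_def by (rule SB_mult_left) (assumption | rule x y m linB)+
    also have "\<dots> = SB (\<lambda>u v. \<pi> (m \<otimes> S x) \<cdot> \<pi> u \<cdot> \<pi> (S v)) y"
      using x y m by (intro SB_cong) (simp_all add: clB B.m_assoc)
    finally show ?thesis .
  qed
  then have "SB (\<lambda>x y. \<pi> (m \<otimes> S x) \<cdot> e y) h =
      SB (\<lambda>x y. SB (\<lambda>u v. \<pi> (m \<otimes> S x) \<cdot> \<pi> u \<cdot> \<pi> (S v)) y) h"
    by - (assumption | rule SB_cong h m linB)+
  also have "\<dots> = SB (\<lambda>w v. SB (\<lambda>x u. \<pi> (m \<otimes> S x) \<cdot> \<pi> u \<cdot> \<pi> (S v)) w) h"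
    by (rule SB_coassoc[symmetric]) (assumption | rule h m linB)+
  also have "\<dots> = SB (\<lambda>w v. SB (\<lambda>x u. \<pi> (m \<otimes> S x) \<cdot> \<pi> u) w \<cdot> \<pi> (S v)) h"
    by (rule SB_cong, (assumption | rule h m linB)+, rule SB_mult_right[symmetric])
      (assumption | rule h m linB)+
  also have "\<dots> = SB (\<lambda>w v. \<pi> m \<cdot> (e' w \<cdot> \<pi> (S v))) h"
    using h m by (intro SB_cong) (simp_all add: clB pi_e'[symmetric] B.m_assoc)
  also have "\<dots> = \<pi> m \<cdot> SB (\<lambda>w v. e' w \<cdot> \<pi> (S v)) h"
    by (rule SB_mult_left[symmetric]) (assumption | rule h m linB)+
  finally show ?thesis by (simp add: SB_e'_pi_S h)
qed

text \<open>
  \<open>\<pi>(S h\<^sub>1) \<pi>(h\<^sub>2) a \<pi>(S h\<^sub>3) = \<epsilon>'\<^sub>h\<^sub>1 a \<pi>(S h\<^sub>2) = a \<epsilon>'\<^sub>h\<^sub>1 \<pi>(S h\<^sub>2) = a \<pi>(S h)\<close>.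
\<close>

lemma SB_pi_S_act:
  assumes a: "a \<in> cent" and h: "h \<in> carrier H"
  shows "SB (\<lambda>x y. \<pi> (S x) \<cdot> act y a) h = a \<cdot> \<pi> (S h)"
proof -
  note aB = centD(1)[OF a]
  have "\<pi> (S x) \<cdot> act y a = SB (\<lambda>u v. \<pi> (S x) \<cdot> \<pi> u \<cdot> (a \<cdot> \<pi> (S v))) y"
    if x: "x \<in> carrier H" and y: "y \<in> carrier H" for x y
  proof -
    have "\<pi> (S x) \<cdot> act y a = SB (\<lambda>u v. \<pi> (S x) \<cdot> (\<pi> u \<cdot> a \<cdot> \<pi> (S v))) y"
      unfolding act_def by (rule SB_mult_left) (assumption | rule x y aB linB)+
    also have "\<dots> = SB (\<lambda>u v. \<pi> (S x) \<cdot> \<pi> u \<cdot> (a \<cdot> \<pi> (S v))) y"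
      using x y aB by (intro SB_cong) (simp_all add: clB B.m_assoc)
    finally show ?thesis .
  qed
  then have "SB (\<lambda>x y. \<pi> (S x) \<cdot> act y a) h =
      SB (\<lambda>x y. SB (\<lambda>u v. \<pi> (S x) \<cdot> \<pi> u \<cdot> (a \<cdot> \<pi> (S v))) y) h"
    by - (assumption | rule SB_cong h aB linB)+
  also have "\<dots> = SB (\<lambda>w v. SB (\<lambda>x u. \<pi> (S x) \<cdot> \<pi> u \<cdot> (a \<cdot> \<pi> (S v))) w) h"
    by (rule SB_coassoc[symmetric]) (assumption | rule h aB linB)+
  also have "\<dots> = SB (\<lambda>w v. e' w \<cdot> (a \<cdot> \<pi> (S v))) h"
    unfolding e'_def
    by (rule SB_cong, (assumption | rule h aB linB)+, rule SB_mult_right[symmetric])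
      (assumption | rule h aB linB)+
  also have "\<dots> = SB (\<lambda>w v. a \<cdot> (e' w \<cdot> \<pi> (S v))) h"
    using h aB by (intro SB_cong) (simp_all add: clB B.m_assoc[symmetric] centD(2)[OF a])
  also have "\<dots> = a \<cdot> SB (\<lambda>w v. e' w \<cdot> \<pi> (S v)) h"
    by (rule SB_mult_left[symmetric]) (assumption | rule h aB linB)+
  finally show ?thesis by (simp add: SB_e'_pi_S h)
qed

text \<open>
  The mirror image of \<open>act_pi\<close>, with \<open>a \<pi>(S l) = \<pi>(S l\<^sub>1) (l\<^sub>2 \<rhd> a)\<close> as the rule for commuting.
\<close>

lemma pi_act:
  assumes a: "a \<in> cent" and l: "l \<in> carrier H" and m: "m \<in> carrier H"
  shows "SB (\<lambda>x y. \<pi> (m \<otimes> x) \<cdot> a \<cdot> \<pi> (S y)) l = \<pi> m \<cdot> act l a"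
proof -
  note aB = centD(1)[OF a]
  have "\<pi> (m \<otimes> x) \<cdot> a \<cdot> \<pi> (S y) = SB (\<lambda>u v. \<pi> (m \<otimes> x) \<cdot> \<pi> (S u) \<cdot> act v a) y"
    if x: "x \<in> carrier H" and y: "y \<in> carrier H" for x y
  proof -
    have "\<pi> (m \<otimes> x) \<cdot> a \<cdot> \<pi> (S y) = \<pi> (m \<otimes> x) \<cdot> SB (\<lambda>u v. \<pi> (S u) \<cdot> act v a) y"
      using x y m aB by (simp add: SB_pi_S_act[OF a] B.m_assoc clB)
    also have "\<dots> = SB (\<lambda>u v. \<pi> (m \<otimes> x) \<cdot> (\<pi> (S u) \<cdot> act v a)) y"
      by (rule SB_mult_left) (assumption | rule x y m aB linB)+
    also have "\<dots> = SB (\<lambda>u v. \<pi> (m \<otimes> x) \<cdot> \<pi> (S u) \<cdot> act v a) y"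
      using x y m aB by (intro SB_cong) (simp_all add: clB B.m_assoc)
    finally show ?thesis .
  qed
  then have "SB (\<lambda>x y. \<pi> (m \<otimes> x) \<cdot> a \<cdot> \<pi> (S y)) l =
      SB (\<lambda>x y. SB (\<lambda>u v. \<pi> (m \<otimes> x) \<cdot> \<pi> (S u) \<cdot> act v a) y) l"
    by - (assumption | rule SB_cong l aB m linB)+
  also have "\<dots> = SB (\<lambda>w v. SB (\<lambda>x u. \<pi> (m \<otimes> x) \<cdot> \<pi> (S u) \<cdot> act v a) w) l"
    by (rule SB_coassoc[symmetric]) (assumption | rule l m aB linB)+
  also have "\<dots> = SB (\<lambda>w v. SB (\<lambda>x u. \<pi> (m \<otimes> x) \<cdot> \<pi> (S u)) w \<cdot> act v a) l"
    by (rule SB_cong, (assumption | rule l m aB linB)+, rule SB_mult_right[symmetric])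
      (assumption | rule l m aB linB)+
  also have "\<dots> = SB (\<lambda>w v. \<pi> m \<cdot> (e w \<cdot> act v a)) l"
    using l m aB by (intro SB_cong) (simp_all add: clB pi_e[symmetric] B.m_assoc)
  also have "\<dots> = \<pi> m \<cdot> SB (\<lambda>w v. e w \<cdot> act v a) l"
    by (rule SB_mult_left[symmetric]) (assumption | rule l m aB linB)+
  finally show ?thesis by (simp add: SB_e_act[OF aB l])
qed

text \<open>
  \<open>\<pi>(h\<^sub>1l\<^sub>1) a \<pi>(S(l\<^sub>2) S(h\<^sub>2)) \<epsilon>\<^sub>h\<^sub>3 = \<pi>(h\<^sub>1l\<^sub>1) a \<pi>(S l\<^sub>2) \<pi>(S h\<^sub>2)\<close> by \<open>SB_pi_S_e\<close>, and \<open>pi_act\<close> separates the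
  first factor.
\<close>

lemma act_act_symmetric:
  assumes a: "a \<in> cent" and h: "h \<in> carrier H" and l: "l \<in> carrier H"
  shows "act h (act l a) = SB (\<lambda>x y. act (x \<otimes> l) a \<cdot> act y \<one>\<^bsub>B\<^esub>) h"
proof -
  note aB = centD(1)[OF a]
  let ?F = "\<lambda>p q u v y. \<pi> (p \<otimes> u) \<cdot> a \<cdot> (\<pi> (S v \<otimes> S q) \<cdot> e y)"
  have "act (x \<otimes> l) a \<cdot> act y \<one>\<^bsub>B\<^esub> = SB (\<lambda>p q. SB (\<lambda>u v. ?F p q u v y) l) x"
    if x: "x \<in> carrier H" and y: "y \<in> carrier H" for x y
  proof -
    have "act (x \<otimes> l) a \<cdot> act y \<one>\<^bsub>B\<^esub> =
        SB (\<lambda>p q. SB (\<lambda>u v. \<pi> (p \<otimes> u) \<cdot> a \<cdot> \<pi> (S v \<otimes> S q)) l) x \<cdot> e y"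
      using x y l by (simp only: act_one_eq act_tensor_mult[OF aB])
    also have "\<dots> = SB (\<lambda>p q. SB (\<lambda>u v. \<pi> (p \<otimes> u) \<cdot> a \<cdot> \<pi> (S v \<otimes> S q)) l \<cdot> e y) x"
      by (rule SB_mult_right) (assumption | rule x y l aB linB)+
    also have "\<dots> = SB (\<lambda>p q. SB (\<lambda>u v. \<pi> (p \<otimes> u) \<cdot> a \<cdot> \<pi> (S v \<otimes> S q) \<cdot> e y) l) x"
      by (rule SB_cong, (assumption | rule x y aB l linB)+, rule SB_mult_right)
        (assumption | rule x y aB l linB)+
    also have "\<dots> = SB (\<lambda>p q. SB (\<lambda>u v. ?F p q u v y) l) x"
      using x y l aB by (intro SB_cong) (simp_all add: clB B.m_assoc)
    finally show ?thesis .
  qed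
  then have "SB (\<lambda>x y. act (x \<otimes> l) a \<cdot> act y \<one>\<^bsub>B\<^esub>) h =
      SB (\<lambda>x y. SB (\<lambda>p q. SB (\<lambda>u v. ?F p q u v y) l) x) h"
    by - (assumption | rule SB_cong h aB l linB)+
  also have "\<dots> = SB (\<lambda>p z. SB (\<lambda>q y. SB (\<lambda>u v. ?F p q u v y) l) z) h"
    by (rule SB_coassoc) (assumption | rule h l aB linB)+
  also have "\<dots> = SB (\<lambda>p z. SB (\<lambda>u v. SB (\<lambda>q y. ?F p q u v y) z) l) h"
    by (rule SB_cong, (assumption | rule h aB l linB)+, rule SW_swap)
      (assumption | rule h aB l linB)+
  also have "\<dots> = SB (\<lambda>p z. \<pi> p \<cdot> act l a \<cdot> \<pi> (S z)) h"
  proof -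
    have "SB (\<lambda>u v. SB (\<lambda>q y. ?F p q u v y) z) l = \<pi> p \<cdot> act l a \<cdot> \<pi> (S z)"
      if p: "p \<in> carrier H" and z: "z \<in> carrier H" for p z
    proof -
      have "SB (\<lambda>u v. SB (\<lambda>q y. ?F p q u v y) z) l =
          SB (\<lambda>u v. \<pi> (p \<otimes> u) \<cdot> a \<cdot> SB (\<lambda>q y. \<pi> (S v \<otimes> S q) \<cdot> e y) z) l"
        by (rule SB_cong, (assumption | rule p z aB l linB)+, rule SB_mult_left[symmetric])
          (assumption | rule p z aB l linB)+
      also have "\<dots> = SB (\<lambda>u v. \<pi> (p \<otimes> u) \<cdot> a \<cdot> \<pi> (S v) \<cdot> \<pi> (S z)) l"
        using p z l aB by (intro SB_cong) (simp_all add: clB SB_pi_S_e B.m_assoc)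
      also have "\<dots> = SB (\<lambda>u v. \<pi> (p \<otimes> u) \<cdot> a \<cdot> \<pi> (S v)) l \<cdot> \<pi> (S z)"
        by (rule SB_mult_right[symmetric]) (assumption | rule p z l aB linB)+
      finally show ?thesis using p l by (simp only: pi_act[OF a])
    qed
    then show ?thesis
      by - (assumption | rule SB_cong h aB l linB)+
  qed
  finally show ?thesis by (simp add: act_def)
qed

end

section \<open>Endomorphism algebras and tensor products of partial representations\<close>

text \<open>
  Endomorphisms are functions that are undefined outside the carrier, so that two of them are
  equal if they agree on it.
\<close>

definition end_alg :: "'k ring \<Rightarrow> ('k, 'm, 'w) module_scheme \<Rightarrow> ('k, 'm \<Rightarrow> 'm) module" where
  "end_alg R M = \<lparr>carrier = mod_hom R M M \<inter> extensional (carrier M),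
     mult = compose (carrier M), one = (\<lambda>x\<in>carrier M. x),
     zero = (\<lambda>x\<in>carrier M. \<zero>\<^bsub>M\<^esub>), add = (\<lambda>f g. \<lambda>x\<in>carrier M. f x \<oplus>\<^bsub>M\<^esub> g x),
     smult = (\<lambda>c f. \<lambda>x\<in>carrier M. c \<odot>\<^bsub>M\<^esub> f x)\<rparr>"

lemma end_alg_simps:
  "carrier (end_alg R M) = mod_hom R M M \<inter> extensional (carrier M)"
  "mult (end_alg R M) = compose (carrier M)"
  "one (end_alg R M) = (\<lambda>x\<in>carrier M. x)"
  "zero (end_alg R M) = (\<lambda>x\<in>carrier M. \<zero>\<^bsub>M\<^esub>)"
  "add (end_alg R M) = (\<lambda>f g. \<lambda>x\<in>carrier M. f x \<oplus>\<^bsub>M\<^esub> g x)"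
  "smult (end_alg R M) = (\<lambda>c f. \<lambda>x\<in>carrier M. c \<odot>\<^bsub>M\<^esub> f x)"
  by (simp_all add: end_alg_def)

context
  fixes R :: "'k ring" and M :: "('k, 'm, 'w) module_scheme"
  assumes M: "module R M"
begin

interpretation M: module R M by (rule M)

lemma end_alg_carrierI: "f \<in> mod_hom R M M \<Longrightarrow> (\<lambda>x\<in>carrier M. f x) \<in> carrier (end_alg R M)"
  unfolding end_alg_simps by (rule IntI, erule mod_hom_cong[OF M]) simp_all

lemma end_alg_closed: "\<lbrakk>f \<in> carrier (end_alg R M); x \<in> carrier M\<rbrakk> \<Longrightarrow> f x \<in> carrier M"
  by (auto simp: end_alg_simps intro: mod_hom_closed)

lemma end_alg_hom: "f \<in> carrier (end_alg R M) \<Longrightarrow> f \<in> mod_hom R M M"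
  by (simp add: end_alg_simps)

lemma end_alg_eqI:
  "\<lbrakk>f \<in> carrier (end_alg R M); g \<in> carrier (end_alg R M);
    \<And>x. x \<in> carrier M \<Longrightarrow> f x = g x\<rbrakk> \<Longrightarrow> f = g"
  by (auto simp: end_alg_simps intro: extensionalityI)

lemma end_alg_apply:
  "x \<in> carrier M \<Longrightarrow> (f \<otimes>\<^bsub>end_alg R M\<^esub> g) x = f (g x)"
  "x \<in> carrier M \<Longrightarrow> \<one>\<^bsub>end_alg R M\<^esub> x = x"
  "x \<in> carrier M \<Longrightarrow> \<zero>\<^bsub>end_alg R M\<^esub> x = \<zero>\<^bsub>M\<^esub>"
  "x \<in> carrier M \<Longrightarrow> (f \<oplus>\<^bsub>end_alg R M\<^esub> g) x = f x \<oplus>\<^bsub>M\<^esub> g x"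
  "x \<in> carrier M \<Longrightarrow> (c \<odot>\<^bsub>end_alg R M\<^esub> f) x = c \<odot>\<^bsub>M\<^esub> f x"
  by (simp_all add: end_alg_simps compose_def)

lemma end_alg_ops:
  "\<lbrakk>f \<in> carrier (end_alg R M); g \<in> carrier (end_alg R M)\<rbrakk>
    \<Longrightarrow> f \<otimes>\<^bsub>end_alg R M\<^esub> g \<in> carrier (end_alg R M)"
  "\<one>\<^bsub>end_alg R M\<^esub> \<in> carrier (end_alg R M)"
  "\<zero>\<^bsub>end_alg R M\<^esub> \<in> carrier (end_alg R M)"
  "\<lbrakk>f \<in> carrier (end_alg R M); g \<in> carrier (end_alg R M)\<rbrakk>
    \<Longrightarrow> f \<oplus>\<^bsub>end_alg R M\<^esub> g \<in> carrier (end_alg R M)"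
  "\<lbrakk>c \<in> carrier R; f \<in> carrier (end_alg R M)\<rbrakk> \<Longrightarrow> c \<odot>\<^bsub>end_alg R M\<^esub> f \<in> carrier (end_alg R M)"
proof -
  assume f: "f \<in> carrier (end_alg R M)"
  note fh = end_alg_hom[OF f]
  {
    assume g: "g \<in> carrier (end_alg R M)"
    note gh = end_alg_hom[OF g]
    show "f \<otimes>\<^bsub>end_alg R M\<^esub> g \<in> carrier (end_alg R M)"
      unfolding end_alg_simps(2) compose_def by (rule end_alg_carrierI[OF mod_hom_compose[OF gh fh]])
    have "(\<lambda>x. f x \<oplus>\<^bsub>M\<^esub> g x) \<in> mod_hom R M M"
      by (intro mod_homI) (auto simp: mod_hom_closed[OF fh] mod_hom_closed[OF gh]
          mod_hom_add[OF fh] mod_hom_add[OF gh] mod_hom_smult[OF fh] mod_hom_smult[OF gh]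
          M.smult_r_distr M.M.add.m_ac)
    then show "f \<oplus>\<^bsub>end_alg R M\<^esub> g \<in> carrier (end_alg R M)"
      unfolding end_alg_simps(5) by (rule end_alg_carrierI)
  }
  assume c: "c \<in> carrier R"
  show "c \<odot>\<^bsub>end_alg R M\<^esub> f \<in> carrier (end_alg R M)"
    unfolding end_alg_simps(6) by (rule end_alg_carrierI[OF mod_hom_fun_smult[OF M fh c]])
next
  show "\<one>\<^bsub>end_alg R M\<^esub> \<in> carrier (end_alg R M)"
    unfolding end_alg_simps(3) by (rule end_alg_carrierI[OF mod_hom_id])
  have "(\<lambda>x. \<zero>\<^bsub>M\<^esub>) \<in> mod_hom R M M" by (auto intro!: mod_homI)
  then show "\<zero>\<^bsub>end_alg R M\<^esub> \<in> carrier (end_alg R M)"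
    unfolding end_alg_simps(4) by (rule end_alg_carrierI)
qed

lemma end_alg_module: "module R (end_alg R M)"
proof (rule moduleI)
  show "abelian_group (end_alg R M)"
  proof (rule abelian_groupI)
    fix f assume f: "f \<in> carrier (end_alg R M)"
    have c: "(\<ominus>\<^bsub>R\<^esub> \<one>\<^bsub>R\<^esub>) \<odot>\<^bsub>end_alg R M\<^esub> f \<in> carrier (end_alg R M)"
      using f by (intro end_alg_ops) auto
    have "(\<ominus>\<^bsub>R\<^esub> \<one>\<^bsub>R\<^esub>) \<odot>\<^bsub>end_alg R M\<^esub> f \<oplus>\<^bsub>end_alg R M\<^esub> f = \<zero>\<^bsub>end_alg R M\<^esub>"
      using f by (intro end_alg_eqI end_alg_ops c)
        (auto simp: end_alg_apply M.smult_l_minus end_alg_closed M.M.l_neg)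
    then show "\<exists>g\<in>carrier (end_alg R M). g \<oplus>\<^bsub>end_alg R M\<^esub> f = \<zero>\<^bsub>end_alg R M\<^esub>"
      using c by blast
  qed (auto intro!: end_alg_ops end_alg_eqI simp: end_alg_apply end_alg_closed M.M.add.m_ac)
qed (auto intro!: M.R.is_cring end_alg_ops end_alg_eqI
      simp: end_alg_apply end_alg_closed M.smult_l_distr M.smult_r_distr M.smult_assoc1)

lemma end_alg_algebra: "assoc_algebra R (end_alg R M)"
  by (rule assoc_algebraI[OF end_alg_module])
    (auto intro!: end_alg_ops end_alg_eqI mod_homI
      simp: end_alg_apply end_alg_closed mod_hom_add[OF end_alg_hom] mod_hom_smult[OF end_alg_hom])

lemma end_alg_eval: "x \<in> carrier M \<Longrightarrow> (\<lambda>f. f x) \<in> mod_hom R (end_alg R M) M"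
  by (rule mod_homI) (auto simp: end_alg_apply end_alg_closed)

lemma end_alg_mod_homI:
  assumes "\<And>u. u \<in> carrier L \<Longrightarrow> F u \<in> mod_hom R M M"
    and "\<And>x. x \<in> carrier M \<Longrightarrow> (\<lambda>u. F u x) \<in> mod_hom R L M"
    and L: "module R L"
  shows "(\<lambda>u. \<lambda>x\<in>carrier M. F u x) \<in> mod_hom R L (end_alg R M)"
proof -
  interpret L: module R L by fact
  let ?F = "\<lambda>u. \<lambda>x\<in>carrier M. F u x"
  have F: "?F u \<in> carrier (end_alg R M)" if "u \<in> carrier L" for u
    by (rule end_alg_carrierI[OF assms(1)[OF that]])
  show ?thesis
  proof (rule mod_homI)
    fix u v assume "u \<in> carrier L" "v \<in> carrier L"
    then show "?F (u \<oplus>\<^bsub>L\<^esub> v) = ?F u \<oplus>\<^bsub>end_alg R M\<^esub> ?F v"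
      by (intro end_alg_eqI end_alg_ops F)
        (simp_all add: end_alg_apply mod_hom_add[OF assms(2)])
  next
    fix c u assume "c \<in> carrier R" "u \<in> carrier L"
    then show "?F (c \<odot>\<^bsub>L\<^esub> u) = c \<odot>\<^bsub>end_alg R M\<^esub> ?F u"
      by (intro end_alg_eqI end_alg_ops F)
        (simp_all add: end_alg_apply mod_hom_smult[OF assms(2)])
  qed (rule F)
qed

end

text \<open>
  The map \<open>T\<close> plays the role of \<open>B \<otimes> H \<rightarrow> D\<close>, an algebra map.  Composed with
  \<open>h \<mapsto> \<rho>(h\<^sub>1) \<otimes> h\<^sub>2\<close>, the tensor product of \<open>\<rho>\<close> and the identity of \<open>H\<close>, it is again a partial
  representation: since the second factor is multiplicative, only the identities of \<open>\<rho>\<close> are left to use.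
\<close>

locale partial_rep_tensor = partial_rep R H B \<rho> + D: assoc_algebra R D
  for R :: "'k ring" and H :: "('k, 'h) hopf" (structure)
    and B :: "('k, 'b) module" and \<rho> :: "'h \<Rightarrow> 'b" and D :: "('k, 'd) module" +
  fixes T :: "'b \<Rightarrow> 'h \<Rightarrow> 'd"
  assumes T_bilin: "bilin R B H D T"
    and T_mult: "\<lbrakk>f \<in> carrier B; g \<in> carrier B; h \<in> carrier H; l \<in> carrier H\<rbrakk>
      \<Longrightarrow> T f h \<otimes>\<^bsub>D\<^esub> T g l = T (f \<otimes>\<^bsub>B\<^esub> g) (h \<otimes> l)"
    and T_one: "T \<one>\<^bsub>B\<^esub> \<one> = \<one>\<^bsub>D\<^esub>"
begin

abbreviation SD where "SD \<equiv> sweedler D R H"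
abbreviation Dmult (infixl \<open>\<star>\<close> 70) where "x \<star> y \<equiv> x \<otimes>\<^bsub>D\<^esub> y"

definition L where "L h = SD (\<lambda>p q. T (\<rho> p) q) h"

lemma module_D: "module R D" by (rule D.module_axioms)
lemma algebra_D: "assoc_algebra R D" by (rule D.assoc_algebra_axioms)

lemmas linT = linB module_D lin_mult_left[OF algebra_D] lin_mult_right[OF algebra_D]
  bilin_compose_left[OF T_bilin] bilin_compose_right[OF T_bilin] bilin_closed[OF T_bilin]
  bilin_right[OF T_bilin] D.m_closed

lemma L_lin: "f \<in> mod_hom R M H \<Longrightarrow> (\<lambda>x. L (f x)) \<in> mod_hom R M D"
  unfolding L_def by (assumption | rule linT)+

lemma L_hom: "L \<in> mod_hom R H D"
  using L_lin[OF mod_hom_id] .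

lemma L_closed: "h \<in> carrier H \<Longrightarrow> L h \<in> carrier D"
  by (rule mod_hom_closed[OF L_hom])

lemmas linD = L_lin L_hom L_closed linT
lemmas SD_cong = SW_cong[OF module_D]
lemmas SD_coassoc = SW_coassoc[OF module_D]
lemmas clD = clB bilin_closed[OF T_bilin] L_closed SW_closed[OF module_D]

lemmas SD_mult_left = SW_times_left[OF algebra_D]
lemmas SD_mult_right = SW_times_right[OF algebra_D]

lemma T_SB:
  assumes "h \<in> carrier H" "q \<in> carrier H"
    and "\<And>x y. \<lbrakk>x \<in> carrier H; y \<in> carrier H\<rbrakk> \<Longrightarrow> f x y \<in> carrier B"
  shows "SD (\<lambda>x y. T (f x y) q) h = T (SB f h) q"
  by (rule SW_image[where g = "\<lambda>t. T t q", symmetric])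
    (assumption | rule linD assms bilin_left[OF T_bilin])+

lemma L_S: "x \<in> carrier H \<Longrightarrow> L (S x) = SD (\<lambda>p q. T (\<rho> (S q)) (S p)) x"
  unfolding L_def by (rule SW_S) (assumption | rule bilinI linD)+

lemma L_mult: "\<lbrakk>x \<in> carrier H; y \<in> carrier H\<rbrakk> \<Longrightarrow>
    L (x \<otimes> y) = SD (\<lambda>p q. SD (\<lambda>u v. T (\<rho> (p \<otimes> u)) (q \<otimes> v)) y) x"
  unfolding L_def by (rule SW_mult) (assumption | rule bilinI linD)+

lemma SD_mult_SD:
  assumes h: "h \<in> carrier H" and l: "l \<in> carrier H"
    and f: "\<And>x y. \<lbrakk>x \<in> carrier H; y \<in> carrier H\<rbrakk> \<Longrightarrow> f x y \<in> carrier B"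
    and f': "\<And>x y. \<lbrakk>x \<in> carrier H; y \<in> carrier H\<rbrakk> \<Longrightarrow> f' x y \<in> carrier H"
    and g: "\<And>x y. \<lbrakk>x \<in> carrier H; y \<in> carrier H\<rbrakk> \<Longrightarrow> g x y \<in> carrier B"
    and g': "\<And>x y. \<lbrakk>x \<in> carrier H; y \<in> carrier H\<rbrakk> \<Longrightarrow> g' x y \<in> carrier H"
  shows "SD (\<lambda>p q. T (f p q) (f' p q)) h \<star> SD (\<lambda>u v. T (g u v) (g' u v)) l =
    SD (\<lambda>p q. SD (\<lambda>u v. T (f p q \<cdot> g u v) (f' p q \<otimes> g' u v)) l) h"
proof -
  note c = f f' g g' h l
  have "SD (\<lambda>p q. T (f p q) (f' p q)) h \<star> SD (\<lambda>u v. T (g u v) (g' u v)) l =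
      SD (\<lambda>p q. T (f p q) (f' p q) \<star> SD (\<lambda>u v. T (g u v) (g' u v)) l) h"
    by (rule SD_mult_right) (assumption | rule linD c)+
  also have "\<dots> = SD (\<lambda>p q. SD (\<lambda>u v. T (f p q) (f' p q) \<star> T (g u v) (g' u v)) l) h"
    by (rule SD_cong, (assumption | rule linD c)+, rule SD_mult_left) (assumption | rule linD c)+
  also have "\<dots> = SD (\<lambda>p q. SD (\<lambda>u v. T (f p q \<cdot> g u v) (f' p q \<otimes> g' u v)) l) h"
    by (intro SD_cong) (simp_all add: T_mult c clD)
  finally show ?thesis .
qed

text \<open>
  \<open>F(l\<^sub>1, l\<^sub>4) \<otimes> G(l\<^sub>2 S(l\<^sub>3)) = F(l\<^sub>1, l\<^sub>2) \<otimes> G(1)\<close>.  This is the shape of the identities with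
  \<open>\<epsilon>\<^sub>l\<close>: the two middle components of \<open>l\<close> are those of the second tensor factor.
\<close>

lemma SD_collapse:
  assumes F: "bilin R H H B F" and G: "G \<in> mod_hom R H H" and l: "l \<in> carrier H"
  shows "SD (\<lambda>x z. SD (\<lambda>u v. SD (\<lambda>p q. T (F u q) (G (v \<otimes> S p))) z) x) l =
    SD (\<lambda>w r. T (F w r) (G \<one>)) l"
proof -
  have GG: "(\<lambda>x. G (f x)) \<in> mod_hom R M H" if "f \<in> mod_hom R M H" for f and M :: "('k, 'h, 'y) module_scheme"
    by (rule mod_hom_compose[OF that G])
  note c = l bilin_compose_left[OF F] bilin_compose_right[OF F] bilin_closed[OF F]
    bilin_right[OF F] bilin_left[OF F] GG mod_hom_closed[OF G] linD
  have "SD (\<lambda>x z. SD (\<lambda>u v. SD (\<lambda>p q. T (F u q) (G (v \<otimes> S p))) z) x) l =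
      SD (\<lambda>x z. SD (\<lambda>p q. SD (\<lambda>u v. T (F u q) (G (v \<otimes> S p))) x) z) l"
    by (rule SD_cong, (assumption | rule c)+, rule SW_swap) (assumption | rule c)+
  also have "\<dots> = SD (\<lambda>w q. SD (\<lambda>x p. SD (\<lambda>u v. T (F u q) (G (v \<otimes> S p))) x) w) l"
    by (rule SD_coassoc[symmetric]) (assumption | rule c)+
  also have "\<dots> = SD (\<lambda>w q. T (F w q) (G \<one>)) l"
  proof -
    have "SD (\<lambda>x p. SD (\<lambda>u v. T (F u q) (G (v \<otimes> S p))) x) w = T (F w q) (G \<one>)"
      if w: "w \<in> carrier H" and q: "q \<in> carrier H" for w q
    proof -
      have "SD (\<lambda>x p. SD (\<lambda>u v. T (F u q) (G (v \<otimes> S p))) x) w =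
          SD (\<lambda>u y. SD (\<lambda>v p. T (F u q) (G (v \<otimes> S p))) y) w"
        by (rule SD_coassoc) (assumption | rule w q c)+
      also have "\<dots> = T (F w q) (G \<one>)"
        by (rule SW_cancel_right(2)[where G = "\<lambda>u t. T (F u q) (G t)"])
          (assumption | rule bilinI w q c)+
      finally show ?thesis .
    qed
    then show ?thesis
      by - (assumption | rule SD_cong c)+
  qed
  finally show ?thesis .
qed

text \<open>
  In \<open>F(l\<^sub>2, l\<^sub>3) \<otimes> G(l\<^sub>1, l\<^sub>4)\<close>, only the Sweedler sum of \<open>F\<close> over the middle components matters.
  This is the shape of the identities with \<open>\<epsilon>'\<^sub>l\<close>, whose first tensor factor is in the middle.
\<close>

lemma SD_nest:
  assumes F: "bilin R H H B F" and F': "bilin R H H B F'" and G: "bilin R H H H G"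
    and eq: "\<And>m. m \<in> carrier H \<Longrightarrow> SB F m = SB F' m" and l: "l \<in> carrier H"
  shows "SD (\<lambda>x z. SD (\<lambda>c d. SD (\<lambda>u v. T (F d u) (G c v)) z) x) l =
    SD (\<lambda>x z. SD (\<lambda>c d. SD (\<lambda>u v. T (F' d u) (G c v)) z) x) l"
proof -
  have *: "SD (\<lambda>x z. SD (\<lambda>c d. SD (\<lambda>u v. T (F d u) (G c v)) z) x) l =
      SD (\<lambda>c w. SD (\<lambda>m v. T (SB F m) (G c v)) w) l"
    if F: "bilin R H H B F" for F
  proof -
    note c = l bilin_compose_left[OF F] bilin_compose_right[OF F] bilin_closed[OF F]
      bilin_right[OF F] bilin_left[OF F] bilin_compose_left[OF G] bilin_compose_right[OF G]
      bilin_closed[OF G] bilin_right[OF G] bilin_left[OF G] linD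
    have "SD (\<lambda>x z. SD (\<lambda>c d. SD (\<lambda>u v. T (F d u) (G c v)) z) x) l =
        SD (\<lambda>c w. SD (\<lambda>d z. SD (\<lambda>u v. T (F d u) (G c v)) z) w) l"
      by (rule SD_coassoc) (assumption | rule c)+
    also have "\<dots> = SD (\<lambda>c w. SD (\<lambda>m v. SD (\<lambda>d u. T (F d u) (G c v)) m) w) l"
      by (rule SD_cong, (assumption | rule c)+, rule SD_coassoc[symmetric]) (assumption | rule c)+
    also have "\<dots> = SD (\<lambda>c w. SD (\<lambda>m v. T (SB F m) (G c v)) w) l"
      by (rule SD_cong, (assumption | rule c)+, rule SD_cong, (assumption | rule c)+, rule T_SB)
        (assumption | rule c)+
    finally show ?thesis .
  qed
  have cl: "bilin R H H B F \<Longrightarrow> m \<in> carrier H \<Longrightarrow> SB F m \<in> carrier B" for F m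
    by (rule SW_closed[OF module_B]) (auto intro: bilin_closed)
  show ?thesis
    unfolding *[OF F] *[OF F'] using l
    by (intro SD_cong) (auto simp: eq intro!: clD cl F F' bilin_closed[OF G])
qed

text \<open>
  The element \<open>\<epsilon>\<^sub>l\<close> of the new partial representation is \<open>\<epsilon>\<^sub>l \<otimes> 1\<close>.
\<close>

lemma SD_L_L_S:
  assumes l: "l \<in> carrier H"
  shows "SD (\<lambda>x z. L x \<star> L (S z)) l = SD (\<lambda>w r. T (\<rho> w \<cdot> \<rho> (S r)) \<one>) l"
proof -
  have "SD (\<lambda>x z. L x \<star> L (S z)) l =
      SD (\<lambda>x z. SD (\<lambda>u v. SD (\<lambda>p q. T (\<rho> u \<cdot> \<rho> (S q)) (v \<otimes> S p)) z) x) l"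
  proof (rule SD_cong[OF l])
    fix x z assume "x \<in> carrier H" "z \<in> carrier H"
    then show "L x \<star> L (S z) = SD (\<lambda>u v. SD (\<lambda>p q. T (\<rho> u \<cdot> \<rho> (S q)) (v \<otimes> S p)) z) x"
      by (simp only: L_S, unfold L_def) (rule SD_mult_SD; auto intro: clD)
  qed (assumption | rule l linD)+
  also have "\<dots> = SD (\<lambda>w r. T (\<rho> w \<cdot> \<rho> (S r)) \<one>) l"
    by (rule SD_collapse[where F = "\<lambda>u q. \<rho> u \<cdot> \<rho> (S q)" and G = "\<lambda>t. t"])
      (assumption | rule bilinI l linD)+
  finally show ?thesis .
qed

lemma L_mult_eps:
  assumes h: "h \<in> carrier H" and l: "l \<in> carrier H"
  shows "SD (\<lambda>x z. L h \<star> L x \<star> L (S z)) l = SD (\<lambda>x z. L (h \<otimes> x) \<star> L (S z)) l"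
proof -
  have "SD (\<lambda>x z. L h \<star> L x \<star> L (S z)) l = SD (\<lambda>x z. L h \<star> (L x \<star> L (S z))) l"
    using h l by (intro SD_cong) (simp_all add: D.m_assoc clD)
  also have "\<dots> = L h \<star> SD (\<lambda>x z. L x \<star> L (S z)) l"
    by (rule SD_mult_left[symmetric]) (assumption | rule h l linD)+
  also have "\<dots> = SD (\<lambda>p q. SD (\<lambda>w r. T (\<rho> p \<cdot> (\<rho> w \<cdot> \<rho> (S r))) (q \<otimes> \<one>)) l) h"
    unfolding SD_L_L_S[OF l] unfolding L_def by (rule SD_mult_SD) (assumption | rule h l linD)+
  also have "\<dots> = SD (\<lambda>p q. SD (\<lambda>w r. T (\<rho> p \<cdot> \<rho> w \<cdot> \<rho> (S r)) q) l) h"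
    using h l by (intro SD_cong) (simp_all add: B.m_assoc clD)
  also have "\<dots> = SD (\<lambda>p q. SD (\<lambda>w r. T (\<rho> (p \<otimes> w) \<cdot> \<rho> (S r)) q) l) h"
  proof -
    have "SD (\<lambda>w r. T (\<rho> p \<cdot> \<rho> w \<cdot> \<rho> (S r)) q) l = SD (\<lambda>w r. T (\<rho> (p \<otimes> w) \<cdot> \<rho> (S r)) q) l"
      if "p \<in> carrier H" "q \<in> carrier H" for p q
      using that l by (simp add: T_SB clD mult_eps)
    then show ?thesis
      by - (assumption | rule SD_cong h l linD)+
  qed
  also have "\<dots> = SD (\<lambda>x z. L (h \<otimes> x) \<star> L (S z)) l"
  proof -
    have 1: "L (h \<otimes> x) \<star> L (S z) =
        SD (\<lambda>p q. SD (\<lambda>u v. SD (\<lambda>c d. T (\<rho> (p \<otimes> u) \<cdot> \<rho> (S d)) (q \<otimes> (v \<otimes> S c))) z) x) h"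
      if x: "x \<in> carrier H" and z: "z \<in> carrier H" for x z
    proof -
      have "L (h \<otimes> x) \<star> L (S z) = SD (\<lambda>p q. SD (\<lambda>u v. T (\<rho> (p \<otimes> u)) (q \<otimes> v)) x \<star> L (S z)) h"
        unfolding L_mult[OF h x]
        by (rule SD_mult_right) (assumption | rule h x z linD)+
      also have "\<dots> = SD (\<lambda>p q. SD (\<lambda>u v. SD (\<lambda>c d. T (\<rho> (p \<otimes> u) \<cdot> \<rho> (S d)) (q \<otimes> v \<otimes> S c)) z) x) h"
        unfolding L_S[OF z]
        by (rule SD_cong, (assumption | rule h x z linD)+, rule SD_mult_SD)
          (assumption | rule h x z linD)+
      also have "\<dots> = SD (\<lambda>p q. SD (\<lambda>u v. SD (\<lambda>c d. T (\<rho> (p \<otimes> u) \<cdot> \<rho> (S d)) (q \<otimes> (v \<otimes> S c))) z) x) h"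
        using h x z by (intro SD_cong) (simp_all add: m_assoc clD)
      finally show ?thesis .
    qed
    then have "SD (\<lambda>x z. L (h \<otimes> x) \<star> L (S z)) l = SD (\<lambda>x z.
        SD (\<lambda>p q. SD (\<lambda>u v. SD (\<lambda>c d. T (\<rho> (p \<otimes> u) \<cdot> \<rho> (S d)) (q \<otimes> (v \<otimes> S c))) z) x) h) l"
      by - (assumption | rule SD_cong h l linD)+
    also have "\<dots> = SD (\<lambda>p q. SD (\<lambda>x z.
        SD (\<lambda>u v. SD (\<lambda>c d. T (\<rho> (p \<otimes> u) \<cdot> \<rho> (S d)) (q \<otimes> (v \<otimes> S c))) z) x) l) h"
      by (rule SW_swap) (assumption | rule h l linD)+
    also have "\<dots> = SD (\<lambda>p q. SD (\<lambda>w r. T (\<rho> (p \<otimes> w) \<cdot> \<rho> (S r)) q) l) h"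
    proof -
      have "SD (\<lambda>x z. SD (\<lambda>u v. SD (\<lambda>c d. T (\<rho> (p \<otimes> u) \<cdot> \<rho> (S d)) (q \<otimes> (v \<otimes> S c))) z) x) l =
          SD (\<lambda>w r. T (\<rho> (p \<otimes> w) \<cdot> \<rho> (S r)) (q \<otimes> \<one>)) l"
        if "p \<in> carrier H" "q \<in> carrier H" for p q
        by (rule SD_collapse[where F = "\<lambda>u d. \<rho> (p \<otimes> u) \<cdot> \<rho> (S d)" and G = "\<lambda>t. q \<otimes> t"])
          (assumption | rule bilinI that l linD)+
      then have "SD (\<lambda>x z. SD (\<lambda>u v. SD (\<lambda>c d. T (\<rho> (p \<otimes> u) \<cdot> \<rho> (S d)) (q \<otimes> (v \<otimes> S c))) z) x) l =
          SD (\<lambda>w r. T (\<rho> (p \<otimes> w) \<cdot> \<rho> (S r)) q) l"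
        if "p \<in> carrier H" "q \<in> carrier H" for p q
        using that by simp
      then show ?thesis
        by - (assumption | rule SD_cong h l linD)+
    qed
    finally show ?thesis by simp
  qed
  finally show ?thesis .
qed

lemma L_eps_mult:
  assumes l: "l \<in> carrier H" and m: "m \<in> carrier H"
  shows "SD (\<lambda>x z. L x \<star> L (S z) \<star> L m) l = SD (\<lambda>x z. L x \<star> L (S z \<otimes> m)) l"
proof -
  have "SD (\<lambda>x z. L x \<star> L (S z) \<star> L m) l = SD (\<lambda>x z. L x \<star> L (S z)) l \<star> L m"
    by (rule SD_mult_right[symmetric]) (assumption | rule l m linD)+
  also have "\<dots> = SD (\<lambda>w r. SD (\<lambda>p q. T (\<rho> w \<cdot> \<rho> (S r) \<cdot> \<rho> p) (\<one> \<otimes> q)) m) l"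
    unfolding SD_L_L_S[OF l] unfolding L_def by (rule SD_mult_SD) (assumption | rule l m linD)+
  also have "\<dots> = SD (\<lambda>p q. SD (\<lambda>w r. T (\<rho> w \<cdot> \<rho> (S r) \<cdot> \<rho> p) (\<one> \<otimes> q)) l) m"
    by (rule SW_swap) (assumption | rule l m linD)+
  also have "\<dots> = SD (\<lambda>p q. SD (\<lambda>w r. T (\<rho> w \<cdot> \<rho> (S r \<otimes> p)) (\<one> \<otimes> q)) l) m"
  proof -
    have "SD (\<lambda>w r. T (\<rho> w \<cdot> \<rho> (S r) \<cdot> \<rho> p) (\<one> \<otimes> q)) l = SD (\<lambda>w r. T (\<rho> w \<cdot> \<rho> (S r \<otimes> p)) (\<one> \<otimes> q)) l"
      if "p \<in> carrier H" "q \<in> carrier H" for p q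
      using that l by (simp add: T_SB clD eps_mult)
    then show ?thesis
      by - (assumption | rule SD_cong m l linD)+
  qed
  also have "\<dots> = SD (\<lambda>x z. L x \<star> L (S z \<otimes> m)) l"
  proof -
    have 1: "L x \<star> L (S z \<otimes> m) =
        SD (\<lambda>p q. SD (\<lambda>u v. SD (\<lambda>c d. T (\<rho> u \<cdot> \<rho> (S d \<otimes> p)) ((v \<otimes> S c) \<otimes> q)) z) x) m"
      if x: "x \<in> carrier H" and z: "z \<in> carrier H" for x z
    proof -
      have "L (S z \<otimes> m) = SD (\<lambda>c d. SD (\<lambda>p q. T (\<rho> (c \<otimes> p)) (d \<otimes> q)) m) (S z)"
        using z m by (simp only: L_mult S_closed)
      also have "\<dots> = SD (\<lambda>c d. SD (\<lambda>p q. T (\<rho> (S d \<otimes> p)) (S c \<otimes> q)) m) z"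
        by (rule SW_S) (assumption | rule bilinI z m linD)+
      also have "\<dots> = SD (\<lambda>p q. SD (\<lambda>c d. T (\<rho> (S d \<otimes> p)) (S c \<otimes> q)) z) m"
        by (rule SW_swap) (assumption | rule z m linD)+
      finally have "L x \<star> L (S z \<otimes> m) = SD (\<lambda>p q. L x \<star> SD (\<lambda>c d. T (\<rho> (S d \<otimes> p)) (S c \<otimes> q)) z) m"
        by (simp only:) (rule SD_mult_left, (assumption | rule x z m linD)+)
      also have "\<dots> = SD (\<lambda>p q. SD (\<lambda>u v. SD (\<lambda>c d. T (\<rho> u \<cdot> \<rho> (S d \<otimes> p)) (v \<otimes> (S c \<otimes> q))) z) x) m"
        by (rule SD_cong, (assumption | rule m x z linD)+, unfold L_def, rule SD_mult_SD)
          (assumption | rule m x z linD)+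
      also have "\<dots> = SD (\<lambda>p q. SD (\<lambda>u v. SD (\<lambda>c d. T (\<rho> u \<cdot> \<rho> (S d \<otimes> p)) ((v \<otimes> S c) \<otimes> q)) z) x) m"
        using m x z by (intro SD_cong) (simp_all add: m_assoc clD)
      finally show ?thesis .
    qed
    then have "SD (\<lambda>x z. L x \<star> L (S z \<otimes> m)) l = SD (\<lambda>x z.
        SD (\<lambda>p q. SD (\<lambda>u v. SD (\<lambda>c d. T (\<rho> u \<cdot> \<rho> (S d \<otimes> p)) ((v \<otimes> S c) \<otimes> q)) z) x) m) l"
      by - (assumption | rule SD_cong m l linD)+
    also have "\<dots> = SD (\<lambda>p q. SD (\<lambda>x z.
        SD (\<lambda>u v. SD (\<lambda>c d. T (\<rho> u \<cdot> \<rho> (S d \<otimes> p)) ((v \<otimes> S c) \<otimes> q)) z) x) l) m"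
      by (rule SW_swap) (assumption | rule m l linD)+
    also have "\<dots> = SD (\<lambda>p q. SD (\<lambda>w r. T (\<rho> w \<cdot> \<rho> (S r \<otimes> p)) (\<one> \<otimes> q)) l) m"
    proof -
      have "SD (\<lambda>x z. SD (\<lambda>u v. SD (\<lambda>c d. T (\<rho> u \<cdot> \<rho> (S d \<otimes> p)) ((v \<otimes> S c) \<otimes> q)) z) x) l =
          SD (\<lambda>w r. T (\<rho> w \<cdot> \<rho> (S r \<otimes> p)) (\<one> \<otimes> q)) l"
        if "p \<in> carrier H" "q \<in> carrier H" for p q
        by (rule SD_collapse[where F = "\<lambda>u d. \<rho> u \<cdot> \<rho> (S d \<otimes> p)" and G = "\<lambda>t. t \<otimes> q"])
          (assumption | rule bilinI that l linD)+
      then show ?thesis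
        by - (assumption | rule SD_cong m l linD)+
    qed
    finally show ?thesis by simp
  qed
  finally show ?thesis .
qed

lemma L_mult_eps':
  assumes h: "h \<in> carrier H" and l: "l \<in> carrier H"
  shows "SD (\<lambda>x z. L h \<star> L (S x) \<star> L z) l = SD (\<lambda>x z. L (h \<otimes> S x) \<star> L z) l"
proof -
  let ?E = "\<lambda>f. SD (\<lambda>p q. SD (\<lambda>x z. SD (\<lambda>c d. SD (\<lambda>u v. T (f p d u) (q \<otimes> (S c \<otimes> v))) z) x) l) h"
  have 1: "L h \<star> L (S x) \<star> L z =
      SD (\<lambda>p q. SD (\<lambda>c d. SD (\<lambda>u v. T (\<rho> p \<cdot> \<rho> (S d) \<cdot> \<rho> u) (q \<otimes> (S c \<otimes> v))) z) x) h"
    if x: "x \<in> carrier H" and z: "z \<in> carrier H" for x z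
  proof -
    have "L h \<star> L (S x) = SD (\<lambda>p q. SD (\<lambda>c d. T (\<rho> p \<cdot> \<rho> (S d)) (q \<otimes> S c)) x) h"
      unfolding L_S[OF x] unfolding L_def by (rule SD_mult_SD) (assumption | rule h x linD)+
    then have "L h \<star> L (S x) \<star> L z = SD (\<lambda>p q. SD (\<lambda>c d. T (\<rho> p \<cdot> \<rho> (S d)) (q \<otimes> S c)) x \<star> L z) h"
      by (simp only:) (rule SD_mult_right, (assumption | rule h x z linD)+)
    also have "\<dots> = SD (\<lambda>p q. SD (\<lambda>c d. SD (\<lambda>u v. T (\<rho> p \<cdot> \<rho> (S d) \<cdot> \<rho> u) (q \<otimes> S c \<otimes> v)) z) x) h"
      by (rule SD_cong, (assumption | rule h x z linD)+, unfold L_def, rule SD_mult_SD)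
        (assumption | rule h x z linD)+
    also have "\<dots> = SD (\<lambda>p q. SD (\<lambda>c d. SD (\<lambda>u v. T (\<rho> p \<cdot> \<rho> (S d) \<cdot> \<rho> u) (q \<otimes> (S c \<otimes> v))) z) x) h"
      using h x z by (intro SD_cong) (simp_all add: m_assoc clD)
    finally show ?thesis .
  qed
  have 2: "L (h \<otimes> S x) \<star> L z =
      SD (\<lambda>p q. SD (\<lambda>c d. SD (\<lambda>u v. T (\<rho> (p \<otimes> S d) \<cdot> \<rho> u) (q \<otimes> (S c \<otimes> v))) z) x) h"
    if x: "x \<in> carrier H" and z: "z \<in> carrier H" for x z
  proof -
    have "L (h \<otimes> S x) = SD (\<lambda>p q. SD (\<lambda>d c. T (\<rho> (p \<otimes> d)) (q \<otimes> c)) (S x)) h"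
      using h x by (simp only: L_mult S_closed)
    also have "\<dots> = SD (\<lambda>p q. SD (\<lambda>c d. T (\<rho> (p \<otimes> S d)) (q \<otimes> S c)) x) h"
      by (rule SD_cong, (assumption | rule h x linD)+, rule SW_S)
        (assumption | rule bilinI h x linD)+
    finally have "L (h \<otimes> S x) \<star> L z = SD (\<lambda>p q. SD (\<lambda>c d. T (\<rho> (p \<otimes> S d)) (q \<otimes> S c)) x \<star> L z) h"
      by (simp only:) (rule SD_mult_right, (assumption | rule h x z linD)+)
    also have "\<dots> = SD (\<lambda>p q. SD (\<lambda>c d. SD (\<lambda>u v. T (\<rho> (p \<otimes> S d) \<cdot> \<rho> u) (q \<otimes> S c \<otimes> v)) z) x) h"
      by (rule SD_cong, (assumption | rule h x z linD)+, unfold L_def, rule SD_mult_SD)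
        (assumption | rule h x z linD)+
    also have "\<dots> = SD (\<lambda>p q. SD (\<lambda>c d. SD (\<lambda>u v. T (\<rho> (p \<otimes> S d) \<cdot> \<rho> u) (q \<otimes> (S c \<otimes> v))) z) x) h"
      using h x z by (intro SD_cong) (simp_all add: m_assoc clD)
    finally show ?thesis .
  qed
  have "SD (\<lambda>x z. L h \<star> L (S x) \<star> L z) l = SD (\<lambda>x z. SD (\<lambda>p q. SD (\<lambda>c d.
      SD (\<lambda>u v. T (\<rho> p \<cdot> \<rho> (S d) \<cdot> \<rho> u) (q \<otimes> (S c \<otimes> v))) z) x) h) l"
    using 1 by - (assumption | rule SD_cong h l linD)+
  also have "\<dots> = ?E (\<lambda>p d u. \<rho> p \<cdot> \<rho> (S d) \<cdot> \<rho> u)"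
    by (rule SW_swap) (assumption | rule h l linD)+
  also have "\<dots> = ?E (\<lambda>p d u. \<rho> (p \<otimes> S d) \<cdot> \<rho> u)"
    by (rule SD_cong, (assumption | rule h l linD)+, rule SD_nest)
      (assumption | rule mult_eps' bilinI h l linD)+
  also have "\<dots> = SD (\<lambda>x z. SD (\<lambda>p q. SD (\<lambda>c d.
      SD (\<lambda>u v. T (\<rho> (p \<otimes> S d) \<cdot> \<rho> u) (q \<otimes> (S c \<otimes> v))) z) x) h) l"
    by (rule SW_swap[symmetric]) (assumption | rule h l linD)+
  also have "\<dots> = SD (\<lambda>x z. L (h \<otimes> S x) \<star> L z) l"
    using 2[symmetric] by - (assumption | rule SD_cong h l linD)+
  finally show ?thesis .
qed

lemma L_eps'_mult:
  assumes l: "l \<in> carrier H" and m: "m \<in> carrier H"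
  shows "SD (\<lambda>x z. L (S x) \<star> L z \<star> L m) l = SD (\<lambda>x z. L (S x) \<star> L (z \<otimes> m)) l"
proof -
  let ?E = "\<lambda>f. SD (\<lambda>p q. SD (\<lambda>x z. SD (\<lambda>c d. SD (\<lambda>u v. T (f p d u) (S c \<otimes> (v \<otimes> q))) z) x) l) m"
  have 1: "L (S x) \<star> L z \<star> L m =
      SD (\<lambda>p q. SD (\<lambda>c d. SD (\<lambda>u v. T (\<rho> (S d) \<cdot> \<rho> u \<cdot> \<rho> p) (S c \<otimes> (v \<otimes> q))) z) x) m"
    if x: "x \<in> carrier H" and z: "z \<in> carrier H" for x z
  proof -
    have a: "T f g \<star> L m = SD (\<lambda>p q. T (f \<cdot> \<rho> p) (g \<otimes> q)) m"
      if f: "f \<in> carrier B" and g: "g \<in> carrier H" for f g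
    proof -
      have "T f g \<star> L m = SD (\<lambda>p q. T f g \<star> T (\<rho> p) q) m"
        unfolding L_def by (rule SD_mult_left) (assumption | rule f g m linD)+
      then show ?thesis using f g m by (subst (asm) SD_cong) (auto simp: T_mult clD)
    qed
    have a': "T f (g \<otimes> v) \<star> L m = SD (\<lambda>p q. T (f \<cdot> \<rho> p) (g \<otimes> (v \<otimes> q))) m"
      if "f \<in> carrier B" "g \<in> carrier H" "v \<in> carrier H" for f g v
      using that m a[of f "g \<otimes> v"] by (simp add: m_closed) (rule SD_cong; simp add: m_assoc clD)
    have "L (S x) \<star> L z = SD (\<lambda>c d. SD (\<lambda>u v. T (\<rho> (S d) \<cdot> \<rho> u) (S c \<otimes> v)) z) x"
      unfolding L_S[OF x] unfolding L_def by (rule SD_mult_SD) (assumption | rule x z linD)+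
    then have "L (S x) \<star> L z \<star> L m = SD (\<lambda>c d. SD (\<lambda>u v. T (\<rho> (S d) \<cdot> \<rho> u) (S c \<otimes> v)) z \<star> L m) x"
      by (simp only:) (rule SD_mult_right, (assumption | rule m x z linD)+)
    also have "\<dots> = SD (\<lambda>c d. SD (\<lambda>u v. T (\<rho> (S d) \<cdot> \<rho> u) (S c \<otimes> v) \<star> L m) z) x"
      by (rule SD_cong, (assumption | rule m x z linD)+, rule SD_mult_right)
        (assumption | rule m x z linD)+
    also have "\<dots> = SD (\<lambda>c d. SD (\<lambda>u v. SD (\<lambda>p q. T (\<rho> (S d) \<cdot> \<rho> u \<cdot> \<rho> p) (S c \<otimes> (v \<otimes> q))) m) z) x"
      using m x z by (intro SD_cong) (simp_all add: a' clD)
    also have "\<dots> = SD (\<lambda>c d. SD (\<lambda>p q. SD (\<lambda>u v. T (\<rho> (S d) \<cdot> \<rho> u \<cdot> \<rho> p) (S c \<otimes> (v \<otimes> q))) z) m) x"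
      by (rule SD_cong, (assumption | rule m x z linD)+, rule SW_swap)
        (assumption | rule m x z linD)+
    also have "\<dots> = SD (\<lambda>p q. SD (\<lambda>c d. SD (\<lambda>u v. T (\<rho> (S d) \<cdot> \<rho> u \<cdot> \<rho> p) (S c \<otimes> (v \<otimes> q))) z) x) m"
      by (rule SW_swap) (assumption | rule m x z linD)+
    finally show ?thesis .
  qed
  have 2: "L (S x) \<star> L (z \<otimes> m) =
      SD (\<lambda>p q. SD (\<lambda>c d. SD (\<lambda>u v. T (\<rho> (S d) \<cdot> \<rho> (u \<otimes> p)) (S c \<otimes> (v \<otimes> q))) z) x) m"
    if x: "x \<in> carrier H" and z: "z \<in> carrier H" for x z
  proof -
    have "L (z \<otimes> m) = SD (\<lambda>u v. SD (\<lambda>p q. T (\<rho> (u \<otimes> p)) (v \<otimes> q)) m) z"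
      using m z by (simp only: L_mult)
    also have "\<dots> = SD (\<lambda>p q. SD (\<lambda>u v. T (\<rho> (u \<otimes> p)) (v \<otimes> q)) z) m"
      by (rule SW_swap) (assumption | rule z m linD)+
    finally have "L (S x) \<star> L (z \<otimes> m) = SD (\<lambda>p q. L (S x) \<star> SD (\<lambda>u v. T (\<rho> (u \<otimes> p)) (v \<otimes> q)) z) m"
      by (simp only:) (rule SD_mult_left, (assumption | rule m x z linD)+)
    also have "\<dots> = SD (\<lambda>p q. SD (\<lambda>c d. SD (\<lambda>u v. T (\<rho> (S d) \<cdot> \<rho> (u \<otimes> p)) (S c \<otimes> (v \<otimes> q))) z) x) m"
      unfolding L_S[OF x]
      by (rule SD_cong, (assumption | rule m x z linD)+, rule SD_mult_SD)
        (assumption | rule m x z linD)+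
    finally show ?thesis .
  qed
  have "SD (\<lambda>x z. L (S x) \<star> L z \<star> L m) l = SD (\<lambda>x z. SD (\<lambda>p q. SD (\<lambda>c d.
      SD (\<lambda>u v. T (\<rho> (S d) \<cdot> \<rho> u \<cdot> \<rho> p) (S c \<otimes> (v \<otimes> q))) z) x) m) l"
    using 1 by - (assumption | rule SD_cong m l linD)+
  also have "\<dots> = ?E (\<lambda>p d u. \<rho> (S d) \<cdot> \<rho> u \<cdot> \<rho> p)"
    by (rule SW_swap) (assumption | rule m l linD)+
  also have "\<dots> = ?E (\<lambda>p d u. \<rho> (S d) \<cdot> \<rho> (u \<otimes> p))"
    by (rule SD_cong, (assumption | rule m l linD)+, rule SD_nest)
      (assumption | rule eps'_mult bilinI m l linD)+
  also have "\<dots> = SD (\<lambda>x z. SD (\<lambda>p q. SD (\<lambda>c d.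
      SD (\<lambda>u v. T (\<rho> (S d) \<cdot> \<rho> (u \<otimes> p)) (S c \<otimes> (v \<otimes> q))) z) x) m) l"
    by (rule SW_swap[symmetric]) (assumption | rule m l linD)+
  also have "\<dots> = SD (\<lambda>x z. L (S x) \<star> L (z \<otimes> m)) l"
    using 2[symmetric] by - (assumption | rule SD_cong m l linD)+
  finally show ?thesis .
qed

lemma L_one: "L \<one> = \<one>\<^bsub>D\<^esub>"
proof -
  have "L \<one> = T (\<rho> \<one>) \<one>"
    unfolding L_def by (rule SW_one) (assumption | rule bilinI linD)+
  then show ?thesis by (simp add: pi_one T_one)
qed

theorem tensor_partial_rep: "partial_rep R H D L"
  by unfold_locales (rule L_hom L_one L_mult_eps L_eps_mult L_mult_eps' L_eps'_mult | assumption)+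

end

section \<open>Symmetric partial actions\<close>

context partial_action
begin

abbreviation hact :: "'h \<Rightarrow> 'a \<Rightarrow> 'a" (infixr \<open>\<rhd>\<close> 65) where "h \<rhd> a \<equiv> act_on R H A \<alpha> h a"
abbreviation S where "S \<equiv> antipode H"
abbreviation SA where "SA \<equiv> sweedler A R H"
abbreviation Amult (infixl \<open>\<cdot>\<close> 60) where "x \<cdot> y \<equiv> x \<otimes>\<^bsub>A\<^esub> y"
abbreviation Hmult (infixl \<open>\<bullet>\<close> 70) where "x \<bullet> y \<equiv> x \<otimes>\<^bsub>H\<^esub> y"

lemma module_A: "module R A" by (rule A.module_axioms)
lemma algebra_A: "assoc_algebra R A" by (rule A.assoc_algebra_axioms)

lemma hact_bilin: "bilin R H A A (\<rhd>)"
  unfolding act_on_def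
  by (intro bilinI mod_hom_compose[OF bilin_right[OF tens_bilin[OF H.module_H module_A]] act_hom]
      mod_hom_compose[OF bilin_left[OF tens_bilin[OF H.module_H module_A]] act_hom])

lemma hact_closed: "\<lbrakk>h \<in> carrier H; a \<in> carrier A\<rbrakk> \<Longrightarrow> h \<rhd> a \<in> carrier A"
  by (rule bilin_closed[OF hact_bilin])

lemmas linA = H.lin module_A lin_mult_left[OF algebra_A] lin_mult_right[OF algebra_A]
  bilin_compose_left[OF hact_bilin] bilin_compose_right[OF hact_bilin] bilin_right[OF hact_bilin]
  bilin_left[OF hact_bilin]
  hact_closed A.m_closed A.one_closed
lemmas clA = hact_closed H.S_closed H.SW_closed[OF module_A]
lemmas SA_cong = H.SW_cong[OF module_A]
lemmas SA_coassoc = H.SW_coassoc[OF module_A]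

lemmas SA_mult_left = H.SW_times_left[OF algebra_A]
lemmas SA_mult_right = H.SW_times_right[OF algebra_A]

lemma hact_SA:
  assumes "h \<in> carrier H" "l \<in> carrier H"
    and "\<And>x y. \<lbrakk>x \<in> carrier H; y \<in> carrier H\<rbrakk> \<Longrightarrow> f x y \<in> carrier A"
  shows "l \<rhd> SA f h = SA (\<lambda>x y. l \<rhd> f x y) h"
  by (rule H.SW_image) (assumption | rule linA assms)+

lemma SA_one_hact:
  assumes "h \<in> carrier H" "a \<in> carrier A"
  shows "SA (\<lambda>x y. (x \<rhd> \<one>\<^bsub>A\<^esub>) \<cdot> (y \<rhd> a)) h = h \<rhd> a"
  using act_mult[OF assms(1) A.one_closed assms(2)] assms by simp

lemma SA_hact_one:
  assumes "h \<in> carrier H" "a \<in> carrier A"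
  shows "SA (\<lambda>x y. (x \<rhd> a) \<cdot> (y \<rhd> \<one>\<^bsub>A\<^esub>)) h = h \<rhd> a"
  using act_mult[OF assms A.one_closed] assms by simp

text \<open>
  \<open>l\<^sub>1 \<rhd> (S(l\<^sub>2) \<rhd> a) = (l\<^sub>1 \<rhd> 1)(l\<^sub>2 S(l\<^sub>3) \<rhd> a)\<close>.
\<close>

lemma SA_hact_S_hact:
  assumes l: "l \<in> carrier H" and a: "a \<in> carrier A"
  shows "SA (\<lambda>x y. x \<rhd> S y \<rhd> a) l = (l \<rhd> \<one>\<^bsub>A\<^esub>) \<cdot> a"
proof -
  have "SA (\<lambda>x y. x \<rhd> S y \<rhd> a) l = SA (\<lambda>x y. SA (\<lambda>p q. (p \<rhd> \<one>\<^bsub>A\<^esub>) \<cdot> (q \<bullet> S y \<rhd> a)) x) l"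
    by (assumption | rule SA_cong act_act l a linA)+
  also have "\<dots> = SA (\<lambda>p z. SA (\<lambda>q y. (p \<rhd> \<one>\<^bsub>A\<^esub>) \<cdot> (q \<bullet> S y \<rhd> a)) z) l"
    by (rule SA_coassoc) (assumption | rule l a linA)+
  also have "\<dots> = (l \<rhd> \<one>\<^bsub>A\<^esub>) \<cdot> (\<one>\<^bsub>H\<^esub> \<rhd> a)"
    by (rule H.SW_cancel_right(2)[where G = "\<lambda>p t. (p \<rhd> \<one>\<^bsub>A\<^esub>) \<cdot> (t \<rhd> a)"])
      (assumption | rule bilinI l a linA)+
  finally show ?thesis by (simp add: act_one a)
qed

end

locale symmetric_partial_action = partial_action +
  assumes act_sym: "\<lbrakk>h \<in> carrier H; l \<in> carrier H; a \<in> carrier A\<rbrakk> \<Longrightarrow>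
      h \<rhd> l \<rhd> a = SA (\<lambda>x y. (x \<bullet> l \<rhd> a) \<cdot> (y \<rhd> \<one>\<^bsub>A\<^esub>)) h"
begin

text \<open>
  \<open>S(l\<^sub>1) \<rhd> (l\<^sub>2 \<rhd> a) = (S(l\<^sub>2) l\<^sub>3 \<rhd> a)(S(l\<^sub>1) \<rhd> 1)\<close>; here the symmetric law is essential, because \<open>S\<close>
  reverses the comultiplication.
\<close>

lemma SA_S_hact_hact:
  assumes l: "l \<in> carrier H" and a: "a \<in> carrier A"
  shows "SA (\<lambda>x y. S x \<rhd> y \<rhd> a) l = a \<cdot> (S l \<rhd> \<one>\<^bsub>A\<^esub>)"
proof -
  have "S x \<rhd> y \<rhd> a = SA (\<lambda>p q. (S q \<bullet> y \<rhd> a) \<cdot> (S p \<rhd> \<one>\<^bsub>A\<^esub>)) x"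
    if x: "x \<in> carrier H" and y: "y \<in> carrier H" for x y
  proof -
    have "S x \<rhd> y \<rhd> a = SA (\<lambda>p q. (p \<bullet> y \<rhd> a) \<cdot> (q \<rhd> \<one>\<^bsub>A\<^esub>)) (S x)"
      using x y a by (intro act_sym H.S_closed)
    also have "\<dots> = SA (\<lambda>p q. (S q \<bullet> y \<rhd> a) \<cdot> (S p \<rhd> \<one>\<^bsub>A\<^esub>)) x"
      by (rule H.SW_S) (assumption | rule bilinI x y a linA)+
    finally show ?thesis .
  qed
  then have "SA (\<lambda>x y. S x \<rhd> y \<rhd> a) l =
      SA (\<lambda>x y. SA (\<lambda>p q. (S q \<bullet> y \<rhd> a) \<cdot> (S p \<rhd> \<one>\<^bsub>A\<^esub>)) x) l"
    by - (assumption | rule SA_cong l a linA)+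
  also have "\<dots> = SA (\<lambda>p z. SA (\<lambda>q y. (S q \<bullet> y \<rhd> a) \<cdot> (S p \<rhd> \<one>\<^bsub>A\<^esub>)) z) l"
    by (rule SA_coassoc) (assumption | rule l a linA)+
  also have "\<dots> = (\<one>\<^bsub>H\<^esub> \<rhd> a) \<cdot> (S l \<rhd> \<one>\<^bsub>A\<^esub>)"
    by (rule H.SW_cancel_right(1)[where G = "\<lambda>p t. (t \<rhd> a) \<cdot> (S p \<rhd> \<one>\<^bsub>A\<^esub>)"])
      (assumption | rule bilinI l a linA)+
  finally show ?thesis by (simp add: act_one a)
qed

text \<open>
  Both sides are \<open>(h\<^sub>1l \<rhd> 1)(h\<^sub>2 \<rhd> a)\<close>.  For the left one, use
  \<open>h \<rhd> ((l \<rhd> 1) a) = (h\<^sub>1 \<rhd> (l \<rhd> 1))(h\<^sub>2 \<rhd> a) = (h\<^sub>1l \<rhd> 1)(h\<^sub>2 \<rhd> 1)(h\<^sub>3 \<rhd> a)\<close>.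
\<close>

lemma hact_mult_eps:
  assumes h: "h \<in> carrier H" and l: "l \<in> carrier H" and a: "a \<in> carrier A"
  shows "SA (\<lambda>x y. h \<rhd> x \<rhd> S y \<rhd> a) l = SA (\<lambda>x y. h \<bullet> x \<rhd> S y \<rhd> a) l"
proof -
  let ?u = "\<one>\<^bsub>A\<^esub>"
  have "SA (\<lambda>x y. h \<rhd> x \<rhd> S y \<rhd> a) l = h \<rhd> SA (\<lambda>x y. x \<rhd> S y \<rhd> a) l"
    by (rule hact_SA[symmetric]) (assumption | rule h l a linA)+
  also have "\<dots> = SA (\<lambda>x y. (x \<rhd> l \<rhd> ?u) \<cdot> (y \<rhd> a)) h"
    unfolding SA_hact_S_hact[OF l a] using h l a by (intro act_mult hact_closed) auto
  also have "\<dots> = SA (\<lambda>x y. SA (\<lambda>p q. (p \<bullet> l \<rhd> ?u) \<cdot> (q \<rhd> ?u)) x \<cdot> (y \<rhd> a)) h"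
    using h l a by (intro SA_cong) (simp_all add: act_sym clA)
  also have "\<dots> = SA (\<lambda>x y. SA (\<lambda>p q. (p \<bullet> l \<rhd> ?u) \<cdot> (q \<rhd> ?u) \<cdot> (y \<rhd> a)) x) h"
    by (rule SA_cong, (assumption | rule h l a linA)+, rule SA_mult_right)
      (assumption | rule h l a linA)+
  also have "\<dots> = SA (\<lambda>p z. SA (\<lambda>q y. (p \<bullet> l \<rhd> ?u) \<cdot> (q \<rhd> ?u) \<cdot> (y \<rhd> a)) z) h"
    by (rule SA_coassoc) (assumption | rule h l a linA)+
  also have "\<dots> = SA (\<lambda>p z. (p \<bullet> l \<rhd> ?u) \<cdot> (z \<rhd> a)) h"
  proof -
    have "SA (\<lambda>q y. (p \<bullet> l \<rhd> ?u) \<cdot> (q \<rhd> ?u) \<cdot> (y \<rhd> a)) z = (p \<bullet> l \<rhd> ?u) \<cdot> (z \<rhd> a)"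
      if p: "p \<in> carrier H" and z: "z \<in> carrier H" for p z
    proof -
      have "SA (\<lambda>q y. (p \<bullet> l \<rhd> ?u) \<cdot> (q \<rhd> ?u) \<cdot> (y \<rhd> a)) z =
          SA (\<lambda>q y. (p \<bullet> l \<rhd> ?u) \<cdot> ((q \<rhd> ?u) \<cdot> (y \<rhd> a))) z"
        using p z l a by (intro SA_cong) (simp_all add: A.m_assoc clA)
      also have "\<dots> = (p \<bullet> l \<rhd> ?u) \<cdot> SA (\<lambda>q y. (q \<rhd> ?u) \<cdot> (y \<rhd> a)) z"
        by (rule SA_mult_left[symmetric]) (assumption | rule p z l a linA)+
      finally show ?thesis by (simp only: SA_one_hact[OF z a])
    qed
    then show ?thesis
      by - (assumption | rule SA_cong h l a linA)+
  qed
  also have "\<dots> = SA (\<lambda>x y. h \<bullet> x \<rhd> S y \<rhd> a) l"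
  proof -
    have 1: "h \<bullet> x \<rhd> S y \<rhd> a =
        SA (\<lambda>p q. SA (\<lambda>u v. (p \<bullet> u \<rhd> ?u) \<cdot> (q \<bullet> (v \<bullet> S y) \<rhd> a)) x) h"
      if x: "x \<in> carrier H" and y: "y \<in> carrier H" for x y
    proof -
      have "h \<bullet> x \<rhd> S y \<rhd> a = SA (\<lambda>p q. (p \<rhd> ?u) \<cdot> (q \<bullet> S y \<rhd> a)) (h \<bullet> x)"
        using h x y a by (intro act_act H.m_closed H.S_closed)
      also have "\<dots> = SA (\<lambda>p q. SA (\<lambda>u v. (p \<bullet> u \<rhd> ?u) \<cdot> ((q \<bullet> v) \<bullet> S y \<rhd> a)) x) h"
        by (rule H.SW_mult) (assumption | rule bilinI h x y a linA)+
      also have "\<dots> = SA (\<lambda>p q. SA (\<lambda>u v. (p \<bullet> u \<rhd> ?u) \<cdot> (q \<bullet> (v \<bullet> S y) \<rhd> a)) x) h"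
        using h x y a by (intro SA_cong) (simp_all add: H.m_assoc clA)
      finally show ?thesis .
    qed
    have "SA (\<lambda>x y. h \<bullet> x \<rhd> S y \<rhd> a) l =
        SA (\<lambda>x y. SA (\<lambda>p q. SA (\<lambda>u v. (p \<bullet> u \<rhd> ?u) \<cdot> (q \<bullet> (v \<bullet> S y) \<rhd> a)) x) h) l"
      using 1 by - (assumption | rule SA_cong h l a linA)+
    also have "\<dots> = SA (\<lambda>p q. SA (\<lambda>x y. SA (\<lambda>u v. (p \<bullet> u \<rhd> ?u) \<cdot> (q \<bullet> (v \<bullet> S y) \<rhd> a)) x) l) h"
      by (rule H.SW_swap) (assumption | rule h l a linA)+
    also have "\<dots> = SA (\<lambda>p q. SA (\<lambda>u z. SA (\<lambda>v y. (p \<bullet> u \<rhd> ?u) \<cdot> (q \<bullet> (v \<bullet> S y) \<rhd> a)) z) l) h"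
      by (rule SA_cong, (assumption | rule h l a linA)+, rule SA_coassoc)
        (assumption | rule h l a linA)+
    also have "\<dots> = SA (\<lambda>p q. (p \<bullet> l \<rhd> ?u) \<cdot> (q \<rhd> a)) h"
    proof -
      have "SA (\<lambda>u z. SA (\<lambda>v y. (p \<bullet> u \<rhd> ?u) \<cdot> (q \<bullet> (v \<bullet> S y) \<rhd> a)) z) l =
          (p \<bullet> l \<rhd> ?u) \<cdot> (q \<rhd> a)"
        if p: "p \<in> carrier H" and q: "q \<in> carrier H" for p q
      proof -
        have "SA (\<lambda>u z. SA (\<lambda>v y. (p \<bullet> u \<rhd> ?u) \<cdot> (q \<bullet> (v \<bullet> S y) \<rhd> a)) z) l =
            (p \<bullet> l \<rhd> ?u) \<cdot> (q \<bullet> \<one>\<^bsub>H\<^esub> \<rhd> a)"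
          by (rule H.SW_cancel_right(2)[where G = "\<lambda>u t. (p \<bullet> u \<rhd> ?u) \<cdot> (q \<bullet> t \<rhd> a)"])
            (assumption | rule bilinI p q l a linA)+
        then show ?thesis using q by simp
      qed
      then show ?thesis
        by - (assumption | rule SA_cong h l a linA)+
    qed
    finally show ?thesis by simp
  qed
  finally show ?thesis .
qed

text \<open>
  Both sides are \<open>(h \<rhd> 1)(l \<rhd> a)\<close>.
\<close>

lemma hact_eps_mult:
  assumes h: "h \<in> carrier H" and l: "l \<in> carrier H" and a: "a \<in> carrier A"
  shows "SA (\<lambda>x y. x \<rhd> S y \<rhd> l \<rhd> a) h = SA (\<lambda>x y. x \<rhd> S y \<bullet> l \<rhd> a) h"
proof -
  let ?u = "\<one>\<^bsub>A\<^esub>"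
  have "x \<rhd> S y \<bullet> l \<rhd> a = SA (\<lambda>p q. (p \<rhd> ?u) \<cdot> ((q \<bullet> S y) \<bullet> l \<rhd> a)) x"
    if x: "x \<in> carrier H" and y: "y \<in> carrier H" for x y
  proof -
    have "x \<rhd> S y \<bullet> l \<rhd> a = SA (\<lambda>p q. (p \<rhd> ?u) \<cdot> (q \<bullet> (S y \<bullet> l) \<rhd> a)) x"
      using x y l a by (intro act_act H.m_closed H.S_closed)
    also have "\<dots> = SA (\<lambda>p q. (p \<rhd> ?u) \<cdot> ((q \<bullet> S y) \<bullet> l \<rhd> a)) x"
      using x y l a by (intro SA_cong) (simp_all add: H.m_assoc clA)
    finally show ?thesis .
  qed
  then have "SA (\<lambda>x y. x \<rhd> S y \<bullet> l \<rhd> a) h =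
      SA (\<lambda>x y. SA (\<lambda>p q. (p \<rhd> ?u) \<cdot> ((q \<bullet> S y) \<bullet> l \<rhd> a)) x) h"
    by - (assumption | rule SA_cong h l a linA)+
  also have "\<dots> = SA (\<lambda>p z. SA (\<lambda>q y. (p \<rhd> ?u) \<cdot> ((q \<bullet> S y) \<bullet> l \<rhd> a)) z) h"
    by (rule SA_coassoc) (assumption | rule h l a linA)+
  also have "\<dots> = (h \<rhd> ?u) \<cdot> (\<one>\<^bsub>H\<^esub> \<bullet> l \<rhd> a)"
    by (rule H.SW_cancel_right(2)[where G = "\<lambda>p t. (p \<rhd> ?u) \<cdot> (t \<bullet> l \<rhd> a)"])
      (assumption | rule bilinI h l a linA)+
  also have "\<dots> = SA (\<lambda>x y. x \<rhd> S y \<rhd> l \<rhd> a) h"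
    using h l a by (simp add: SA_hact_S_hact hact_closed)
  finally show ?thesis by simp
qed

text \<open>
  Both sides are \<open>(h\<^sub>1 \<rhd> a)(h\<^sub>2 S(l) \<rhd> 1)\<close>.  For the left one, use
  \<open>h \<rhd> (a (S(l) \<rhd> 1)) = (h\<^sub>1 \<rhd> a)(h\<^sub>2 \<rhd> (S(l) \<rhd> 1)) = (h\<^sub>1 \<rhd> a)(h\<^sub>2 \<rhd> 1)(h\<^sub>3 S(l) \<rhd> 1)\<close>.
\<close>

lemma hact_mult_eps':
  assumes h: "h \<in> carrier H" and l: "l \<in> carrier H" and a: "a \<in> carrier A"
  shows "SA (\<lambda>x y. h \<rhd> S x \<rhd> y \<rhd> a) l = SA (\<lambda>x y. h \<bullet> S x \<rhd> y \<rhd> a) l"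
proof -
  let ?u = "\<one>\<^bsub>A\<^esub>"
  have "SA (\<lambda>x y. h \<rhd> S x \<rhd> y \<rhd> a) l = h \<rhd> SA (\<lambda>x y. S x \<rhd> y \<rhd> a) l"
    by (rule hact_SA[symmetric]) (assumption | rule h l a linA)+
  also have "\<dots> = SA (\<lambda>x y. (x \<rhd> a) \<cdot> (y \<rhd> S l \<rhd> ?u)) h"
    unfolding SA_S_hact_hact[OF l a] using h l a by (intro act_mult hact_closed H.S_closed) auto
  also have "\<dots> = SA (\<lambda>x y. SA (\<lambda>p q. (x \<rhd> a) \<cdot> (p \<rhd> ?u) \<cdot> (q \<bullet> S l \<rhd> ?u)) y) h"
  proof -
    have "(x \<rhd> a) \<cdot> (y \<rhd> S l \<rhd> ?u) = SA (\<lambda>p q. (x \<rhd> a) \<cdot> (p \<rhd> ?u) \<cdot> (q \<bullet> S l \<rhd> ?u)) y"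
      if x: "x \<in> carrier H" and y: "y \<in> carrier H" for x y
    proof -
      have "(x \<rhd> a) \<cdot> (y \<rhd> S l \<rhd> ?u) = (x \<rhd> a) \<cdot> SA (\<lambda>p q. (p \<rhd> ?u) \<cdot> (q \<bullet> S l \<rhd> ?u)) y"
        using y l by (simp add: act_act H.S_closed)
      also have "\<dots> = SA (\<lambda>p q. (x \<rhd> a) \<cdot> ((p \<rhd> ?u) \<cdot> (q \<bullet> S l \<rhd> ?u))) y"
        by (rule SA_mult_left) (assumption | rule x y l a linA)+
      also have "\<dots> = SA (\<lambda>p q. (x \<rhd> a) \<cdot> (p \<rhd> ?u) \<cdot> (q \<bullet> S l \<rhd> ?u)) y"
        using x y l a by (intro SA_cong) (simp_all add: A.m_assoc clA)
      finally show ?thesis .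
    qed
    then show ?thesis
      by - (assumption | rule SA_cong h l a linA)+
  qed
  also have "\<dots> = SA (\<lambda>w q. SA (\<lambda>x p. (x \<rhd> a) \<cdot> (p \<rhd> ?u) \<cdot> (q \<bullet> S l \<rhd> ?u)) w) h"
    by (rule SA_coassoc[symmetric]) (assumption | rule h l a linA)+
  also have "\<dots> = SA (\<lambda>w q. SA (\<lambda>x p. (x \<rhd> a) \<cdot> (p \<rhd> ?u)) w \<cdot> (q \<bullet> S l \<rhd> ?u)) h"
    by (rule SA_cong, (assumption | rule h l a linA)+, rule SA_mult_right[symmetric])
      (assumption | rule h l a linA)+
  also have "\<dots> = SA (\<lambda>w q. (w \<rhd> a) \<cdot> (q \<bullet> S l \<rhd> ?u)) h"
    using h l a by (intro SA_cong) (simp_all add: SA_hact_one clA)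
  also have "\<dots> = SA (\<lambda>x y. h \<bullet> S x \<rhd> y \<rhd> a) l"
  proof -
    have 1: "h \<bullet> S x \<rhd> y \<rhd> a =
        SA (\<lambda>p q. SA (\<lambda>u v. (p \<bullet> (S v \<bullet> y) \<rhd> a) \<cdot> (q \<bullet> S u \<rhd> ?u)) x) h"
      if x: "x \<in> carrier H" and y: "y \<in> carrier H" for x y
    proof -
      have "h \<bullet> S x \<rhd> y \<rhd> a = SA (\<lambda>p q. (p \<bullet> y \<rhd> a) \<cdot> (q \<rhd> ?u)) (h \<bullet> S x)"
        using h x y a by (intro act_sym H.m_closed H.S_closed)
      also have "\<dots> = SA (\<lambda>p q. SA (\<lambda>u v. ((p \<bullet> u) \<bullet> y \<rhd> a) \<cdot> (q \<bullet> v \<rhd> ?u)) (S x)) h"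
        by (rule H.SW_mult) (assumption | rule bilinI h x y a linA)+
      also have "\<dots> = SA (\<lambda>p q. SA (\<lambda>u v. ((p \<bullet> S v) \<bullet> y \<rhd> a) \<cdot> (q \<bullet> S u \<rhd> ?u)) x) h"
        by (rule SA_cong, (assumption | rule h x y a linA)+, rule H.SW_S)
          (assumption | rule bilinI h x y a linA)+
      also have "\<dots> = SA (\<lambda>p q. SA (\<lambda>u v. (p \<bullet> (S v \<bullet> y) \<rhd> a) \<cdot> (q \<bullet> S u \<rhd> ?u)) x) h"
        using h x y a by (intro SA_cong) (simp_all add: H.m_assoc clA)
      finally show ?thesis .
    qed
    have "SA (\<lambda>x y. h \<bullet> S x \<rhd> y \<rhd> a) l =
        SA (\<lambda>x y. SA (\<lambda>p q. SA (\<lambda>u v. (p \<bullet> (S v \<bullet> y) \<rhd> a) \<cdot> (q \<bullet> S u \<rhd> ?u)) x) h) l"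
      using 1 by - (assumption | rule SA_cong h l a linA)+
    also have "\<dots> = SA (\<lambda>p q. SA (\<lambda>x y. SA (\<lambda>u v. (p \<bullet> (S v \<bullet> y) \<rhd> a) \<cdot> (q \<bullet> S u \<rhd> ?u)) x) l) h"
      by (rule H.SW_swap) (assumption | rule h l a linA)+
    also have "\<dots> = SA (\<lambda>p q. SA (\<lambda>u z. SA (\<lambda>v y. (p \<bullet> (S v \<bullet> y) \<rhd> a) \<cdot> (q \<bullet> S u \<rhd> ?u)) z) l) h"
      by (rule SA_cong, (assumption | rule h l a linA)+, rule SA_coassoc)
        (assumption | rule h l a linA)+
    also have "\<dots> = SA (\<lambda>p q. (p \<rhd> a) \<cdot> (q \<bullet> S l \<rhd> ?u)) h"
    proof -
      have "SA (\<lambda>u z. SA (\<lambda>v y. (p \<bullet> (S v \<bullet> y) \<rhd> a) \<cdot> (q \<bullet> S u \<rhd> ?u)) z) l =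
          (p \<rhd> a) \<cdot> (q \<bullet> S l \<rhd> ?u)"
        if p: "p \<in> carrier H" and q: "q \<in> carrier H" for p q
      proof -
        have "SA (\<lambda>u z. SA (\<lambda>v y. (p \<bullet> (S v \<bullet> y) \<rhd> a) \<cdot> (q \<bullet> S u \<rhd> ?u)) z) l =
            (p \<bullet> \<one>\<^bsub>H\<^esub> \<rhd> a) \<cdot> (q \<bullet> S l \<rhd> ?u)"
          by (rule H.SW_cancel_right(1)[where G = "\<lambda>u t. (p \<bullet> t \<rhd> a) \<cdot> (q \<bullet> S u \<rhd> ?u)"])
            (assumption | rule bilinI p q l a linA)+
        then show ?thesis using p by simp
      qed
      then show ?thesis
        by - (assumption | rule SA_cong h l a linA)+
    qed
    finally show ?thesis by simp
  qed
  finally show ?thesis .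
qed

text \<open>
  Both sides are \<open>(l \<rhd> a)(S(h) \<rhd> 1)\<close>.
\<close>

lemma hact_eps'_mult:
  assumes h: "h \<in> carrier H" and l: "l \<in> carrier H" and a: "a \<in> carrier A"
  shows "SA (\<lambda>x y. S x \<rhd> y \<rhd> l \<rhd> a) h = SA (\<lambda>x y. S x \<rhd> y \<bullet> l \<rhd> a) h"
proof -
  let ?u = "\<one>\<^bsub>A\<^esub>"
  have "S x \<rhd> y \<bullet> l \<rhd> a = SA (\<lambda>p q. ((S q \<bullet> y) \<bullet> l \<rhd> a) \<cdot> (S p \<rhd> ?u)) x"
    if x: "x \<in> carrier H" and y: "y \<in> carrier H" for x y
  proof -
    have "S x \<rhd> y \<bullet> l \<rhd> a = SA (\<lambda>p q. (p \<bullet> (y \<bullet> l) \<rhd> a) \<cdot> (q \<rhd> ?u)) (S x)"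
      using x y l a by (intro act_sym H.m_closed H.S_closed)
    also have "\<dots> = SA (\<lambda>p q. (S q \<bullet> (y \<bullet> l) \<rhd> a) \<cdot> (S p \<rhd> ?u)) x"
      by (rule H.SW_S) (assumption | rule bilinI x y l a linA)+
    also have "\<dots> = SA (\<lambda>p q. ((S q \<bullet> y) \<bullet> l \<rhd> a) \<cdot> (S p \<rhd> ?u)) x"
      using x y l a by (intro SA_cong) (simp_all add: H.m_assoc clA)
    finally show ?thesis .
  qed
  then have "SA (\<lambda>x y. S x \<rhd> y \<bullet> l \<rhd> a) h =
      SA (\<lambda>x y. SA (\<lambda>p q. ((S q \<bullet> y) \<bullet> l \<rhd> a) \<cdot> (S p \<rhd> ?u)) x) h"
    by - (assumption | rule SA_cong h l a linA)+
  also have "\<dots> = SA (\<lambda>p z. SA (\<lambda>q y. ((S q \<bullet> y) \<bullet> l \<rhd> a) \<cdot> (S p \<rhd> ?u)) z) h"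
    by (rule SA_coassoc) (assumption | rule h l a linA)+
  also have "\<dots> = (\<one>\<^bsub>H\<^esub> \<bullet> l \<rhd> a) \<cdot> (S h \<rhd> ?u)"
    by (rule H.SW_cancel_right(1)[where G = "\<lambda>p t. (t \<bullet> l \<rhd> a) \<cdot> (S p \<rhd> ?u)"])
      (assumption | rule bilinI h l a linA)+
  also have "\<dots> = SA (\<lambda>x y. S x \<rhd> y \<rhd> l \<rhd> a) h"
    using h l a by (simp add: SA_S_hact_hact hact_closed)
  finally show ?thesis by simp
qed

definition \<rho> where "\<rho> h = (\<lambda>a\<in>carrier A. h \<rhd> a)"

abbreviation "EA \<equiv> end_alg R A"

lemma algebra_EA: "assoc_algebra R EA" by (rule end_alg_algebra[OF module_A])
lemma module_EA: "module R EA" by (rule end_alg_module[OF module_A])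

lemma rho_hom: "\<rho> \<in> mod_hom R H EA"
  unfolding \<rho>_def
  by (rule end_alg_mod_homI[OF module_A]) (assumption | rule linA)+

lemma rho_closed: "h \<in> carrier H \<Longrightarrow> \<rho> h \<in> carrier EA"
  by (rule mod_hom_closed[OF rho_hom])

lemma rho_apply: "a \<in> carrier A \<Longrightarrow> \<rho> h a = h \<rhd> a"
  by (simp add: \<rho>_def)

lemma SW_EA_apply:
  assumes "h \<in> carrier H" "a \<in> carrier A"
    and "\<And>x y. \<lbrakk>x \<in> carrier H; y \<in> carrier H\<rbrakk> \<Longrightarrow> f x y \<in> carrier EA"
  shows "sweedler EA R H f h a = SA (\<lambda>x y. f x y a) h"
  by (rule H.SW_image[OF module_EA module_A end_alg_eval[OF module_A assms(2)] assms(1,3)])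

lemma rho_partial_rep: "partial_rep R H EA \<rho>"
proof -
  note m = end_alg_ops(1)[OF module_A]
  note ap = end_alg_apply(1)[OF module_A] rho_apply hact_closed H.S_closed
  note cl = m rho_closed H.S_closed H.m_closed H.SW_closed[OF module_EA]
  have eqI: "sweedler EA R H f h = sweedler EA R H g h"
    if "h \<in> carrier H" "\<And>x y. \<lbrakk>x \<in> carrier H; y \<in> carrier H\<rbrakk> \<Longrightarrow> f x y \<in> carrier EA"
      "\<And>x y. \<lbrakk>x \<in> carrier H; y \<in> carrier H\<rbrakk> \<Longrightarrow> g x y \<in> carrier EA"
      "\<And>a. a \<in> carrier A \<Longrightarrow> SA (\<lambda>x y. f x y a) h = SA (\<lambda>x y. g x y a) h" for f g h
    by (rule end_alg_eqI[OF module_A]) (simp_all add: that SW_EA_apply H.SW_closed[OF module_EA])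
  have c: "SA (\<lambda>x y. f x y) h = SA (\<lambda>x y. f' x y) h"
    if "SA (\<lambda>x y. g x y) h = SA (\<lambda>x y. g' x y) h" "h \<in> carrier H"
      "\<And>x y. \<lbrakk>x \<in> carrier H; y \<in> carrier H\<rbrakk> \<Longrightarrow> f x y = g x y"
      "\<And>x y. \<lbrakk>x \<in> carrier H; y \<in> carrier H\<rbrakk> \<Longrightarrow> f' x y = g' x y"
      "\<And>x y. \<lbrakk>x \<in> carrier H; y \<in> carrier H\<rbrakk> \<Longrightarrow> g x y \<in> carrier A"
      "\<And>x y. \<lbrakk>x \<in> carrier H; y \<in> carrier H\<rbrakk> \<Longrightarrow> g' x y \<in> carrier A" for f f' g g' h
  proof -
    have "SA f h = SA g h"
      by (rule SA_cong[symmetric]) (simp_all add: that)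
    also have "\<dots> = SA f' h"
      unfolding that(1) by (rule SA_cong) (simp_all add: that)
    finally show ?thesis .
  qed
  show ?thesis
  proof (intro partial_rep.intro partial_rep_axioms.intro H.hopf_algebra_axioms algebra_EA rho_hom)
    show "\<rho> \<one>\<^bsub>H\<^esub> = \<one>\<^bsub>EA\<^esub>"
      by (rule end_alg_eqI[OF module_A], intro rho_closed H.one_closed,
          rule end_alg_ops(2)[OF module_A]) (simp add: end_alg_apply[OF module_A] rho_apply act_one)
    fix h l assume h: "h \<in> carrier H" and l: "l \<in> carrier H"
    show "H.SW EA (\<lambda>x y. \<rho> h \<otimes>\<^bsub>EA\<^esub> \<rho> x \<otimes>\<^bsub>EA\<^esub> \<rho> (S y)) l = H.SW EA (\<lambda>x y. \<rho> (h \<bullet> x) \<otimes>\<^bsub>EA\<^esub> \<rho> (S y)) l"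
      using h l by - (rule eqI, (assumption | rule cl)+, rule c[OF hact_mult_eps[of h l]], (simp add: ap cl)+)
    show "H.SW EA (\<lambda>x y. \<rho> x \<otimes>\<^bsub>EA\<^esub> \<rho> (S y) \<otimes>\<^bsub>EA\<^esub> \<rho> l) h = H.SW EA (\<lambda>x y. \<rho> x \<otimes>\<^bsub>EA\<^esub> \<rho> (S y \<bullet> l)) h"
      using h l by - (rule eqI, (assumption | rule cl)+, rule c[OF hact_eps_mult[of h l]], (simp add: ap cl)+)
    show "H.SW EA (\<lambda>x y. \<rho> h \<otimes>\<^bsub>EA\<^esub> \<rho> (S x) \<otimes>\<^bsub>EA\<^esub> \<rho> y) l = H.SW EA (\<lambda>x y. \<rho> (h \<bullet> S x) \<otimes>\<^bsub>EA\<^esub> \<rho> y) l"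
      using h l by - (rule eqI, (assumption | rule cl)+, rule c[OF hact_mult_eps'[of h l]], (simp add: ap cl)+)
    show "H.SW EA (\<lambda>x y. \<rho> (S x) \<otimes>\<^bsub>EA\<^esub> \<rho> y \<otimes>\<^bsub>EA\<^esub> \<rho> l) h = H.SW EA (\<lambda>x y. \<rho> (S x) \<otimes>\<^bsub>EA\<^esub> \<rho> (y \<bullet> l)) h"
      using h l by - (rule eqI, (assumption | rule cl)+, rule c[OF hact_eps'_mult[of h l]], (simp add: ap cl)+)
  qed
qed

abbreviation "V \<equiv> tensor R A H"
abbreviation "EV \<equiv> end_alg R V"
abbreviation tensV (infix \<open>\<oslash>\<close> 55) where "a \<oslash> h \<equiv> tens R A H a h"

lemma module_V: "module R V" by (rule tensor_module[OF module_A H.module_H])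
lemma module_EV: "module R EV" by (rule end_alg_module[OF module_V])

lemma tensV_bilin: "bilin R A H V (tens R A H)"
  by (rule tens_bilin[OF module_A H.module_H])

lemma tensV_closed: "\<lbrakk>a \<in> carrier A; h \<in> carrier H\<rbrakk> \<Longrightarrow> a \<oslash> h \<in> carrier V"
  by (rule bilin_closed[OF tensV_bilin])

lemmas linV = module_V bilin_compose_left[OF tensV_bilin] bilin_compose_right[OF tensV_bilin]
  bilin_right[OF tensV_bilin] bilin_left[OF tensV_bilin] tensV_closed linA

text \<open>
  The operator \<open>f \<otimes> (y \<mapsto> h y)\<close> on \<open>A \<otimes> H\<close>.
\<close>

definition T where "T f h = (\<lambda>t\<in>carrier V. tensor_lift V R (\<lambda>b y. f b \<oslash> h \<bullet> y) t)"

lemma T_inner_bilin: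
  assumes "f \<in> carrier EA" "h \<in> carrier H"
  shows "bilin R A H V (\<lambda>b y. f b \<oslash> h \<bullet> y)"
  using assms end_alg_hom[OF module_A assms(1)] end_alg_closed[OF module_A assms(1)]
  by - (rule bilinI; (assumption | rule linV)+)

lemma T_apply:
  assumes "f \<in> carrier EA" "h \<in> carrier H" "b \<in> carrier A" "y \<in> carrier H"
  shows "T f h (b \<oslash> y) = f b \<oslash> h \<bullet> y"
  using assms by (simp add: T_def tensV_closed
      tensor_lift_tens[OF module_A H.module_H module_V T_inner_bilin])

lemma T_inner_hom:
  assumes "f \<in> carrier EA" "h \<in> carrier H"
  shows "tensor_lift V R (\<lambda>b y. f b \<oslash> h \<bullet> y) \<in> mod_hom R V V"
  by (rule tensor_lift_hom[OF module_A H.module_H module_V T_inner_bilin[OF assms]])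

lemma T_closed: "\<lbrakk>f \<in> carrier EA; h \<in> carrier H\<rbrakk> \<Longrightarrow> T f h \<in> carrier EV"
  unfolding T_def by (rule end_alg_carrierI[OF module_V T_inner_hom])

lemma T_bilin: "bilin R EA H EV T"
proof (rule bilinI)
  fix f assume f: "f \<in> carrier EA"
  note fl = end_alg_closed[OF module_A f]
  show "T f \<in> mod_hom R H EV"
    unfolding T_def
    by (rule end_alg_mod_homI[OF module_V], rule T_inner_hom[OF f],
        assumption, rule tensor_lift_param[OF module_A H.module_H _ H.module_H module_V])
      (assumption | rule linV fl)+
next
  fix h assume h: "h \<in> carrier H"
  show "(\<lambda>f. T f h) \<in> mod_hom R EA EV"
    unfolding T_def
    by (rule end_alg_mod_homI[OF module_V], rule T_inner_hom[OF _ h],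
        assumption, rule tensor_lift_param[OF module_A H.module_H _ module_EA module_V])
      (assumption | rule linV h end_alg_eval[OF module_A] module_EA)+
qed

lemma EV_eqI:
  assumes "F \<in> carrier EV" "G \<in> carrier EV"
    and eq: "\<And>b y. \<lbrakk>b \<in> carrier A; y \<in> carrier H\<rbrakk> \<Longrightarrow> F (b \<oslash> y) = G (b \<oslash> y)"
  shows "F = G"
proof (rule end_alg_eqI[OF module_V assms(1,2)])
  fix t assume t: "t \<in> carrier V"
  show "F t = G t"
    by (rule tensor_hom_eqI[OF module_A H.module_H module_V end_alg_hom[OF module_V assms(1)]
          end_alg_hom[OF module_V assms(2)] eq t])
qed

lemma T_mult:
  assumes "f \<in> carrier EA" "g \<in> carrier EA" "h \<in> carrier H" "l \<in> carrier H"
  shows "T f h \<otimes>\<^bsub>EV\<^esub> T g l = T (f \<otimes>\<^bsub>EA\<^esub> g) (h \<bullet> l)"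
proof (rule EV_eqI)
  note m = end_alg_ops(1)[OF module_A] end_alg_ops(1)[OF module_V]
  show "T f h \<otimes>\<^bsub>EV\<^esub> T g l \<in> carrier EV" "T (f \<otimes>\<^bsub>EA\<^esub> g) (h \<bullet> l) \<in> carrier EV"
    using assms by (auto intro!: m T_closed)
  fix b y assume "b \<in> carrier A" "y \<in> carrier H"
  then show "(T f h \<otimes>\<^bsub>EV\<^esub> T g l) (b \<oslash> y) = T (f \<otimes>\<^bsub>EA\<^esub> g) (h \<bullet> l) (b \<oslash> y)"
    using assms by (simp add: end_alg_apply[OF module_V] end_alg_apply[OF module_A] T_apply m
        tensV_closed end_alg_closed[OF module_A] H.m_assoc)
qed

lemma T_one: "T \<one>\<^bsub>EA\<^esub> \<one>\<^bsub>H\<^esub> = \<one>\<^bsub>EV\<^esub>"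
proof (rule EV_eqI)
  note o = end_alg_ops(2)[OF module_A] end_alg_ops(2)[OF module_V]
  show "T \<one>\<^bsub>EA\<^esub> \<one>\<^bsub>H\<^esub> \<in> carrier EV" "\<one>\<^bsub>EV\<^esub> \<in> carrier EV"
    by (auto intro!: o T_closed)
  fix b y assume "b \<in> carrier A" "y \<in> carrier H"
  then show "T \<one>\<^bsub>EA\<^esub> \<one>\<^bsub>H\<^esub> (b \<oslash> y) = \<one>\<^bsub>EV\<^esub> (b \<oslash> y)"
    by (simp add: end_alg_apply[OF module_V] end_alg_apply[OF module_A] T_apply o tensV_closed)
qed

lemma rho_tensor: "partial_rep_tensor R H EA \<rho> EV T"
  by (intro partial_rep_tensor.intro rho_partial_rep end_alg_algebra[OF module_V]
      partial_rep_tensor_axioms.intro T_bilin T_mult T_one)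

definition L where "L h = sweedler EV R H (\<lambda>p q. T (\<rho> p) q) h"

lemma L_eq: "partial_rep_tensor.L R H \<rho> EV T = L"
  by (intro ext) (simp add: partial_rep_tensor.L_def[OF rho_tensor] L_def)

lemma L_partial_rep: "partial_rep R H EV L"
  using partial_rep_tensor.tensor_partial_rep[OF rho_tensor] by (simp add: L_eq)

lemma SW_EV_apply:
  assumes "h \<in> carrier H" "t \<in> carrier V"
    and "\<And>x y. \<lbrakk>x \<in> carrier H; y \<in> carrier H\<rbrakk> \<Longrightarrow> f x y \<in> carrier EV"
  shows "sweedler EV R H f h t = H.SW V (\<lambda>x y. f x y t) h"
  by (rule H.SW_image[OF module_EV module_V end_alg_eval[OF module_V assms(2)] assms(1,3)])

lemma L_closed: "h \<in> carrier H \<Longrightarrow> L h \<in> carrier EV"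
  unfolding L_def by (intro H.SW_closed module_EV T_closed rho_closed)

lemma L_apply:
  assumes "h \<in> carrier H" "b \<in> carrier A" "y \<in> carrier H"
  shows "L h (b \<oslash> y) = H.SW V (\<lambda>p q. p \<rhd> b \<oslash> q \<bullet> y) h"
proof -
  have "L h (b \<oslash> y) = H.SW V (\<lambda>p q. T (\<rho> p) q (b \<oslash> y)) h"
    unfolding L_def using assms by (intro SW_EV_apply tensV_closed T_closed rho_closed)
  also have "\<dots> = H.SW V (\<lambda>p q. p \<rhd> b \<oslash> q \<bullet> y) h"
    using assms by (intro H.SW_cong[OF module_V])
      (simp_all add: T_apply rho_apply rho_closed tensV_closed hact_closed)
  finally show ?thesis .
qed

definition lmult where "lmult a = T (\<lambda>b\<in>carrier A. a \<cdot> b) \<one>\<^bsub>H\<^esub>"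

lemma lmult_hom: "lmult \<in> mod_hom R A EV"
  unfolding lmult_def
  by (rule mod_hom_compose[OF end_alg_mod_homI[OF module_A] bilin_left[OF T_bilin]])
    (assumption | rule linA)+

lemma lmult_inner_closed: "a \<in> carrier A \<Longrightarrow> (\<lambda>b\<in>carrier A. a \<cdot> b) \<in> carrier EA"
  by (rule end_alg_carrierI[OF module_A]) (assumption | rule linA)+

lemma lmult_closed: "a \<in> carrier A \<Longrightarrow> lmult a \<in> carrier EV"
  by (rule mod_hom_closed[OF lmult_hom])

lemma lmult_apply: "\<lbrakk>a \<in> carrier A; b \<in> carrier A; y \<in> carrier H\<rbrakk> \<Longrightarrow> lmult a (b \<oslash> y) = a \<cdot> b \<oslash> y"
  unfolding lmult_def by (simp add: T_apply lmult_inner_closed)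

lemma lmult_mult: "\<lbrakk>a \<in> carrier A; b \<in> carrier A\<rbrakk> \<Longrightarrow> lmult (a \<cdot> b) = lmult a \<otimes>\<^bsub>EV\<^esub> lmult b"
  by (rule EV_eqI) (auto intro!: lmult_closed end_alg_ops(1)[OF module_V]
      simp: lmult_apply end_alg_apply(1)[OF module_V] tensV_closed A.m_assoc)

lemma lmult_one: "lmult \<one>\<^bsub>A\<^esub> = \<one>\<^bsub>EV\<^esub>"
  by (rule EV_eqI) (auto intro!: lmult_closed end_alg_ops(2)[OF module_V]
      simp: lmult_apply end_alg_apply(2)[OF module_V] tensV_closed)

text \<open>
  For the classes in \<open>H\<^sub>p\<^sub>a\<^sub>r\<close>, this identifies the action of \<open>\<epsilon>\<^sub>k\<close> on \<open>A \<otimes> H\<close> as the multiplication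
  by \<open>\<epsilon>\<^sub>k = k \<rhd> 1\<close> on the first factor.
\<close>

lemma SW_L_L_S:
  assumes k: "k \<in> carrier H"
  shows "sweedler EV R H (\<lambda>x y. L x \<otimes>\<^bsub>EV\<^esub> L (S y)) k = lmult (k \<rhd> \<one>\<^bsub>A\<^esub>)"
proof -
  note m = end_alg_ops(1)[OF module_A]
  have "sweedler EV R H (\<lambda>x y. L x \<otimes>\<^bsub>EV\<^esub> L (S y)) k =
      sweedler EV R H (\<lambda>w r. T (\<rho> w \<otimes>\<^bsub>EA\<^esub> \<rho> (S r)) \<one>\<^bsub>H\<^esub>) k"
    using partial_rep_tensor.SD_L_L_S[OF rho_tensor k] by (simp add: L_eq)
  also have "\<dots> = T (sweedler EA R H (\<lambda>w r. \<rho> w \<otimes>\<^bsub>EA\<^esub> \<rho> (S r)) k) \<one>\<^bsub>H\<^esub>"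
    by (rule H.SW_image[symmetric, OF module_EA module_EV bilin_left[OF T_bilin]])
      (auto intro!: k m rho_closed H.S_closed)
  also have "sweedler EA R H (\<lambda>w r. \<rho> w \<otimes>\<^bsub>EA\<^esub> \<rho> (S r)) k = (\<lambda>b\<in>carrier A. (k \<rhd> \<one>\<^bsub>A\<^esub>) \<cdot> b)"
  proof (rule end_alg_eqI[OF module_A])
    show "sweedler EA R H (\<lambda>w r. \<rho> w \<otimes>\<^bsub>EA\<^esub> \<rho> (S r)) k \<in> carrier EA"
      by (intro H.SW_closed module_EA k m rho_closed H.S_closed)
    show "(\<lambda>b\<in>carrier A. (k \<rhd> \<one>\<^bsub>A\<^esub>) \<cdot> b) \<in> carrier EA"
      by (intro lmult_inner_closed hact_closed k A.one_closed)
    fix a assume a: "a \<in> carrier A"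
    have "sweedler EA R H (\<lambda>w r. \<rho> w \<otimes>\<^bsub>EA\<^esub> \<rho> (S r)) k a =
        SA (\<lambda>x y. (\<rho> x \<otimes>\<^bsub>EA\<^esub> \<rho> (S y)) a) k"
      using a by (intro SW_EA_apply k m rho_closed H.S_closed)
    also have "\<dots> = SA (\<lambda>x y. x \<rhd> S y \<rhd> a) k"
      using k a by (intro SA_cong)
        (auto simp: end_alg_apply(1)[OF module_A] rho_apply hact_closed H.S_closed)
    finally show "sweedler EA R H (\<lambda>w r. \<rho> w \<otimes>\<^bsub>EA\<^esub> \<rho> (S r)) k a =
        (\<lambda>b\<in>carrier A. (k \<rhd> \<one>\<^bsub>A\<^esub>) \<cdot> b) a"
      using k a by (simp add: SA_hact_S_hact)
  qed
  finally show ?thesis by (simp only: lmult_def)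
qed

abbreviation smash where "smash \<equiv> smash_mult R H A \<alpha>"

lemma smash_inner_bilin:
  assumes a: "a \<in> carrier A" and h: "h \<in> carrier H"
  shows "bilin R A H V (\<lambda>b l. H.SW V (\<lambda>x y. a \<cdot> (x \<rhd> b) \<oslash> y \<bullet> l) h)"
  by (rule bilinI; (assumption | rule linV a h)+)

lemma smash_outer_bilin:
  assumes u: "u \<in> carrier V"
  shows "bilin R A H V (\<lambda>a h. tensor_lift V R (\<lambda>b l.
    H.SW V (\<lambda>x y. a \<cdot> (x \<rhd> b) \<oslash> y \<bullet> l) h) u)"
  by (rule bilinI; rule tensor_lift_param[OF module_A H.module_H u];
      (assumption | rule linV)+)

lemma smash_eq: "smash t u = tensor_lift V R (\<lambda>a h. tensor_lift V R (\<lambda>b l.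
    H.SW V (\<lambda>x y. a \<cdot> (x \<rhd> b) \<oslash> y \<bullet> l) h) u) t"
  by (simp add: smash_mult_def Let_def)

lemma smash_left_hom: "u \<in> carrier V \<Longrightarrow> (\<lambda>t. smash t u) \<in> mod_hom R V V"
  unfolding smash_eq
  by (rule tensor_lift_hom[OF module_A H.module_H module_V smash_outer_bilin])

text \<open>
  The elements \<open>1 \<otimes> h\<close> and \<open>a \<otimes> 1\<close> multiply on the left by \<open>L\<^sub>h\<close> and \<open>lmult a\<close>, respectively.
\<close>

lemma smash_tens:
  assumes a: "a \<in> carrier A" and h: "h \<in> carrier H" and u: "u \<in> carrier V"
  shows "smash (a \<oslash> h) u = lmult a (L h u)"
proof -
  have "smash (a \<oslash> h) u = tensor_lift V R (\<lambda>b l. H.SW V (\<lambda>x y. a \<cdot> (x \<rhd> b) \<oslash> y \<bullet> l) h) u"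
    unfolding smash_eq by (rule tensor_lift_tens[OF module_A H.module_H module_V smash_outer_bilin[OF u] a h])
  also have "\<dots> = lmult a (L h u)"
  proof (rule tensor_hom_eqI[OF module_A H.module_H module_V _ _ _ u])
    show "tensor_lift V R (\<lambda>b l. H.SW V (\<lambda>x y. a \<cdot> (x \<rhd> b) \<oslash> y \<bullet> l) h) \<in> mod_hom R V V"
      by (rule tensor_lift_hom[OF module_A H.module_H module_V smash_inner_bilin[OF a h]])
    note la = end_alg_hom[OF module_V lmult_closed[OF a]]
    show "(\<lambda>u. lmult a (L h u)) \<in> mod_hom R V V"
      by (rule mod_hom_compose[OF end_alg_hom[OF module_V L_closed[OF h]] la])
    fix b l assume b: "b \<in> carrier A" and l: "l \<in> carrier H"
    have "lmult a (L h (b \<oslash> l)) = H.SW V (\<lambda>x y. lmult a (x \<rhd> b \<oslash> y \<bullet> l)) h"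
      unfolding L_apply[OF h b l]
      by (rule H.SW_image[OF module_V module_V la h]) (assumption | rule linV b l)+
    also have "\<dots> = H.SW V (\<lambda>x y. a \<cdot> (x \<rhd> b) \<oslash> y \<bullet> l) h"
      using a b l by (intro H.SW_cong module_V h)
        (auto simp: lmult_apply hact_closed tensV_closed)
    finally show "tensor_lift V R (\<lambda>b l. H.SW V (\<lambda>x y. a \<cdot> (x \<rhd> b) \<oslash> y \<bullet> l) h) (b \<oslash> l) =
        lmult a (L h (b \<oslash> l))"
      by (simp add: tensor_lift_tens[OF module_A H.module_H module_V smash_inner_bilin[OF a h] b l])
  qed
  finally show ?thesis .
qed

end

section \<open>Subalgebras\<close>

lemma subalgI:
  assumes A: "assoc_algebra R A" and "B \<subseteq> carrier A" "\<one>\<^bsub>A\<^esub> \<in> B"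
    and add: "\<And>x y. \<lbrakk>x \<in> B; y \<in> B\<rbrakk> \<Longrightarrow> x \<oplus>\<^bsub>A\<^esub> y \<in> B"
    and smult: "\<And>c x. \<lbrakk>c \<in> carrier R; x \<in> B\<rbrakk> \<Longrightarrow> c \<odot>\<^bsub>A\<^esub> x \<in> B"
    and mult: "\<And>x y. \<lbrakk>x \<in> B; y \<in> B\<rbrakk> \<Longrightarrow> x \<otimes>\<^bsub>A\<^esub> y \<in> B"
  shows "subalg R A B"
proof -
  interpret A: assoc_algebra R A by fact
  have "\<zero>\<^bsub>R\<^esub> \<odot>\<^bsub>A\<^esub> \<one>\<^bsub>A\<^esub> \<in> B" using assms by (intro smult) auto
  then have "submodule B R A"
    using assms by (intro submodule_criterion A.module_axioms) auto
  moreover have "subring B A"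
    using assms A.submoduleE(3)[OF \<open>submodule B R A\<close>] by (intro A.subringI) auto
  ultimately show ?thesis by (simp add: subalg_def)
qed

lemma subalgD:
  assumes "subalg R A B"
  shows "submodule B R A" "\<one>\<^bsub>A\<^esub> \<in> B" "\<lbrakk>x \<in> B; y \<in> B\<rbrakk> \<Longrightarrow> x \<otimes>\<^bsub>A\<^esub> y \<in> B"
    "x \<in> B \<Longrightarrow> x \<in> carrier A"
  using assms subringE[of B A] by (auto simp: subalg_def)

lemma gen_subalg_subalg:
  assumes A: "assoc_algebra R A" and E: "E \<subseteq> carrier A"
  shows "subalg R A (gen_subalg R A E)"
proof -
  interpret A: assoc_algebra R A by fact
  have top: "subalg R A (carrier A)" by (rule subalgI[OF A]) auto
  show ?thesis
    unfolding gen_subalg_def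
  proof (rule subalgI[OF A])
    show "\<Inter> {B. subalg R A B \<and> E \<subseteq> B} \<subseteq> carrier A" using top E by blast
  qed (auto intro: subalgD submodule_add submodule_smult)
qed

lemma gen_subalg_incl: "E \<subseteq> gen_subalg R A E"
  and gen_subalg_least: "\<lbrakk>subalg R A B; E \<subseteq> B\<rbrakk> \<Longrightarrow> gen_subalg R A E \<subseteq> B"
  by (auto simp: gen_subalg_def)

lemma subalg_algebra:
  assumes A: "assoc_algebra R A" and B: "subalg R A B"
  shows "assoc_algebra R (A\<lparr>carrier := B\<rparr>)"
proof -
  interpret A: assoc_algebra R A by fact
  note c = subalgD[OF B]
  have "module R (A\<lparr>carrier := B\<rparr>)"
    by (rule submodule.submodule_is_module[OF c(1) A.module_axioms])
  then show ?thesis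
    by (rule assoc_algebraI)
      (auto simp: c mod_hom_def A.m_assoc A.l_distr A.r_distr A.smult_mult_left A.smult_mult_right)
qed

lemma subalg_incl_hom: "submodule N R P \<Longrightarrow> (\<lambda>x. x) \<in> mod_hom R (P\<lparr>carrier := N\<rparr>) P"
  by (auto simp: mod_hom_def submodule_subset)

lemma mod_hom_into_submodule:
  "\<lbrakk>f \<in> mod_hom R M P; \<And>x. x \<in> carrier M \<Longrightarrow> f x \<in> N\<rbrakk> \<Longrightarrow> f \<in> mod_hom R M (P\<lparr>carrier := N\<rparr>)"
  by (auto simp: mod_hom_def)

lemma mod_hom_on_submodule:
  "\<lbrakk>f \<in> mod_hom R P M; submodule N R P\<rbrakk> \<Longrightarrow> f \<in> mod_hom R (P\<lparr>carrier := N\<rparr>) M"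
  by (auto simp: mod_hom_def submodule_subset)

context hopf_algebra
begin

text \<open>
  Sums over the base algebra and over the ambient algebra agree, so that all calculations can be done
  in the latter.
\<close>

lemma SW_submodule:
  assumes P: "module R P" and N: "submodule N R P" and h: "h \<in> carrier H"
    and f: "\<And>x y. \<lbrakk>x \<in> carrier H; y \<in> carrier H\<rbrakk> \<Longrightarrow> f x y \<in> N"
  shows "SW P f h = SW (P\<lparr>carrier := N\<rparr>) f h" "SW P f h \<in> N"
proof -
  have N': "module R (P\<lparr>carrier := N\<rparr>)" by (rule submodule.submodule_is_module[OF N P])
  show 1: "SW P f h = SW (P\<lparr>carrier := N\<rparr>) f h"
    using SW_image[OF N' P subalg_incl_hom[OF N] h, of f] f by simp
  show "SW P f h \<in> N"
    unfolding 1 using SW_closed[OF N' h, of f] f by simp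
qed

end

section \<open>The partial action on the base algebra\<close>

context partial_rep
begin

definition base where "base = gen_subalg R B (e ` carrier H)"

abbreviation A where "A \<equiv> B\<lparr>carrier := base\<rparr>"

lemma base_subalg: "subalg R B base"
  unfolding base_def by (rule gen_subalg_subalg[OF algebra_B]) (auto simp: e_closed)

lemmas base_facts = subalgD[OF base_subalg]
lemmas base_submodule = base_facts(1)

lemma base_B: "a \<in> base \<Longrightarrow> a \<in> carrier B"
  by (rule base_facts(4))

lemma e_base: "h \<in> carrier H \<Longrightarrow> e h \<in> base"
  unfolding base_def by (rule subsetD[OF gen_subalg_incl]) simp

lemma base_least: "\<lbrakk>subalg R B N; \<And>h. h \<in> carrier H \<Longrightarrow> e h \<in> N\<rbrakk> \<Longrightarrow> base \<subseteq> N"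
  unfolding base_def by (rule gen_subalg_least) auto

lemma algebra_base: "assoc_algebra R A"
  by (rule subalg_algebra[OF algebra_B base_subalg])

lemma module_base: "module R A"
  using algebra_base by (simp add: assoc_algebra_def)

lemma cent_subalg: "subalg R B cent"
proof (rule subalgI[OF algebra_B])
  fix x y assume x: "x \<in> cent" and y: "y \<in> cent"
  note xy = centD(1)[OF x] centD(1)[OF y]
  show "x \<oplus>\<^bsub>B\<^esub> y \<in> cent"
    using xy by (auto simp: cent_def B.l_distr B.r_distr e'_closed centD(2)[OF x] centD(2)[OF y])
  have "e' h \<cdot> (x \<cdot> y) = x \<cdot> y \<cdot> e' h" if h: "h \<in> carrier H" for h
  proof -
    have "e' h \<cdot> (x \<cdot> y) = (e' h \<cdot> x) \<cdot> y" using xy h by (simp add: B.m_assoc e'_closed)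
    also have "\<dots> = x \<cdot> (e' h \<cdot> y)" using xy h by (simp add: centD(2)[OF x] B.m_assoc e'_closed)
    also have "\<dots> = x \<cdot> y \<cdot> e' h" using xy h by (simp add: centD(2)[OF y] B.m_assoc e'_closed)
    finally show ?thesis .
  qed
  then show "x \<cdot> y \<in> cent" using xy by (auto simp: cent_def)
next
  fix c x assume c: "c \<in> carrier R" and x: "x \<in> cent"
  then show "c \<odot>\<^bsub>B\<^esub> x \<in> cent"
    using centD(1)[OF x]
    by (auto simp: cent_def B.smult_mult_left B.smult_mult_right e'_closed centD(2)[OF x])
qed (auto simp: one_cent centD)

lemma base_cent: "a \<in> base \<Longrightarrow> a \<in> cent"
  using base_least[OF cent_subalg e_cent] by auto

lemma SB_base:
  "\<lbrakk>h \<in> carrier H; \<And>x y. \<lbrakk>x \<in> carrier H; y \<in> carrier H\<rbrakk> \<Longrightarrow> f x y \<in> base\<rbrakk> \<Longrightarrow> SB f h \<in> base"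
  by (rule SW_submodule(2)[OF module_B base_submodule])

text \<open>
  The elements whose translates stay in the base algebra form a subalgebra by \<open>act_mult_cent\<close>, and it
  contains the generators by \<open>act_e\<close>.
\<close>

lemma act_base:
  assumes a: "a \<in> base" and h: "h \<in> carrier H"
  shows "act h a \<in> base"
proof -
  let ?N = "{a \<in> base. \<forall>h\<in>carrier H. act h a \<in> base}"
  have lin: "(\<lambda>a. act h a) \<in> mod_hom R B B" if "h \<in> carrier H" for h
    using that act_lin_right[OF module_B mod_hom_id] by simp
  have "subalg R B ?N"
  proof (rule subalgI[OF algebra_B])
    show "\<one>\<^bsub>B\<^esub> \<in> ?N" by (auto simp: act_one_eq e_base base_facts(2))
    fix x y assume xy: "x \<in> ?N" "y \<in> ?N"
    then show "x \<oplus>\<^bsub>B\<^esub> y \<in> ?N"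
      by (auto simp: mod_hom_add[OF lin] base_B submodule_add[OF base_submodule])
    show "x \<cdot> y \<in> ?N"
      using xy by (auto simp: act_mult_cent base_cent base_B intro!: SB_base base_facts(3))
  next
    fix c x assume "c \<in> carrier R" "x \<in> ?N"
    then show "c \<odot>\<^bsub>B\<^esub> x \<in> ?N"
      by (auto simp: mod_hom_smult[OF lin] base_B submodule_smult[OF base_submodule])
  qed (auto simp: base_B)
  moreover have "e k \<in> ?N" if "k \<in> carrier H" for k
    using that by (auto simp: e_base act_e intro!: SB_base base_facts(3))
  ultimately have "base \<subseteq> ?N" by (rule base_least)
  then show ?thesis using a h by auto
qed

definition \<alpha> where "\<alpha> = tensor_lift A R act"

lemma act_bilin: "bilin R H A A act"
proof (rule bilinI)
  fix h assume h: "h \<in> carrier H"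
  have "act h \<in> mod_hom R A B"
    by (rule mod_hom_on_submodule[OF act_lin_right[OF module_B mod_hom_id h] base_submodule])
  then show "act h \<in> mod_hom R A A"
    by (rule mod_hom_into_submodule) (simp add: act_base h)
next
  fix a assume "a \<in> carrier A"
  then have a: "a \<in> base" by simp
  show "(\<lambda>h. act h a) \<in> mod_hom R H A"
    by (rule mod_hom_into_submodule[OF act_lin_left[OF mod_hom_id base_B[OF a]]])
      (simp add: act_base a)
qed

lemma act_on_eq: "\<lbrakk>h \<in> carrier H; a \<in> base\<rbrakk> \<Longrightarrow> act_on R H A \<alpha> h a = act h a"
  by (simp add: act_on_def \<alpha>_def tensor_lift_tens[OF module_H module_base module_base act_bilin])

lemma SW_base_cong:
  assumes "h \<in> carrier H"
    and f: "\<And>x y. \<lbrakk>x \<in> carrier H; y \<in> carrier H\<rbrakk> \<Longrightarrow> f x y \<in> base"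
    and "\<And>x y. \<lbrakk>x \<in> carrier H; y \<in> carrier H\<rbrakk> \<Longrightarrow> g x y = f x y"
  shows "sweedler A R H g h = SB f h"
proof -
  have "SB f h = sweedler A R H f h"
    by (rule SW_submodule(1)[OF module_B base_submodule assms(1,2)])
  also have "\<dots> = sweedler A R H g h"
    using assms by (intro SW_cong[OF module_base]) auto
  finally show ?thesis ..
qed

theorem base_symmetric_partial_action: "symmetric_partial_action R H A \<alpha>"
proof (intro symmetric_partial_action.intro partial_action.intro partial_action_axioms.intro
    symmetric_partial_action_axioms.intro hopf_algebra_axioms algebra_base)
  show "\<alpha> \<in> mod_hom R (tensor R H A) A"
    unfolding \<alpha>_def by (rule tensor_lift_hom[OF module_H module_base module_base act_bilin])
  fix a assume "a \<in> carrier A"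
  then have a: "a \<in> base" by simp
  note aB = base_B[OF a] and ac = base_cent[OF a]
  have "act \<one> a = \<pi> \<one> \<cdot> a \<cdot> \<pi> (S \<one>)"
    unfolding act_def by (rule SW_one) (assumption | rule bilinI linB aB)+
  then show "act_on R H A \<alpha> \<one> a = a"
    using a aB by (simp add: act_on_eq S_one pi_one)
  fix h assume h: "h \<in> carrier H"
  {
    fix b assume "b \<in> carrier A"
    then have b: "b \<in> base" by simp
    show "act_on R H A \<alpha> h (a \<otimes>\<^bsub>A\<^esub> b) =
        SW A (\<lambda>x y. act_on R H A \<alpha> x a \<otimes>\<^bsub>A\<^esub> act_on R H A \<alpha> y b) h"
      using a b h by (subst SW_base_cong[of h "\<lambda>x y. act x a \<cdot> act y b"])
        (auto simp: act_on_eq base_facts(3) act_base act_mult_cent[OF ac base_B])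
  }
  fix l assume l: "l \<in> carrier H"
  show "act_on R H A \<alpha> h (act_on R H A \<alpha> l a) =
      SW A (\<lambda>x y. act_on R H A \<alpha> x \<one>\<^bsub>A\<^esub> \<otimes>\<^bsub>A\<^esub> act_on R H A \<alpha> (y \<otimes> l) a) h"
    using a h l by (subst SW_base_cong[of h "\<lambda>x y. act x \<one>\<^bsub>B\<^esub> \<cdot> act (y \<otimes> l) a"])
      (auto simp: act_on_eq base_facts(2,3) act_base act_act[OF ac])
  show "act_on R H A \<alpha> h (act_on R H A \<alpha> l a) =
      SW A (\<lambda>x y. act_on R H A \<alpha> (x \<otimes> l) a \<otimes>\<^bsub>A\<^esub> act_on R H A \<alpha> y \<one>\<^bsub>A\<^esub>) h"
    using a h l by (subst SW_base_cong[of h "\<lambda>x y. act (x \<otimes> l) a \<cdot> act y \<one>\<^bsub>B\<^esub>"])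
      (auto simp: act_on_eq base_facts(2,3) act_base act_act_symmetric[OF ac])
qed

definition \<Phi> where "\<Phi> = tensor_lift B R (\<lambda>a h. a \<cdot> \<pi> h)"

abbreviation "AH \<equiv> tensor R A H"
abbreviation "unit \<equiv> tens R A H \<one>\<^bsub>B\<^esub> \<one>"

lemma Phi_bilin: "bilin R A H B (\<lambda>a h. a \<cdot> \<pi> h)"
proof (rule bilinI)
  fix a assume "a \<in> carrier A"
  then show "(\<lambda>h. a \<cdot> \<pi> h) \<in> mod_hom R H B"
    by (intro lin_mult_left[OF algebra_B] pi_hom) (simp add: base_B)
next
  fix h assume h: "h \<in> carrier H"
  show "(\<lambda>a. a \<cdot> \<pi> h) \<in> mod_hom R A B"
    by (rule mod_hom_on_submodule[OF lin_mult_right[OF algebra_B mod_hom_id] base_submodule])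
      (simp add: pi_closed h)
qed

lemma module_AH: "module R AH"
  by (rule tensor_module[OF module_base module_H])

lemma Phi_hom: "\<Phi> \<in> mod_hom R AH B"
  unfolding \<Phi>_def by (rule tensor_lift_hom[OF module_base module_H module_B Phi_bilin])

lemma Phi_tens: "\<lbrakk>a \<in> base; h \<in> carrier H\<rbrakk> \<Longrightarrow> \<Phi> (tens R A H a h) = a \<cdot> \<pi> h"
  unfolding \<Phi>_def by (rule tensor_lift_tens[OF module_base module_H module_B Phi_bilin]) simp_all

lemma AH_tens_closed: "\<lbrakk>a \<in> base; h \<in> carrier H\<rbrakk> \<Longrightarrow> tens R A H a h \<in> carrier AH"
  by (rule tens_closed[OF module_base module_H]) simp_all

interpretation AS: symmetric_partial_action R H A \<alpha>
  by (rule base_symmetric_partial_action)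

text \<open>
  On \<open>b \<otimes> y\<close> this is the rule \<open>(h\<^sub>1 \<rhd> b) \<pi>(h\<^sub>2 y) = \<pi>(h) b \<pi>(y)\<close>.
\<close>

lemma Phi_L:
  assumes h: "h \<in> carrier H" and t: "t \<in> carrier AH"
  shows "\<Phi> (AS.L h t) = \<pi> h \<cdot> \<Phi> t"
proof (rule tensor_hom_eqI[OF module_base module_H module_B _ _ _ t])
  show "(\<lambda>t. \<Phi> (AS.L h t)) \<in> mod_hom R AH B"
    by (rule mod_hom_compose[OF end_alg_hom[OF module_AH AS.L_closed[OF h]] Phi_hom])
  show "(\<lambda>t. \<pi> h \<cdot> \<Phi> t) \<in> mod_hom R AH B"
    by (rule lin_mult_left[OF algebra_B Phi_hom pi_closed[OF h]])
  fix b y assume "b \<in> carrier A" and y: "y \<in> carrier H"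
  then have b: "b \<in> base" by simp
  have "AS.L h (tens R A H b y) = SW AH (\<lambda>p q. tens R A H (act_on R H A \<alpha> p b) (q \<otimes> y)) h"
    using h b y by (intro AS.L_apply) auto
  also have "\<dots> = SW AH (\<lambda>p q. tens R A H (act p b) (q \<otimes> y)) h"
    using h b y by (intro SW_cong[OF module_AH])
      (auto simp only: act_on_eq intro!: AH_tens_closed act_base m_closed)
  finally have "\<Phi> (AS.L h (tens R A H b y)) = \<Phi> (SW AH (\<lambda>p q. tens R A H (act p b) (q \<otimes> y)) h)"
    by simp
  also have "\<dots> = SB (\<lambda>p q. \<Phi> (tens R A H (act p b) (q \<otimes> y))) h"
    using h b y by (intro SW_image module_AH module_B Phi_hom AH_tens_closed act_base) auto
  also have "\<dots> = SB (\<lambda>p q. act p b \<cdot> \<pi> (q \<otimes> y)) h"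
    using h b y by (intro SB_cong)
      (simp_all add: Phi_tens act_base base_B clB m_closed)
  also have "\<dots> = \<pi> h \<cdot> b \<cdot> \<pi> y"
    by (rule SB_act_pi_mult[OF base_cent[OF b] h y])
  finally show "\<Phi> (AS.L h (tens R A H b y)) = \<pi> h \<cdot> \<Phi> (tens R A H b y)"
    using h b y by (simp add: Phi_tens base_B pi_closed B.m_assoc)
qed

text \<open>
  The hypotheses say that \<open>B\<close> acts on \<open>A \<otimes> H\<close>, with \<open>\<pi>(h)\<close> acting as \<open>L\<^sub>h\<close>, and that \<open>B\<close> is generated by the
  image of \<open>\<pi>\<close>; both hold for \<open>H\<^sub>p\<^sub>a\<^sub>r\<close> by its universal property.
\<close>

theorem smash_iso:
  assumes g: "g \<in> alg_hom R B (end_alg R AH)"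
    and gpi: "\<And>h. h \<in> carrier H \<Longrightarrow> g (\<pi> h) = AS.L h"
    and gen: "\<And>N x. \<lbrakk>submodule N R B; \<one>\<^bsub>B\<^esub> \<in> N;
      \<And>h y. \<lbrakk>h \<in> carrier H; y \<in> N\<rbrakk> \<Longrightarrow> \<pi> h \<cdot> y \<in> N; x \<in> carrier B\<rbrakk> \<Longrightarrow> x \<in> N"
  shows "(\<lambda>x. g x unit) \<in> alg_iso R B (partial_smash R H A \<alpha>)"
proof -
  let ?\<psi> = "\<lambda>x. g x unit"
  let ?E = "end_alg R AH"
  note gm = alg_hom_mod_hom[OF g]
  note gc = mod_hom_closed[OF gm]
  note ap = end_alg_apply[OF module_AH]
  have u: "unit \<in> carrier AH" by (intro AH_tens_closed base_facts(2)) auto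
  have psi: "?\<psi> \<in> mod_hom R B AH"
    by (rule mod_hom_compose[OF gm end_alg_eval[OF module_AH u]])
  have psi_one: "?\<psi> \<one>\<^bsub>B\<^esub> = unit"
    using alg_hom_one[OF g] u by (simp add: ap)
  have psi_pi: "?\<psi> (\<pi> h \<cdot> y) = AS.L h (?\<psi> y)" if "h \<in> carrier H" "y \<in> carrier B" for h y
    using that u alg_hom_mult[OF g, of "\<pi> h" y] by (simp add: pi_closed gpi ap)
  \<comment> \<open>true for 1 and preserved by left multiplication with \<open>\<pi>(h)\<close>\<close>
  have Phi_psi: "\<Phi> (?\<psi> x) = x" if x: "x \<in> carrier B" for x
  proof -
    let ?N = "{x \<in> carrier B. \<Phi> (?\<psi> x) = x}"
    have "x \<in> ?N"
    proof (rule gen[OF _ _ _ x])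
      show "submodule ?N R B"
        by (rule submodule_equalizer[OF module_B module_B mod_hom_compose[OF psi Phi_hom] mod_hom_id])
      show "\<one>\<^bsub>B\<^esub> \<in> ?N"
        using psi_one by (simp add: Phi_tens base_facts(2) pi_one)
      fix h y assume "h \<in> carrier H" "y \<in> ?N"
      then show "\<pi> h \<cdot> y \<in> ?N"
        by (simp add: psi_pi Phi_L mod_hom_closed[OF psi] pi_closed)
    qed
    then show ?thesis by simp
  qed
  \<comment> \<open>both sides are multiplicative in \<open>a\<close>, and they agree on the generators\<close>
  have g_base: "g a = AS.lmult a" if a: "a \<in> base" for a
  proof -
    let ?N = "{a \<in> base. g a = AS.lmult a}"
    note lm = AS.lmult_hom
    have "subalg R B ?N"
    proof (rule subalgI[OF algebra_B])
      show "\<one>\<^bsub>B\<^esub> \<in> ?N"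
        using AS.lmult_one by (simp add: base_facts(2) alg_hom_one[OF g])
      fix x y assume xy: "x \<in> ?N" "y \<in> ?N"
      then show "x \<oplus>\<^bsub>B\<^esub> y \<in> ?N"
        using mod_hom_add[OF lm, of x y]
        by (simp add: base_B submodule_add[OF base_submodule] mod_hom_add[OF gm])
      show "x \<cdot> y \<in> ?N"
        using xy AS.lmult_mult[of x y]
        by (simp add: base_B base_facts(3) alg_hom_mult[OF g])
    next
      fix c x assume "c \<in> carrier R" "x \<in> ?N"
      then show "c \<odot>\<^bsub>B\<^esub> x \<in> ?N"
        using mod_hom_smult[OF lm, of c x]
        by (simp add: base_B submodule_smult[OF base_submodule] mod_hom_smult[OF gm])
    qed (auto simp: base_B)
    moreover have "e k \<in> ?N" if k: "k \<in> carrier H" for k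
    proof -
      have "g (e k) = SW ?E (\<lambda>x y. g (\<pi> x \<cdot> \<pi> (S y))) k"
        unfolding e_def
        by (rule SW_image[OF module_B end_alg_module[OF module_AH] gm k])
          (simp add: pi_closed S_closed)
      also have "\<dots> = SW ?E (\<lambda>x y. AS.L x \<otimes>\<^bsub>?E\<^esub> AS.L (S y)) k"
        using k by (intro SW_cong end_alg_module[OF module_AH] gc)
          (auto simp: pi_closed S_closed alg_hom_mult[OF g] gpi)
      also have "\<dots> = AS.lmult (act_on R H A \<alpha> k \<one>\<^bsub>A\<^esub>)"
        by (rule AS.SW_L_L_S[OF k])
      also have "act_on R H A \<alpha> k \<one>\<^bsub>A\<^esub> = e k"
        using k by (simp add: act_on_eq base_facts(2) act_one_eq)
      finally show ?thesis using k by (simp add: e_base)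
    qed
    ultimately have "base \<subseteq> ?N" by (rule base_least)
    then show ?thesis using a by auto
  qed
  \<comment> \<open>\<open>a \<pi>(h)\<close> acts as left smash multiplication by \<open>a \<otimes> h\<close>\<close>
  have psi_smash: "?\<psi> (\<Phi> t \<cdot> y) = AS.smash t (?\<psi> y)"
    if t: "t \<in> carrier AH" and y: "y \<in> carrier B" for t y
  proof (rule tensor_hom_eqI[OF module_base module_H module_AH _ _ _ t])
    show "(\<lambda>t. ?\<psi> (\<Phi> t \<cdot> y)) \<in> mod_hom R AH AH"
      by (rule mod_hom_compose[OF lin_mult_right[OF algebra_B Phi_hom y] psi])
    show "(\<lambda>t. AS.smash t (?\<psi> y)) \<in> mod_hom R AH AH"
      by (rule AS.smash_left_hom[OF mod_hom_closed[OF psi y]])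
    fix a h assume "a \<in> carrier A" and h: "h \<in> carrier H"
    then have a: "a \<in> base" by simp
    have "?\<psi> (\<Phi> (tens R A H a h) \<cdot> y) = g (a \<cdot> (\<pi> h \<cdot> y)) unit"
      using a h y by (simp add: Phi_tens base_B pi_closed B.m_assoc)
    also have "\<dots> = AS.lmult a (AS.L h (?\<psi> y))"
      using a h y u alg_hom_mult[OF g, of a "\<pi> h \<cdot> y"]
      by (simp add: base_B pi_closed ap g_base psi_pi)
    also have "\<dots> = AS.smash (tens R A H a h) (?\<psi> y)"
      using a h mod_hom_closed[OF psi y] by (intro AS.smash_tens[symmetric]) auto
    finally show "?\<psi> (\<Phi> (tens R A H a h) \<cdot> y) = AS.smash (tens R A H a h) (?\<psi> y)" .
  qed
  have Phi_closed: "t \<in> carrier AH \<Longrightarrow> \<Phi> t \<in> carrier B" for t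
    by (rule mod_hom_closed[OF Phi_hom])
  have psi_Phi: "AS.smash t unit = ?\<psi> (\<Phi> t)" if "t \<in> carrier AH" for t
    using psi_smash[OF that B.one_closed] psi_one Phi_closed[OF that] by simp
  have image: "?\<psi> ` carrier B = (\<lambda>t. AS.smash t unit) ` carrier AH"
  proof
    show "?\<psi> ` carrier B \<subseteq> (\<lambda>t. AS.smash t unit) ` carrier AH"
    proof
      fix t assume "t \<in> ?\<psi> ` carrier B"
      then obtain x where x: "x \<in> carrier B" "t = ?\<psi> x" by blast
      then have "t = AS.smash (?\<psi> x) unit"
        by (simp add: psi_Phi mod_hom_closed[OF psi] Phi_psi)
      then show "t \<in> (\<lambda>t. AS.smash t unit) ` carrier AH"
        using mod_hom_closed[OF psi x(1)] by blast
    qed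
    show "(\<lambda>t. AS.smash t unit) ` carrier AH \<subseteq> ?\<psi> ` carrier B"
      using Phi_closed by (auto simp: psi_Phi)
  qed
  have inj: "inj_on ?\<psi> (carrier B)"
    by (rule inj_on_inverseI[where g = \<Phi>]) (rule Phi_psi)
  have smash_one: "SW AH (\<lambda>x y. tens R A H (\<one>\<^bsub>A\<^esub> \<otimes>\<^bsub>A\<^esub> act_on R H A \<alpha> x \<one>\<^bsub>A\<^esub>) y) \<one> = unit"
  proof -
    have "SW AH (\<lambda>x y. tens R A H (\<one>\<^bsub>A\<^esub> \<otimes>\<^bsub>A\<^esub> act_on R H A \<alpha> x \<one>\<^bsub>A\<^esub>) y) \<one> =
        tens R A H (\<one>\<^bsub>A\<^esub> \<otimes>\<^bsub>A\<^esub> act_on R H A \<alpha> \<one> \<one>\<^bsub>A\<^esub>) \<one>"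
      by (rule SW_one[OF module_AH]) (assumption | rule bilinI AS.linV)+
    also have "\<dots> = unit"
      using AS.act_one[of "\<one>\<^bsub>B\<^esub>"] by (simp add: base_facts(2))
    finally show ?thesis .
  qed
  have simps: "carrier (partial_smash R H A \<alpha>) = ?\<psi> ` carrier B"
    "mult (partial_smash R H A \<alpha>) = AS.smash"
    "one (partial_smash R H A \<alpha>) = unit"
    "add (partial_smash R H A \<alpha>) = add AH"
    "smult (partial_smash R H A \<alpha>) = smult AH"
    unfolding image partial_smash_def smash_one by simp_all
  have "?\<psi> \<in> mod_hom R B (partial_smash R H A \<alpha>)"
    by (rule mod_homI) (auto simp: simps mod_hom_add[OF psi] mod_hom_smult[OF psi])
  moreover have "?\<psi> (x \<cdot> y) = AS.smash (?\<psi> x) (?\<psi> y)" if "x \<in> carrier B" "y \<in> carrier B" for x y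
    using psi_smash[OF mod_hom_closed[OF psi that(1)] that(2)] Phi_psi[OF that(1)] by simp
  ultimately have "?\<psi> \<in> alg_hom R B (partial_smash R H A \<alpha>)"
    by (intro alg_homI) (auto simp: simps psi_one)
  then show ?thesis
    using inj by (auto simp: alg_iso_def bij_betw_def simps)
qed

end

section \<open>The universal partial representation\<close>

context hopf_algebra
begin

abbreviation "TA \<equiv> tensor_algebra R H"
abbreviation "inT \<equiv> tensor_algebra_in R H"
abbreviation "HP \<equiv> H_par R H"
abbreviation "cls \<equiv> par_class R H"

lemma algebra_TA: "assoc_algebra R TA"
  by (rule tensor_algebra_algebra[OF module_H])

lemma module_TA: "module R TA"
  using algebra_TA by (simp add: assoc_algebra_def)

lemma inT_hom: "inT \<in> mod_hom R H TA"
  by (rule tensor_algebra_in_hom[OF module_H])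

interpretation TA: assoc_algebra R TA by (rule algebra_TA)

lemma inT_closed: "x \<in> carrier H \<Longrightarrow> inT x \<in> carrier TA"
  by (rule mod_hom_closed[OF inT_hom])

lemmas clT = inT_closed S_closed m_closed one_closed TA.m_closed TA.one_closed SW_closed[OF module_TA]

definition par_gens where "par_gens = {inT \<one> \<ominus>\<^bsub>TA\<^esub> \<one>\<^bsub>TA\<^esub>} \<union>
       {SW TA (\<lambda>x y. inT h \<otimes>\<^bsub>TA\<^esub> inT x \<otimes>\<^bsub>TA\<^esub> inT (S y)) l
          \<ominus>\<^bsub>TA\<^esub> SW TA (\<lambda>x y. inT (h \<otimes> x) \<otimes>\<^bsub>TA\<^esub> inT (S y)) l
         | h l. h \<in> carrier H \<and> l \<in> carrier H} \<union>
       {SW TA (\<lambda>x y. inT x \<otimes>\<^bsub>TA\<^esub> inT (S y) \<otimes>\<^bsub>TA\<^esub> inT l) h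
          \<ominus>\<^bsub>TA\<^esub> SW TA (\<lambda>x y. inT x \<otimes>\<^bsub>TA\<^esub> inT (S y \<otimes> l)) h
         | h l. h \<in> carrier H \<and> l \<in> carrier H} \<union>
       {SW TA (\<lambda>x y. inT h \<otimes>\<^bsub>TA\<^esub> inT (S x) \<otimes>\<^bsub>TA\<^esub> inT y) l
          \<ominus>\<^bsub>TA\<^esub> SW TA (\<lambda>x y. inT (h \<otimes> S x) \<otimes>\<^bsub>TA\<^esub> inT y) l
         | h l. h \<in> carrier H \<and> l \<in> carrier H} \<union>
       {SW TA (\<lambda>x y. inT (S x) \<otimes>\<^bsub>TA\<^esub> inT y \<otimes>\<^bsub>TA\<^esub> inT l) h
          \<ominus>\<^bsub>TA\<^esub> SW TA (\<lambda>x y. inT (S x) \<otimes>\<^bsub>TA\<^esub> inT (y \<otimes> l)) h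
         | h l. h \<in> carrier H \<and> l \<in> carrier H}"

lemma par_rels_eq: "par_rels R H = Idl\<^bsub>TA\<^esub> par_gens"
  by (simp only: par_rels_def par_gens_def Let_def)

lemma par_gens_closed: "par_gens \<subseteq> carrier TA"
  unfolding par_gens_def by (auto intro!: TA.minus_closed clT)

lemma par_rels_ideal: "ideal (par_rels R H) TA"
  unfolding par_rels_eq by (rule TA.genideal_ideal[OF par_gens_closed])

lemma par_gens_rels: "x \<in> par_gens \<Longrightarrow> x \<in> par_rels R H"
  unfolding par_rels_eq using TA.genideal_self[OF par_gens_closed] by auto

lemmas par_rels_submodule = ideal_submodule[OF algebra_TA par_rels_ideal]

lemma algebra_HP: "assoc_algebra R HP"
  unfolding H_par_def by (rule quot_algebra(1)[OF algebra_TA par_rels_ideal])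

abbreviation "\<kappa> \<equiv> (+>\<^bsub>TA\<^esub>) (par_rels R H)"

lemma kappa_hom: "\<kappa> \<in> alg_hom R TA HP"
  unfolding H_par_def by (rule quot_algebra(2)[OF algebra_TA par_rels_ideal])

lemma cls_eq: "cls h = \<kappa> (inT h)"
  by (simp add: par_class_def)

lemma module_HP: "module R HP"
  using algebra_HP by (simp add: assoc_algebra_def)

interpretation HP: assoc_algebra R HP by (rule algebra_HP)

lemma cls_hom: "cls \<in> mod_hom R H HP"
  using mod_hom_compose[OF inT_hom alg_hom_mod_hom[OF kappa_hom]]
  by (simp add: cls_eq[abs_def])

lemma kappa_SW:
  assumes "h \<in> carrier H" "\<And>x y. \<lbrakk>x \<in> carrier H; y \<in> carrier H\<rbrakk> \<Longrightarrow> f x y \<in> carrier TA"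
  shows "\<kappa> (SW TA f h) = SW HP (\<lambda>x y. \<kappa> (f x y)) h"
  by (rule SW_image[OF module_TA module_HP alg_hom_mod_hom[OF kappa_hom] assms])

lemma kappa_eqI: "\<lbrakk>x \<ominus>\<^bsub>TA\<^esub> y \<in> par_gens; x \<in> carrier TA; y \<in> carrier TA\<rbrakk> \<Longrightarrow> \<kappa> x = \<kappa> y"
  using coset_eq_iff[OF module_TA par_rels_submodule, of x y] par_gens_rels by blast

lemma cls_partial_rep: "partial_rep R H HP cls"
proof (intro partial_rep.intro partial_rep_axioms.intro hopf_algebra_axioms algebra_HP cls_hom)
  note km = alg_hom_mult[OF kappa_hom]
  note kc = mod_hom_closed[OF alg_hom_mod_hom[OF kappa_hom]]
  show "cls \<one> = \<one>\<^bsub>HP\<^esub>"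
    using kappa_eqI[of "inT \<one>" "\<one>\<^bsub>TA\<^esub>"] alg_hom_one[OF kappa_hom]
    by (simp add: cls_eq par_gens_def clT)
  have key: "SW HP f h = SW HP f' h"
    if h: "h \<in> carrier H"
      and mem: "SW TA k h \<ominus>\<^bsub>TA\<^esub> SW TA k' h \<in> par_gens"
      and k: "\<And>x y. \<lbrakk>x \<in> carrier H; y \<in> carrier H\<rbrakk> \<Longrightarrow> k x y \<in> carrier TA"
      and k': "\<And>x y. \<lbrakk>x \<in> carrier H; y \<in> carrier H\<rbrakk> \<Longrightarrow> k' x y \<in> carrier TA"
      and f: "\<And>x y. \<lbrakk>x \<in> carrier H; y \<in> carrier H\<rbrakk> \<Longrightarrow> \<kappa> (k x y) = f x y"
      and f': "\<And>x y. \<lbrakk>x \<in> carrier H; y \<in> carrier H\<rbrakk> \<Longrightarrow> \<kappa> (k' x y) = f' x y"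
    for f f' h k k'
  proof -
    have "SW HP f h = SW HP (\<lambda>x y. \<kappa> (k x y)) h"
      by (rule SW_cong[OF module_HP h, symmetric]) (simp_all add: kc k f[symmetric])
    also have "\<dots> = \<kappa> (SW TA k h)" using h k by (rule kappa_SW[symmetric])
    also have "\<dots> = \<kappa> (SW TA k' h)"
      using h k k' by (intro kappa_eqI mem SW_closed module_TA)
    also have "\<dots> = SW HP (\<lambda>x y. \<kappa> (k' x y)) h" using h k' by (rule kappa_SW)
    also have "\<dots> = SW HP f' h"
      by (rule SW_cong[OF module_HP h]) (simp_all add: kc k' f'[symmetric])
    finally show ?thesis .
  qed
  fix h l assume h: "h \<in> carrier H" and l: "l \<in> carrier H"
  have "SW TA (\<lambda>x y. inT h \<otimes>\<^bsub>TA\<^esub> inT x \<otimes>\<^bsub>TA\<^esub> inT (S y)) l \<ominus>\<^bsub>TA\<^esub> SW TA (\<lambda>x y. inT (h \<otimes> x) \<otimes>\<^bsub>TA\<^esub> inT (S y)) l \<in> par_gens"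
    using h l unfolding par_gens_def by blast
  then show "SW HP (\<lambda>x y. cls h \<otimes>\<^bsub>HP\<^esub> cls x \<otimes>\<^bsub>HP\<^esub> cls (S y)) l = SW HP (\<lambda>x y. cls (h \<otimes> x) \<otimes>\<^bsub>HP\<^esub> cls (S y)) l"
    by (rule key[OF l]) (use h l in \<open>simp_all add: clT km cls_eq\<close>)
  have "SW TA (\<lambda>x y. inT x \<otimes>\<^bsub>TA\<^esub> inT (S y) \<otimes>\<^bsub>TA\<^esub> inT l) h \<ominus>\<^bsub>TA\<^esub> SW TA (\<lambda>x y. inT x \<otimes>\<^bsub>TA\<^esub> inT (S y \<otimes> l)) h \<in> par_gens"
    using h l unfolding par_gens_def by blast
  then show "SW HP (\<lambda>x y. cls x \<otimes>\<^bsub>HP\<^esub> cls (S y) \<otimes>\<^bsub>HP\<^esub> cls l) h = SW HP (\<lambda>x y. cls x \<otimes>\<^bsub>HP\<^esub> cls (S y \<otimes> l)) h"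
    by (rule key[OF h]) (use h l in \<open>simp_all add: clT km cls_eq\<close>)
  have "SW TA (\<lambda>x y. inT h \<otimes>\<^bsub>TA\<^esub> inT (S x) \<otimes>\<^bsub>TA\<^esub> inT y) l \<ominus>\<^bsub>TA\<^esub> SW TA (\<lambda>x y. inT (h \<otimes> S x) \<otimes>\<^bsub>TA\<^esub> inT y) l \<in> par_gens"
    using h l unfolding par_gens_def by blast
  then show "SW HP (\<lambda>x y. cls h \<otimes>\<^bsub>HP\<^esub> cls (S x) \<otimes>\<^bsub>HP\<^esub> cls y) l = SW HP (\<lambda>x y. cls (h \<otimes> S x) \<otimes>\<^bsub>HP\<^esub> cls y) l"
    by (rule key[OF l]) (use h l in \<open>simp_all add: clT km cls_eq\<close>)
  have "SW TA (\<lambda>x y. inT (S x) \<otimes>\<^bsub>TA\<^esub> inT y \<otimes>\<^bsub>TA\<^esub> inT l) h \<ominus>\<^bsub>TA\<^esub> SW TA (\<lambda>x y. inT (S x) \<otimes>\<^bsub>TA\<^esub> inT (y \<otimes> l)) h \<in> par_gens"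
    using h l unfolding par_gens_def by blast
  then show "SW HP (\<lambda>x y. cls (S x) \<otimes>\<^bsub>HP\<^esub> cls y \<otimes>\<^bsub>HP\<^esub> cls l) h = SW HP (\<lambda>x y. cls (S x) \<otimes>\<^bsub>HP\<^esub> cls (y \<otimes> l)) h"
    by (rule key[OF h]) (use h l in \<open>simp_all add: clT km cls_eq\<close>)
qed

text \<open>
  A linear map into an algebra extends to the tensor algebra, and the identities of a partial
  representation say that the extension annihilates the generators of the ideal.
\<close>

lemma H_par_lift:
  assumes D: "partial_rep R H D \<rho>"
  obtains g where "g \<in> alg_hom R HP D" "\<And>h. h \<in> carrier H \<Longrightarrow> g (cls h) = \<rho> h"
proof -
  interpret D: partial_rep R H D \<rho> by fact
  obtain F where F: "F \<in> alg_hom R TA D" "\<And>x. x \<in> carrier H \<Longrightarrow> F (inT x) = \<rho> x"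
    using tensor_algebra_lift[OF module_H D.algebra_B D.pi_hom] by blast
  note Fm = alg_hom_mod_hom[OF F(1)]
  have F0: "F (SW TA k h \<ominus>\<^bsub>TA\<^esub> SW TA k' h) = \<zero>\<^bsub>D\<^esub>"
    if h: "h \<in> carrier H" and eq: "SW D f h = SW D f' h"
      and k: "\<And>x y. \<lbrakk>x \<in> carrier H; y \<in> carrier H\<rbrakk> \<Longrightarrow> k x y \<in> carrier TA"
      and k': "\<And>x y. \<lbrakk>x \<in> carrier H; y \<in> carrier H\<rbrakk> \<Longrightarrow> k' x y \<in> carrier TA"
      and f: "\<And>x y. \<lbrakk>x \<in> carrier H; y \<in> carrier H\<rbrakk> \<Longrightarrow> F (k x y) = f x y"
      and f': "\<And>x y. \<lbrakk>x \<in> carrier H; y \<in> carrier H\<rbrakk> \<Longrightarrow> F (k' x y) = f' x y"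
    for f f' h k k'
  proof -
    have 1: "F (SW TA k h) = SW D f h" if k: "\<And>x y. \<lbrakk>x \<in> carrier H; y \<in> carrier H\<rbrakk> \<Longrightarrow> k x y \<in> carrier TA"
      and f: "\<And>x y. \<lbrakk>x \<in> carrier H; y \<in> carrier H\<rbrakk> \<Longrightarrow> F (k x y) = f x y" for k f
    proof -
      have "F (SW TA k h) = SW D (\<lambda>x y. F (k x y)) h"
        using h k by (rule SW_image[OF module_TA D.module_B Fm])
      also have "\<dots> = SW D f h"
        using k f by (intro SW_cong D.module_B h mod_hom_closed[OF Fm])
      finally show ?thesis .
    qed
    have c: "SW TA k h \<in> carrier TA" "SW TA k' h \<in> carrier TA"
      using h k k' by (auto intro!: SW_closed module_TA)
    have "F (SW TA k h) = F (SW TA k' h)"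
      using 1[of k f, OF k f] 1[of k' f', OF k' f'] eq by simp
    then show ?thesis
      using mod_hom_closed[OF Fm c(2)]
      by (simp add: mod_hom_minus[OF module_TA D.module_B Fm c]
          module_minus_eq_zero_iff[OF D.module_B])
  qed
  have "par_gens \<subseteq> {x \<in> carrier TA. F x = \<zero>\<^bsub>D\<^esub>}"
  proof
    fix x assume x: "x \<in> par_gens"
    note Fx = alg_hom_mult[OF F(1)] F(2) clT
    have "F (inT \<one> \<ominus>\<^bsub>TA\<^esub> \<one>\<^bsub>TA\<^esub>) = \<zero>\<^bsub>D\<^esub>"
      by (simp add: mod_hom_minus[OF module_TA D.module_B Fm] Fx alg_hom_one[OF F(1)] D.pi_one
          module_minus_eq_zero_iff[OF D.module_B])
    moreover note F0[OF _ D.mult_eps] F0[OF _ D.eps_mult] F0[OF _ D.mult_eps'] F0[OF _ D.eps'_mult]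
    ultimately have "F x = \<zero>\<^bsub>D\<^esub>"
      using x unfolding par_gens_def
      by (elim UnE CollectE exE conjE singletonE) (simp_all add: Fx)
    then show "x \<in> {x \<in> carrier TA. F x = \<zero>\<^bsub>D\<^esub>}" using x par_gens_closed by auto
  qed
  then have "par_rels R H \<subseteq> {x \<in> carrier TA. F x = \<zero>\<^bsub>D\<^esub>}"
    unfolding par_rels_eq
    by (rule TA.genideal_minimal[OF alg_hom_kernel_ideal[OF algebra_TA D.algebra_B F(1)]])
  then obtain g where g: "g \<in> alg_hom R HP D" "\<And>x. x \<in> carrier TA \<Longrightarrow> g (\<kappa> x) = F x"
    using quot_lift[OF algebra_TA par_rels_ideal D.algebra_B F(1)]
    unfolding H_par_def by blast
  show ?thesis
    by (rule that[OF g(1)]) (simp add: cls_eq g(2) inT_closed F(2))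
qed

lemma H_par_span:
  assumes N: "submodule N R HP" and one: "\<one>\<^bsub>HP\<^esub> \<in> N"
    and mult: "\<And>h y. \<lbrakk>h \<in> carrier H; y \<in> N\<rbrakk> \<Longrightarrow> cls h \<otimes>\<^bsub>HP\<^esub> y \<in> N"
    and x: "x \<in> carrier HP"
  shows "x \<in> N"
proof -
  note km = alg_hom_mod_hom[OF kappa_hom]
  obtain t where t: "t \<in> carrier TA" "x = \<kappa> t"
    using x by (auto simp: H_par_def quot_simps(1))
  let ?N = "{t \<in> carrier TA. \<kappa> t \<in> N}"
  have "submodule ?N R TA"
    using mod_hom_zero[OF module_TA module_HP km]
    by (intro submodule_criterion module_TA)
      (auto simp: mod_hom_add[OF km] mod_hom_smult[OF km] submodule_zero[OF N]
        submodule_add[OF N] submodule_smult[OF N])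
  then have "t \<in> ?N"
  proof (rule tensor_algebra_span[OF module_H _ _ _ t(1)])
    show "\<one>\<^bsub>TA\<^esub> \<in> ?N" using one alg_hom_one[OF kappa_hom] by simp
    fix h y assume "h \<in> carrier H" "y \<in> ?N"
    then show "inT h \<otimes>\<^bsub>TA\<^esub> y \<in> ?N"
      using mult by (simp add: alg_hom_mult[OF kappa_hom] clT cls_eq)
  qed
  then show ?thesis using t by simp
qed

end

theorem theorem4p8:
  fixes R :: "'k ring" and H :: "('k, 'h) hopf"
  assumes "hopf_algebra R H"
  shows "\<exists>\<alpha>. partial_action R H (A_par R H) \<alpha> \<and>
    (\<exists>\<phi>. \<phi> \<in> alg_iso R (H_par R H) (partial_smash R H (A_par R H) \<alpha>))"
proof -
  interpret hopf_algebra R H by fact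
  interpret P: partial_rep R H "H_par R H" "par_class R H"
    by (rule cls_partial_rep)
  have "par_eps R H = P.e"
    by (intro ext) (simp add: par_eps_def P.e_def)
  then have A: "A_par R H = (H_par R H)\<lparr>carrier := P.base\<rparr>"
    by (simp add: A_par_def P.base_def)
  interpret AS: symmetric_partial_action R H "A_par R H" P.\<alpha>
    unfolding A by (rule P.base_symmetric_partial_action)
  obtain g where g: "g \<in> alg_hom R (H_par R H) (end_alg R (tensor R (A_par R H) H))"
    "\<And>h. h \<in> carrier H \<Longrightarrow> g (par_class R H h) = AS.L h"
    using H_par_lift[OF AS.L_partial_rep] by blast
  have "(\<lambda>x. g x P.unit) \<in> alg_iso R (H_par R H) (partial_smash R H (A_par R H) P.\<alpha>)"
    unfolding A
    by (rule P.smash_iso[OF g[unfolded A]]) (assumption | rule H_par_span | blast)+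
  then show ?thesis
    using AS.partial_action_axioms by blast
qed

end
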